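(* Fix $n=4$, $d=2$ and $\lambda\in(0,1)$, and let $\mathcal D_\lambda:S_1^n\to S_1^n$, $\mathcal D_\lambda(\rho)=\lambda\rho+(1-\lambda)\frac1n\mathrm{tr}(\rho)\mathbf 1_n$, be the quantum depolarizing channel. Then $$C^{d^2}_{prod}(\mathcal D_\lambda\otimes\mathcal D_\lambda)>2\,C^d_{prod}(\mathcal D_\lambda).$$ Hence $$C^d(\mathcal D_\lambda)>C^d_{prod}(\mathcal D_\lambda).$$
   Context: $\mathbf 1_n$ is the identity of $M_n$; $S_1^n$ is $M_n$ with the trace norm. A quantum channel $\mathcal N:S_1^n\to S_1^m$ is a completely positive trace preserving map $M_n\to M_m$. A state is a positive semidefinite matrix of trace one; $S(\rho)=-\mathrm{tr}(\rho\log_2\rho)$ (with $0\log_20=0$). For a natural number $d$, the product state classical capacity with assisted entanglement restricted to dimension $d$ is $$C^d_{prod}(\mathcal N)=\sup\Big\{S\Big(\sum_{i=1}^N\lambda_i\,\mathcal N\big((\mathrm{tr}_d\otimes \mathrm{id}_n)(\rho_i)\big)\Big)+\sum_{i=1}^N\lambda_i\Big[S\big((\mathrm{id}_d\otimes \mathrm{tr}_n)(\rho_i)\big)-S\big((\mathrm{id}_d\otimes\mathcal N)(\rho_i)\big)\Big]\Big\},$$ the supremum over all $N\in\mathbb N$, probability distributions $(\lambda_i)_{i=1}^N$ and states $\rho_i\in S_1^d\otimes S_1^n$ (with $\mathrm{tr}_k$ the trace on $M_k$). Its regularization is $$C^d(\mathcal N)=\sup_{k\ge1}\frac{C^{d^k}_{prod}(\mathcal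 N^{\otimes k})}{k}.$$ *)

theory Defs
  imports
    "HOL-Library.Extended_Real"
    "Jordan_Normal_Form.Schur_Decomposition"
begin

section \<open>Complex matrices\<close>

definition mat_trace :: "complex mat \<Rightarrow> complex" where
  "mat_trace A = (\<Sum>i<dim_row A. A $$ (i, i))"

text \<open>The order on \<^typ>\<open>complex\<close> is the one in which \<^prop>\<open>0 \<le> z\<close> says that \<^term>\<open>z\<close> is real and
  nonnegative.\<close>

definition positive_semidefinite :: "nat \<Rightarrow> complex mat \<Rightarrow> bool" where
  "positive_semidefinite n A \<longleftrightarrow>
     A \<in> carrier_mat n n \<and> mat_adjoint A = A \<and>
     (\<forall>v \<in> carrier_vec n. 0 \<le> (A *\<^sub>v v) \<bullet>c v)"

definition state :: "nat \<Rightarrow> complex mat \<Rightarrow> bool" where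
  "state n A \<longleftrightarrow> positive_semidefinite n A \<and> mat_trace A = 1"

definition unitary :: "nat \<Rightarrow> complex mat \<Rightarrow> bool" where
  "unitary n U \<longleftrightarrow> U \<in> carrier_mat n n \<and> mat_adjoint U * U = 1\<^sub>m n \<and> U * mat_adjoint U = 1\<^sub>m n"

text \<open>Functional calculus for Hermitian matrices. The result does not depend on the unitary
  diagonalization (lemma \<open>herm_fun_eq\<close> below).\<close>

definition herm_fun :: "(real \<Rightarrow> real) \<Rightarrow> complex mat \<Rightarrow> complex mat" where
  "herm_fun f A = (THE B. \<exists>U e. unitary (dim_row A) U \<and>
     A = U * mat_diag (dim_row A) (\<lambda>i. complex_of_real (e i)) * mat_adjoint U \<and>
     B = U * mat_diag (dim_row A) (\<lambda>i. complex_of_real (f (e i))) * mat_adjoint U)"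

text \<open>Since \<^prop>\<open>log 2 0 = (0 :: real)\<close> in HOL, \<^term>\<open>herm_fun (log 2) A\<close> vanishes on the kernel of \<^term>\<open>A\<close>;
  this realizes the convention \<open>0 log 0 = 0\<close>.\<close>

definition entropy :: "complex mat \<Rightarrow> real" where
  "entropy A = - Re (mat_trace (A * herm_fun (log 2) A))"

section \<open>Tensor products and partial traces\<close>

text \<open>The basis vector \<open>e\<^sub>i \<otimes> f\<^sub>k\<close> of a tensor product with second factor of dimension \<open>n\<close> has
  index \<open>i * n + k\<close>.\<close>

definition kron :: "complex mat \<Rightarrow> complex mat \<Rightarrow> complex mat" where
  "kron A B = mat (dim_row A * dim_row B) (dim_col A * dim_col B)
     (\<lambda>(r, s). A $$ (r div dim_row B, s div dim_col B) * B $$ (r mod dim_row B, s mod dim_col B))"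

definition mat_unit :: "nat \<Rightarrow> nat \<Rightarrow> nat \<Rightarrow> complex mat" where
  "mat_unit n i j = mat n n (\<lambda>(r, s). if r = i \<and> s = j then 1 else 0)"

text \<open>For linear maps \<open>F : M\<^sub>n \<rightarrow> M\<^sub>m\<close> and \<open>G : M\<^sub>n\<^sub>' \<rightarrow> M\<^sub>m\<^sub>'\<close>, \<open>map_tensor n m n' m' F G\<close> is
  \<open>F \<otimes> G\<close>: the matrix \<open>X = \<Sum> X\<^bsub>(i,k),(j,l)\<^esub> E\<^sub>i\<^sub>j \<otimes> E\<^sub>k\<^sub>l\<close> is sent to
  \<open>\<Sum> X\<^bsub>(i,k),(j,l)\<^esub> F(E\<^sub>i\<^sub>j) \<otimes> G(E\<^sub>k\<^sub>l)\<close>.\<close>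

definition map_tensor :: "nat \<Rightarrow> nat \<Rightarrow> nat \<Rightarrow> nat \<Rightarrow>
    (complex mat \<Rightarrow> complex mat) \<Rightarrow> (complex mat \<Rightarrow> complex mat) \<Rightarrow> complex mat \<Rightarrow> complex mat" where
  "map_tensor n m n' m' F G X = mat (m * m') (m * m')
     (\<lambda>(r, s). \<Sum>i<n. \<Sum>j<n. \<Sum>k<n'. \<Sum>l<n'.
        X $$ (i * n' + k, j * n' + l) * kron (F (mat_unit n i j)) (G (mat_unit n' k l)) $$ (r, s))"

text \<open>\<open>map_tensor_pow n m F k\<close> is \<open>F\<^bsup>\<otimes>k\<^esup> : M\<^bsub>n^k\<^esub> \<rightarrow> M\<^bsub>m^k\<^esub>\<close>.\<close>

primrec map_tensor_pow :: "nat \<Rightarrow> nat \<Rightarrow> (complex mat \<Rightarrow> complex mat) \<Rightarrow> nat \<Rightarrow>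
    complex mat \<Rightarrow> complex mat" where
  "map_tensor_pow n m F 0 = (\<lambda>X. X)"
| "map_tensor_pow n m F (Suc k) = map_tensor n m (n ^ k) (m ^ k) F (map_tensor_pow n m F k)"

text \<open>On \<open>M\<^sub>d \<otimes> M\<^sub>n\<close>, \<open>ptrace_fst d n\<close> is \<open>tr\<^sub>d \<otimes> id\<^sub>n\<close> and \<open>ptrace_snd d n\<close> is \<open>id\<^sub>d \<otimes> tr\<^sub>n\<close>.\<close>

definition ptrace_fst :: "nat \<Rightarrow> nat \<Rightarrow> complex mat \<Rightarrow> complex mat" where
  "ptrace_fst d n X = mat n n (\<lambda>(i, j). \<Sum>a<d. X $$ (a * n + i, a * n + j))"

definition ptrace_snd :: "nat \<Rightarrow> nat \<Rightarrow> complex mat \<Rightarrow> complex mat" where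
  "ptrace_snd d n X = mat d d (\<lambda>(a, b). \<Sum>i<n. X $$ (a * n + i, b * n + i))"

section \<open>Capacities\<close>

text \<open>\<open>mixture m K p R\<close> is \<open>\<Sum>\<^bsub>i = 1..K\<^esub> p\<^sub>i R\<^sub>i\<close> in \<open>M\<^sub>m\<close>.\<close>

definition mixture :: "nat \<Rightarrow> nat \<Rightarrow> (nat \<Rightarrow> real) \<Rightarrow> (nat \<Rightarrow> complex mat) \<Rightarrow> complex mat" where
  "mixture m K p R = mat m m (\<lambda>(r, s). \<Sum>i = 1..K. complex_of_real (p i) * R i $$ (r, s))"

definition prod_rate :: "nat \<Rightarrow> nat \<Rightarrow> nat \<Rightarrow> (complex mat \<Rightarrow> complex mat) \<Rightarrow>
    nat \<Rightarrow> (nat \<Rightarrow> real) \<Rightarrow> (nat \<Rightarrow> complex mat) \<Rightarrow> real" where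
  "prod_rate n m d F K p \<rho> =
     entropy (mixture m K p (\<lambda>i. F (ptrace_fst d n (\<rho> i)))) +
     (\<Sum>i = 1..K. p i *
        (entropy (ptrace_snd d n (\<rho> i)) - entropy (map_tensor d d n m (\<lambda>X. X) F (\<rho> i))))"

text \<open>The capacities of \<open>F : M\<^sub>n \<rightarrow> M\<^sub>m\<close>. Suprema are taken in \<^typ>\<open>ereal\<close>, where they always exist; for
  quantum channels and positive dimensions both capacities are finite.\<close>

definition C_prod :: "nat \<Rightarrow> nat \<Rightarrow> nat \<Rightarrow> (complex mat \<Rightarrow> complex mat) \<Rightarrow> ereal" where
  "C_prod n m d F = Sup {ereal (prod_rate n m d F K p \<rho>) | K p \<rho>.
     (\<forall>i \<in> {1..K}. 0 \<le> p i) \<and> (\<Sum>i = 1..K. p i) = 1 \<and> (\<forall>i \<in> {1..K}. state (d * n) (\<rho> i))}"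

definition C_reg :: "nat \<Rightarrow> nat \<Rightarrow> nat \<Rightarrow> (complex mat \<Rightarrow> complex mat) \<Rightarrow> ereal" where
  "C_reg n m d F =
     (SUP k \<in> {1..}. C_prod (n ^ k) (m ^ k) (d ^ k) (map_tensor_pow n m F k) / ereal (real k))"

definition depolarizing :: "nat \<Rightarrow> real \<Rightarrow> complex mat \<Rightarrow> complex mat" where
  "depolarizing n \<mu> \<rho> =
     complex_of_real \<mu> \<cdot>\<^sub>m \<rho> + (complex_of_real ((1 - \<mu>) / real n) * mat_trace \<rho>) \<cdot>\<^sub>m 1\<^sub>m n"

section \<open>Well-definedness of the functional calculus\<close>

lemma herm_fun_unique:
  assumes U: "unitary n U" and V: "unitary n V"
    and eq: "U * mat_diag n (\<lambda>i. complex_of_real (d i)) * mat_adjoint U =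
             V * mat_diag n (\<lambda>i. complex_of_real (e i)) * mat_adjoint V"
  shows "U * mat_diag n (\<lambda>i. complex_of_real (f (d i))) * mat_adjoint U =
         V * mat_diag n (\<lambda>i. complex_of_real (f (e i))) * mat_adjoint V"
proof -
  let ?U' = "mat_adjoint U" and ?V' = "mat_adjoint V"
  let ?D = "\<lambda>g. mat_diag n (\<lambda>i. complex_of_real (g i))"
  have Uc: "U \<in> carrier_mat n n" and Vc: "V \<in> carrier_mat n n"
    using U V by (auto simp: unitary_def)
  have U'c: "?U' \<in> carrier_mat n n" and V'c: "?V' \<in> carrier_mat n n"
    using Uc Vc by (auto simp: mat_adjoint_def)
  have Dc: "?D g \<in> carrier_mat n n" for g by simp
  note assoc = assoc_mult_mat[of _ n n _ n _ n] mult_carrier_mat[of _ n n _ n]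
  define W where "W = ?V' * U"
  have Wc: "W \<in> carrier_mat n n" using V'c Uc by (simp add: W_def)
  have "?V' * (U * ?D d * ?U') * U = (?V' * U) * (?D d * (?U' * U))"
    using Vc Uc U'c V'c Dc by (simp add: assoc)
  also have "\<dots> = W * ?D d"
    using U right_mult_one_mat[OF Dc[of d]] by (simp add: W_def unitary_def)
  finally have "W * ?D d = ?V' * (U * ?D d * ?U') * U" by simp
  also have "\<dots> = ?V' * (V * ?D e * ?V') * U" by (simp add: eq)
  also have "\<dots> = (?V' * V) * (?D e * (?V' * U))"
    using Vc Uc V'c Dc by (simp add: assoc)
  also have "\<dots> = ?D e * W"
    using V left_mult_one_mat[OF mult_carrier_mat[OF Dc[of e] Wc]]
    by (simp add: W_def[symmetric] unitary_def)
  finally have WD: "W * ?D d = ?D e * W" .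
  have "W * ?D (\<lambda>i. f (d i)) = ?D (\<lambda>i. f (e i)) * W"
  proof (rule eq_matI)
    fix i j assume "i < dim_row (?D (\<lambda>i. f (e i)) * W)" "j < dim_col (?D (\<lambda>i. f (e i)) * W)"
    then have ij: "i < n" "j < n" using Wc by (auto simp: mat_diag_def)
    have "(W * ?D d) $$ (i, j) = (?D e * W) $$ (i, j)" by (simp add: WD)
    then have "W $$ (i, j) * complex_of_real (d j) = complex_of_real (e i) * W $$ (i, j)"
      using ij Wc by (simp add: mat_diag_mult_left[OF Wc] mat_diag_mult_right[OF Wc])
    then have "W $$ (i, j) = 0 \<or> d j = e i" by (auto simp: mult.commute)
    then show "(W * ?D (\<lambda>i. f (d i))) $$ (i, j) = (?D (\<lambda>i. f (e i)) * W) $$ (i, j)"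
      using ij Wc by (auto simp: mat_diag_mult_left[OF Wc] mat_diag_mult_right[OF Wc])
  qed (use Wc in \<open>auto simp: mat_diag_def\<close>)
  then have WF: "W * ?D (\<lambda>i. f (d i)) = ?D (\<lambda>i. f (e i)) * W" .
  have "U * ?D (\<lambda>i. f (d i)) * ?U' = (V * ?V') * (U * ?D (\<lambda>i. f (d i)) * ?U')"
    using V left_mult_one_mat[OF mult_carrier_mat[OF mult_carrier_mat[OF Uc Dc] U'c]]
    by (simp add: unitary_def)
  also have "\<dots> = V * (W * ?D (\<lambda>i. f (d i))) * ?U'"
    using Uc Vc U'c V'c Dc by (simp add: W_def assoc)
  also have "\<dots> = V * (?D (\<lambda>i. f (e i)) * W) * ?U'" by (simp add: WF)
  also have "\<dots> = V * ?D (\<lambda>i. f (e i)) * (?V' * (U * ?U'))"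
    using Uc Vc U'c V'c Dc by (simp add: W_def assoc)
  also have "\<dots> = V * ?D (\<lambda>i. f (e i)) * ?V'"
    using U right_mult_one_mat[OF V'c] by (simp add: unitary_def)
  finally show ?thesis .
qed

lemma herm_fun_eq:
  assumes U: "unitary n U"
    and A: "A = U * mat_diag n (\<lambda>i. complex_of_real (e i)) * mat_adjoint U"
  shows "herm_fun f A = U * mat_diag n (\<lambda>i. complex_of_real (f (e i))) * mat_adjoint U"
proof -
  have "dim_row A = n" using U A by (auto simp: unitary_def)
  moreover have "B = U * mat_diag n (\<lambda>i. complex_of_real (f (e i))) * mat_adjoint U"
    if "unitary n V" and "A = V * mat_diag n (\<lambda>i. complex_of_real (g i)) * mat_adjoint V"
      and "B = V * mat_diag n (\<lambda>i. complex_of_real (f (g i))) * mat_adjoint V" for B V g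
    using herm_fun_unique[of n V U g e f] U A that by simp
  ultimately show ?thesis
    unfolding herm_fun_def using U A by (intro the_equality) blast+
qed

end

theory Submission
  imports Defs "Jordan_Normal_Form.Spectral_Radius" "HOL-Real_Asymp.Real_Asymp" "HOL-Analysis.Convex"
begin

text \<open>
  Write \<open>R(M)\<close> for \<open>log M\<close> minus the entropy of a depolarized pure state in dimension \<open>M\<close>, with the
  depolarizing parameter \<open>\<mu>\<close> fixed. The theorem compares two ways of spending the entanglement: two
  copies of the channel can use a maximally entangled state of dimension \<open>4\<close> on the first copy and
  none on the second, which yields \<open>R(16) + R(4)\<close>, while a single copy with entanglement of dimension \<open>2\<close>
  never exceeds \<open>R(8)\<close>. Since \<open>R\<close> is strictly convex as a function of \<open>log M\<close> and \<open>8\<close> is the geometric mean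
  of \<open>4\<close> and \<open>16\<close>, we have \<open>R(16) + R(4) > 2 R(8)\<close>. So concentrating the entanglement is better than
  spreading it evenly.

  The upper bound for one copy has to hold for arbitrary mixed inputs. The average output contributes at most
  \<open>log n\<close>. For a single input \<open>\<rho>\<close> with reference marginal \<open>\<rho>\<^sub>A\<close> the channel output is
  \<open>\<sigma> = \<mu> \<rho> + (1 - \<mu>) T\<close> with \<open>T = \<rho>\<^sub>A \<otimes> 1/n\<close>, and the entropy of \<open>\<rho>\<^sub>A\<close> minus the entropy of
  \<open>\<sigma>\<close> is the relative entropy of \<open>\<sigma>\<close> and \<open>T\<close> minus \<open>log n\<close>. Since the reference system has dimension \<open>d\<close>, we have \<open>\<rho> \<le> d (\<rho>\<^sub>A \<otimes> 1) = d n T\<close>.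
  Under such a domination with factor \<open>M\<close> the relative entropy is at most \<open>R(M)\<close>: this is the theorem
  \<open>relative_entropy_le_max_divergence\<close>, the analytic core. It is an instance of monotonicity of relative
  entropy, and it is obtained from spectral double sums alone, by comparing second derivatives along the
  segment from \<open>T\<close> to \<open>\<rho>\<close>.

  The lower bound \<open>C_prod_two_depolarizing_ge\<close> evaluates the rate of an explicit ensemble, the convexity is
  \<open>pure_rate_log_convex\<close>, and the strict inequality for the regularized capacity follows from its term for two
  copies.
\<close>

section \<open>Adjoints and the spectral theorem\<close>

lemma dim_mat_adjoint [simp]:
  "dim_row (mat_adjoint A) = dim_col A" "dim_col (mat_adjoint A) = dim_row A"
  by (auto simp: mat_adjoint_def)

lemma mat_adjoint_carrier [simp]: "A \<in> carrier_mat n m \<Longrightarrow> mat_adjoint A \<in> carrier_mat m n"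
  by (intro carrier_matI) auto

lemma index_mat_adjoint [simp]:
  "i < dim_col A \<Longrightarrow> j < dim_row A \<Longrightarrow> mat_adjoint (A :: complex mat) $$ (i, j) = cnj (A $$ (j, i))"
  by (auto simp: mat_adjoint_def mat_of_rows_def)

lemma mat_adjoint_adjoint [simp]: "mat_adjoint (mat_adjoint A) = (A :: complex mat)"
  by (rule eq_matI) auto

lemma mat_adjoint_mult:
  fixes A B :: "complex mat"
  assumes "A \<in> carrier_mat n m" "B \<in> carrier_mat m l"
  shows "mat_adjoint (A * B) = mat_adjoint B * mat_adjoint A"
  by (rule eq_matI) (use assms in \<open>auto simp: scalar_prod_def mult.commute intro!: sum.cong\<close>)

lemma mat_adjoint_one [simp]: "mat_adjoint (1\<^sub>m n :: complex mat) = 1\<^sub>m n"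
  by (rule eq_matI) auto

lemma unitaryD:
  assumes "unitary n U"
  shows "U \<in> carrier_mat n n" "mat_adjoint U \<in> carrier_mat n n"
    "mat_adjoint U * U = 1\<^sub>m n" "U * mat_adjoint U = 1\<^sub>m n"
  using assms by (auto simp: unitary_def)

lemma unitaryI:
  assumes "U \<in> carrier_mat n n" "mat_adjoint U * U = 1\<^sub>m n"
  shows "unitary n U"
  using assms mat_mult_left_right_inverse[of "mat_adjoint U" n U] by (auto simp: unitary_def)

lemma unitary_one [simp]: "unitary n (1\<^sub>m n)"
  by (auto simp: unitary_def)

lemma unitary_adjoint: "unitary n U \<Longrightarrow> unitary n (mat_adjoint U)"
  by (auto simp: unitary_def)

lemma unitary_mult:
  assumes U: "unitary n U" and V: "unitary n V"
  shows "unitary n (U * V)"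
proof (rule unitaryI)
  note c = unitaryD[OF U] unitaryD[OF V]
  show "U * V \<in> carrier_mat n n" using c by auto
  have "mat_adjoint (U * V) * (U * V) = mat_adjoint V * (mat_adjoint U * (U * V))"
    using c(1,2,5,6) by (simp add: mat_adjoint_mult[of U n n V n] assoc_mult_mat[of _ n n _ n _ n]
        mult_carrier_mat[of _ n n _ n])
  also have "mat_adjoint U * (U * V) = (mat_adjoint U * U) * V"
    using c(1,2,5) by (simp add: assoc_mult_mat[of _ n n _ n _ n])
  also have "mat_adjoint V * (mat_adjoint U * U * V) = 1\<^sub>m n" using c by simp
  finally show "mat_adjoint (U * V) * (U * V) = 1\<^sub>m n" .
qed

text \<open>Gram-Schmidt only provides orthogonal columns, so each one is divided by its length afterwards.\<close>

lemma unitary_with_first_column: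
  fixes v :: "complex vec"
  assumes v: "v \<in> carrier_vec n" and v0: "v \<noteq> 0\<^sub>v n"
  obtains U c where "unitary n U" "col U 0 = c \<cdot>\<^sub>v v"
proof -
  define b where "b = basis_completion v"
  define ws where "ws = gram_schmidt n b"
  define W where "W = mat_of_cols n ws"
  interpret cof_vec_space n "TYPE(complex)" .
  from basis_completion[OF v v0, folded b_def]
  have dist_b: "distinct b" and indep: "\<not> lin_dep (set b)" and b: "set b \<subseteq> carrier_vec n"
    and hdb: "hd b = v" and len_b: "length b = n" by auto
  have n: "n \<noteq> 0" using v v0 by (intro notI) auto
  from hdb len_b n obtain vs where bv: "b = v # vs" by (cases b, auto)
  from gram_schmidt_result[OF b dist_b indep refl, folded ws_def]
  have ws: "set ws \<subseteq> carrier_vec n" "corthogonal ws" "length ws = n"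
    by (auto simp: len_b)
  from gram_schmidt_hd[OF v, of vs, folded bv] have hdws: "hd ws = v" unfolding ws_def .
  have orth: "corthogonal_mat W" using orthogonal_mat_of_cols ws unfolding W_def by blast
  have W: "W \<in> carrier_mat n n" using ws unfolding W_def using mat_of_cols_carrier(1)[of n ws] by auto
  define d where "d i = Re (col W i \<bullet>c col W i)" for i
  have dpos: "0 < d i" and dre: "col W i \<bullet>c col W i = complex_of_real (d i)" if "i < n" for i
  proof -
    have "col W i \<bullet>c col W i \<noteq> 0" using corthogonal_matD[OF orth, of i i] that W by auto
    moreover have "0 \<le> col W i \<bullet>c col W i" by auto
    ultimately show "0 < d i" "col W i \<bullet>c col W i = complex_of_real (d i)"
      by (auto simp: d_def less_eq_complex_def complex_eq_iff)
  qed
  define U where "U = W * mat_diag n (\<lambda>i. complex_of_real (1 / sqrt (d i)))"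
  have U: "U \<in> carrier_mat n n" using W by (auto simp: U_def)
  have Ue: "U $$ (i, j) = W $$ (i, j) * complex_of_real (1 / sqrt (d j))" if "i < n" "j < n" for i j
    using that W by (simp add: U_def mat_diag_mult_right[OF W])
  have "mat_adjoint U * U = 1\<^sub>m n"
  proof (rule eq_matI)
    fix i j assume "i < dim_row (1\<^sub>m n)" "j < dim_col (1\<^sub>m n)"
    then have ij: "i < n" "j < n" by auto
    have "(mat_adjoint U * U) $$ (i, j) = (\<Sum>k<n. cnj (U $$ (k, i)) * U $$ (k, j))"
      using ij U by (auto simp: scalar_prod_def lessThan_atLeast0 intro!: sum.cong)
    also have "\<dots> = (\<Sum>k<n. W $$ (k, j) * cnj (W $$ (k, i))) * complex_of_real (1 / sqrt (d i) * (1 / sqrt (d j)))"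
      unfolding sum_distrib_right by (rule sum.cong) (use ij in \<open>auto simp: Ue\<close>)
    also have "(\<Sum>k<n. W $$ (k, j) * cnj (W $$ (k, i))) = col W j \<bullet>c col W i"
      using ij W by (auto simp: scalar_prod_def lessThan_atLeast0 intro!: sum.cong)
    also have "\<dots> = (if i = j then complex_of_real (d i) else 0)"
      using dre[OF ij(1)] corthogonal_matD[OF orth, of j i] ij W by auto
    also have "\<dots> * complex_of_real (1 / sqrt (d i) * (1 / sqrt (d j))) = (if i = j then 1 else 0)"
      using dpos[OF ij(1)] by (auto simp flip: of_real_mult)
    finally show "(mat_adjoint U * U) $$ (i, j) = 1\<^sub>m n $$ (i, j)" using ij by auto
  qed (use U in auto)
  then have "unitary n U" by (rule unitaryI[OF U])
  moreover have "col U 0 = complex_of_real (1 / sqrt (d 0)) \<cdot>\<^sub>v v"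
  proof -
    have "ws ! 0 = v" using hdws ws(3) n by (metis hd_conv_nth length_0_conv)
    then have "col W 0 = v" using ws n v by (simp add: W_def)
    then have "W $$ (i, 0) = v $ i" if "i < n" for i using that n W by (metis carrier_matD index_col neq0_conv)
    then show ?thesis using n U v by (intro eq_vecI) (auto simp: Ue)
  qed
  ultimately show ?thesis by (rule that)
qed

lemma mult_mat_unit_vec:
  fixes A :: "'a :: semiring_1 mat"
  assumes "A \<in> carrier_mat n m" "i < m"
  shows "A *\<^sub>v unit_vec m i = col A i"
  using assms by (intro eq_vecI) auto

lemma mat_diag_carrier_dims [simp]: "dim_row (mat_diag n f) = n" "dim_col (mat_diag n f) = n"
  by (auto simp: mat_diag_def)

text \<open>Induction on the dimension: in an orthonormal basis that starts with an eigenvector the first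
  column of the matrix is a multiple of the first basis vector. Hermiticity then clears the first
  row as well, and the remaining block is Hermitian of smaller size.\<close>

theorem hermitian_spectral:
  assumes "A \<in> carrier_mat n n" "mat_adjoint A = (A :: complex mat)"
  obtains U e where "unitary n U" "A = U * mat_diag n (\<lambda>i. complex_of_real (e i)) * mat_adjoint U"
proof -
  have "\<exists>U e. unitary n U \<and> A = U * mat_diag n (\<lambda>i. complex_of_real (e i)) * mat_adjoint U"
    using assms
  proof (induction n arbitrary: A)
    case 0
    have "unitary 0 (1\<^sub>m 0)" by simp
    moreover have "A = 1\<^sub>m 0 * mat_diag 0 (\<lambda>i. complex_of_real (e i)) * mat_adjoint (1\<^sub>m 0)" for e
      using 0 by (intro eq_matI) auto
    ultimately show ?case by blast
  next
    case (Suc n)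
    note A = Suc.prems(1) and herm = Suc.prems(2)
    let ?N = "Suc n"
    note assoc = assoc_mult_mat[of _ ?N ?N _ ?N _ ?N] mult_carrier_mat[of _ ?N ?N _ ?N]
    obtain ev where "eigenvalue A ev"
      using spectrum_non_empty[OF A] by (auto simp: spectrum_def)
    then obtain v where v: "v \<in> carrier_vec ?N" "v \<noteq> 0\<^sub>v ?N" and Av: "A *\<^sub>v v = ev \<cdot>\<^sub>v v"
      using A by (auto simp: eigenvalue_def eigenvector_def)
    obtain U c where U: "unitary ?N U" and col: "col U 0 = c \<cdot>\<^sub>v v"
      using unitary_with_first_column[OF v] by blast
    note Uc = unitaryD[OF U]
    define A' where "A' = mat_adjoint U * A * U"
    have A': "A' \<in> carrier_mat ?N ?N" using Uc A by (auto simp: A'_def)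
    have herm': "mat_adjoint A' = A'"
      unfolding A'_def using Uc A herm by (simp add: mat_adjoint_mult[of _ ?N ?N _ ?N] assoc)
    have cnjA': "cnj (A' $$ (i, j)) = A' $$ (j, i)" if "i < ?N" "j < ?N" for i j
      using index_mat_adjoint[of j A' i] that A' by (simp add: herm')
    have Ue: "U *\<^sub>v unit_vec ?N 0 = c \<cdot>\<^sub>v v"
      using mult_mat_unit_vec[OF Uc(1), of 0] col by simp
    have "A * U *\<^sub>v unit_vec ?N 0 = A *\<^sub>v (U *\<^sub>v unit_vec ?N 0)"
      by (rule assoc_mult_mat_vec[OF A Uc(1)]) simp
    also have "\<dots> = A *\<^sub>v (c \<cdot>\<^sub>v v)" by (simp only: Ue)
    also have "\<dots> = ev \<cdot>\<^sub>v col U 0"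
      using A v by (simp add: mult_mat_vec[OF A v(1)] Av col smult_smult_assoc mult.commute)
    finally have AU: "A * U *\<^sub>v unit_vec ?N 0 = ev \<cdot>\<^sub>v col U 0" .
    have "A' *\<^sub>v unit_vec ?N 0 = mat_adjoint U *\<^sub>v (A * U *\<^sub>v unit_vec ?N 0)"
      unfolding A'_def assoc_mult_mat[OF Uc(2) A Uc(1)]
      by (rule assoc_mult_mat_vec[OF Uc(2) mult_carrier_mat[OF A Uc(1)]]) simp
    also have "\<dots> = ev \<cdot>\<^sub>v (mat_adjoint U *\<^sub>v (U *\<^sub>v unit_vec ?N 0))"
      unfolding AU Ue col by (rule mult_mat_vec[OF Uc(2)]) (use v in simp)
    also have "mat_adjoint U *\<^sub>v (U *\<^sub>v unit_vec ?N 0) = unit_vec ?N 0"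
      using assoc_mult_mat_vec[OF Uc(2) Uc(1), of "unit_vec ?N 0"] Uc(3) by simp
    finally have colA': "col A' 0 = ev \<cdot>\<^sub>v unit_vec ?N 0"
      using mult_mat_unit_vec[OF A', of 0] by simp
    have A'0: "A' $$ (i, 0) = (if i = 0 then ev else 0)" if "i < ?N" for i
      using arg_cong[OF colA', of "\<lambda>w. w $ i"] that A' by auto
    have A'0': "A' $$ (0, i) = (if i = 0 then ev else 0)" if "i < ?N" for i
      using cnjA'[of i 0] cnjA'[of 0 0] A'0[of i] A'0[of 0] that by (auto split: if_splits)
    have evr: "ev = complex_of_real (Re ev)"
      using cnjA'[of 0 0] A'0[of 0] by (simp add: complex_eq_iff)
    define B where "B = mat n n (\<lambda>(i, j). A' $$ (Suc i, Suc j))"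
    have B: "B \<in> carrier_mat n n" by (simp add: B_def)
    have "mat_adjoint B = B" by (rule eq_matI) (auto simp: B_def cnjA')
    from Suc.IH[OF B this] obtain V f where V: "unitary n V"
      and BV: "B = V * mat_diag n (\<lambda>i. complex_of_real (f i)) * mat_adjoint V" by blast
    note Vc = unitaryD[OF V]
    define V1 where "V1 = four_block_mat (1\<^sub>m 1) (0\<^sub>m 1 n) (0\<^sub>m n 1) V"
    define g where "g = case_nat (Re ev) f"
    have V1c: "V1 \<in> carrier_mat ?N ?N" using Vc by (auto simp: V1_def)
    have V1a: "mat_adjoint V1 = four_block_mat (1\<^sub>m 1) (0\<^sub>m 1 n) (0\<^sub>m n 1) (mat_adjoint V)"
      by (rule eq_matI) (use Vc in \<open>auto simp: V1_def\<close>)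
    have dg: "mat_diag ?N (\<lambda>i. complex_of_real (g i))
        = four_block_mat (mat 1 1 (\<lambda>_. ev)) (0\<^sub>m 1 n) (0\<^sub>m n 1) (mat_diag n (\<lambda>i. complex_of_real (f i)))"
      using evr by (intro eq_matI) (auto simp: mat_diag_def g_def split: nat.split)
    have V1u: "unitary ?N V1"
    proof (rule unitaryI[OF V1c])
      have "mat_adjoint V1 * V1 = four_block_mat (1\<^sub>m 1) (0\<^sub>m 1 n) (0\<^sub>m n 1) (1\<^sub>m n)"
        unfolding V1a unfolding V1_def using Vc
        by (subst mult_four_block_mat[of _ 1 1 _ n _ n _ _ 1 _ n]) auto
      then show "mat_adjoint V1 * V1 = 1\<^sub>m ?N" by simp
    qed
    have "A' = four_block_mat (mat 1 1 (\<lambda>_. ev)) (0\<^sub>m 1 n) (0\<^sub>m n 1) B"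
      using A' by (intro eq_matI) (auto simp: B_def A'0 A'0')
    also have "\<dots> = V1 * mat_diag ?N (\<lambda>i. complex_of_real (g i)) * mat_adjoint V1"
      unfolding V1a dg unfolding V1_def BV using Vc
      apply (subst mult_four_block_mat[of _ 1 1 _ n _ n _ _ 1 _ n], (simp; fail)+)
      apply (subst mult_four_block_mat[of _ 1 1 _ n _ n _ _ 1 _ n])
      apply (auto simp: left_mult_zero_mat[of _ n n] right_mult_zero_mat[of _ n n])
      done
    finally have A'V: "A' = V1 * mat_diag ?N (\<lambda>i. complex_of_real (g i)) * mat_adjoint V1" .
    have "A = (U * mat_adjoint U) * A * (U * mat_adjoint U)" using Uc A by simp
    also have "\<dots> = U * A' * mat_adjoint U" unfolding A'_def using Uc(1,2) A by (simp add: assoc)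
    also have "\<dots> = (U * V1) * mat_diag ?N (\<lambda>i. complex_of_real (g i)) * mat_adjoint (U * V1)"
      unfolding A'V using Uc(1,2) V1c by (simp add: assoc mat_adjoint_mult[of _ ?N ?N _ ?N])
    finally show ?case using unitary_mult[OF U V1u] by blast
  qed
  then show ?thesis using that by blast
qed

section \<open>Trace inequalities\<close>

definition rtr :: "complex mat \<Rightarrow> real" where
  "rtr A = Re (mat_trace A)"

lemma rtr_add: "A \<in> carrier_mat n n \<Longrightarrow> B \<in> carrier_mat n n \<Longrightarrow> rtr (A + B) = rtr A + rtr B"
  by (auto simp: rtr_def mat_trace_def sum.distrib)

lemma rtr_minus: "A \<in> carrier_mat n n \<Longrightarrow> B \<in> carrier_mat n n \<Longrightarrow> rtr (A - B) = rtr A - rtr B"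
  by (auto simp: rtr_def mat_trace_def sum_subtractf)

lemma rtr_smult: "A \<in> carrier_mat n n \<Longrightarrow> rtr (complex_of_real c \<cdot>\<^sub>m A) = c * rtr A"
  by (auto simp: rtr_def mat_trace_def sum_distrib_left)

lemma rtr_one: "rtr (1\<^sub>m n) = n"
  by (auto simp: rtr_def mat_trace_def)

lemma mat_trace_mult:
  assumes "A \<in> carrier_mat n m" "B \<in> carrier_mat m n"
  shows "mat_trace (A * B) = (\<Sum>i<n. \<Sum>j<m. A $$ (i, j) * B $$ (j, i))"
  using assms by (auto simp: mat_trace_def scalar_prod_def lessThan_atLeast0)

lemma mat_trace_mult_comm:
  assumes "A \<in> carrier_mat n m" "B \<in> carrier_mat m n"
  shows "mat_trace (A * B) = mat_trace (B * A)"
  unfolding mat_trace_mult[OF assms] mat_trace_mult[OF assms(2,1)]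
  by (subst sum.swap) (simp add: mult.commute)

lemma rtr_mult_comm:
  "A \<in> carrier_mat n m \<Longrightarrow> B \<in> carrier_mat m n \<Longrightarrow> rtr (A * B) = rtr (B * A)"
  by (simp add: rtr_def mat_trace_mult_comm[of A n m])

lemma rtr_adjoint: "A \<in> carrier_mat n n \<Longrightarrow> rtr (mat_adjoint A) = rtr A"
  by (auto simp: rtr_def mat_trace_def)

definition hermitian :: "nat \<Rightarrow> complex mat \<Rightarrow> bool" where
  "hermitian n A \<longleftrightarrow> A \<in> carrier_mat n n \<and> mat_adjoint A = A"

lemma hermitianD: "hermitian n A \<Longrightarrow> A \<in> carrier_mat n n" "hermitian n A \<Longrightarrow> mat_adjoint A = A"
  by (auto simp: hermitian_def)

text \<open>Two spectral decompositions interact only through the squared overlaps of their eigenvectors, so traces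
  of products turn into classical double sums.\<close>

lemma rtr_spectral_mult:
  assumes U: "unitary n U" and V: "unitary n V"
  shows "rtr ((U * mat_diag n (\<lambda>i. complex_of_real (x i)) * mat_adjoint U) *
              (V * mat_diag n (\<lambda>i. complex_of_real (y i)) * mat_adjoint V)) =
    (\<Sum>i<n. \<Sum>j<n. x i * y j * (cmod ((mat_adjoint U * V) $$ (i, j)))\<^sup>2)"
proof -
  note c = unitaryD(1,2)[OF U] unitaryD(1,2)[OF V]
  let ?D = "\<lambda>x. mat_diag n (\<lambda>i. complex_of_real (x i))"
  note assoc = assoc_mult_mat[of _ n n _ n _ n] mult_carrier_mat[of _ n n _ n]
  define W where "W = mat_adjoint U * V"
  have W: "W \<in> carrier_mat n n" using c by (auto simp: W_def)
  have Wa: "mat_adjoint W = mat_adjoint V * U"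
    unfolding W_def using c by (simp add: mat_adjoint_mult[of _ n n _ n])
  have "mat_trace ((U * ?D x * mat_adjoint U) * (V * ?D y * mat_adjoint V))
      = mat_trace (U * (?D x * W * ?D y * mat_adjoint V))"
    using c by (simp add: assoc W_def)
  also have "\<dots> = mat_trace ((?D x * W * ?D y * mat_adjoint V) * U)"
    using c W by (intro mat_trace_mult_comm[of _ n n]) auto
  also have "\<dots> = mat_trace ((?D x * W) * (?D y * mat_adjoint W))"
    using c W by (simp add: assoc Wa)
  also have "\<dots> = (\<Sum>i<n. \<Sum>j<n. complex_of_real (x i * y j * (cmod (W $$ (i, j)))\<^sup>2))"
  proof (subst mat_trace_mult[of _ n n])
    have "complex_of_real (x i * y j * (cmod w)\<^sup>2) = complex_of_real (x i) * w * (complex_of_real (y j) * cnj w)" for i j w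
      by (simp only: of_real_mult complex_norm_square mult_ac)
    then show "(\<Sum>i<n. \<Sum>j<n. (?D x * W) $$ (i, j) * (?D y * mat_adjoint W) $$ (j, i))
      = (\<Sum>i<n. \<Sum>j<n. complex_of_real (x i * y j * (cmod (W $$ (i, j)))\<^sup>2))"
      using W by (intro sum.cong refl) (simp add: mat_diag_mult_left[of _ n n] del: of_real_mult of_real_power)
  qed (use W in auto)
  finally show ?thesis by (simp add: rtr_def W_def)
qed

lemma herm_fun_mult:
  assumes "hermitian n A"
  shows "herm_fun f A * herm_fun g A = herm_fun (\<lambda>x. f x * g x) A"
proof -
  obtain U e where U: "unitary n U" and A: "A = U * mat_diag n (\<lambda>i. complex_of_real (e i)) * mat_adjoint U"
    using hermitian_spectral[of A n] assms by (auto simp: hermitian_def)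
  note c = unitaryD[OF U]
  note assoc = assoc_mult_mat[of _ n n _ n _ n] mult_carrier_mat[of _ n n _ n]
  let ?D = "\<lambda>f. mat_diag n (\<lambda>i. complex_of_real (f (e i)))"
  have "(U * ?D f * mat_adjoint U) * (U * ?D g * mat_adjoint U) = U * ?D f * ((mat_adjoint U * U) * (?D g * mat_adjoint U))"
    using c(1,2) by (simp add: assoc)
  also have "\<dots> = U * ?D f * (?D g * mat_adjoint U)"
    unfolding c(3) using c(1,2) by (simp add: left_mult_one_mat[of _ n n])
  also have "\<dots> = U * (?D f * ?D g) * mat_adjoint U"
    using c(1,2) by (simp add: assoc del: mat_diag_diag)
  finally show ?thesis by (simp add: herm_fun_eq[OF U A])
qed

lemma herm_fun_id:
  assumes "hermitian n A"
  shows "herm_fun (\<lambda>x. x) A = A"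
proof -
  obtain U e where U: "unitary n U" and A: "A = U * mat_diag n (\<lambda>i. complex_of_real (e i)) * mat_adjoint U"
    using hermitian_spectral[of A n] assms by (auto simp: hermitian_def)
  show ?thesis using herm_fun_eq[OF U A, of "\<lambda>x. x"] A by simp
qed

lemma herm_fun_one:
  assumes "hermitian n A"
  shows "herm_fun (\<lambda>x. 1) A = 1\<^sub>m n"
proof -
  obtain U e where U: "unitary n U" and A: "A = U * mat_diag n (\<lambda>i. complex_of_real (e i)) * mat_adjoint U"
    using hermitian_spectral[of A n] assms by (auto simp: hermitian_def)
  show ?thesis using herm_fun_eq[OF U A, of "\<lambda>x. 1"] unitaryD[OF U] by simp
qed

lemma herm_fun_hermitian:
  assumes "hermitian n A"
  shows "hermitian n (herm_fun f A)"
proof -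
  obtain U e where U: "unitary n U" and A: "A = U * mat_diag n (\<lambda>i. complex_of_real (e i)) * mat_adjoint U"
    using hermitian_spectral[of A n] assms by (auto simp: hermitian_def)
  note c = unitaryD(1,2)[OF U]
  note assoc = assoc_mult_mat[of _ n n _ n _ n] mult_carrier_mat[of _ n n _ n]
  have "mat_adjoint (mat_diag n (\<lambda>i. complex_of_real (f (e i)))) = mat_diag n (\<lambda>i. complex_of_real (f (e i)))"
    by (rule eq_matI) (auto simp: mat_diag_def)
  then show ?thesis
    unfolding hermitian_def herm_fun_eq[OF U A] using c
    by (simp add: assoc mat_adjoint_mult[of _ n n _ n])
qed

lemma rtr_herm_fun_mult:
  assumes U: "unitary n U" and A: "A = U * mat_diag n (\<lambda>i. complex_of_real (a i)) * mat_adjoint U"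
    and V: "unitary n V" and B: "B = V * mat_diag n (\<lambda>i. complex_of_real (b i)) * mat_adjoint V"
  shows "rtr (herm_fun f A * herm_fun g B) =
    (\<Sum>i<n. \<Sum>j<n. f (a i) * g (b j) * (cmod ((mat_adjoint U * V) $$ (i, j)))\<^sup>2)"
  unfolding herm_fun_eq[OF U A] herm_fun_eq[OF V B] by (rule rtr_spectral_mult[OF U V])

definition pos_def :: "nat \<Rightarrow> complex mat \<Rightarrow> bool" where
  "pos_def n A \<longleftrightarrow> hermitian n A \<and>
     (\<forall>v \<in> carrier_vec n. v \<noteq> 0\<^sub>v n \<longrightarrow> 0 < Re ((A *\<^sub>v v) \<bullet>c v))"

lemma pos_def_hermitian: "pos_def n A \<Longrightarrow> hermitian n A"
  by (simp add: pos_def_def)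

lemma psd_hermitian: "positive_semidefinite n A \<Longrightarrow> hermitian n A"
  by (simp add: positive_semidefinite_def hermitian_def)

lemma sandwich_index:
  fixes A X :: "complex mat"
  assumes "A \<in> carrier_mat n n" "X \<in> carrier_mat n m" "i < m" "j < m"
  shows "(mat_adjoint X * A * X) $$ (i, j) = (A *\<^sub>v col X j) \<bullet>c col X i"
proof -
  have "(mat_adjoint X * A * X) $$ (i, j) = (mat_adjoint X * (A * X)) $$ (i, j)"
    using assms by (simp add: assoc_mult_mat[of _ m n _ n _ m])
  also have "\<dots> = (\<Sum>k<n. cnj (X $$ (k, i)) * (A *\<^sub>v col X j) $ k)"
    using assms by (auto simp: scalar_prod_def lessThan_atLeast0 intro!: sum.cong)
  also have "\<dots> = (A *\<^sub>v col X j) \<bullet>c col X i"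
    using assms by (auto simp: scalar_prod_def lessThan_atLeast0 mult.commute intro!: sum.cong)
  finally show ?thesis .
qed

lemma hermitian_sandwich:
  assumes "hermitian n A" "X \<in> carrier_mat n m"
  shows "hermitian m (mat_adjoint X * A * X)"
proof -
  note A = hermitianD[OF assms(1)]
  have "mat_adjoint (mat_adjoint X * A * X) = mat_adjoint X * mat_adjoint (mat_adjoint X * A)"
    using A assms by (intro mat_adjoint_mult[of _ m n _ m]) (auto intro: mult_carrier_mat)
  also have "mat_adjoint (mat_adjoint X * A) = A * X"
    using A assms by (subst mat_adjoint_mult[of _ m n _ n]) auto
  also have "mat_adjoint X * (A * X) = mat_adjoint X * A * X"
    using A assms by (intro assoc_mult_mat[symmetric, of _ m n _ n _ m]) auto
  finally show ?thesis using A assms by (auto simp: hermitian_def intro!: mult_carrier_mat)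
qed

lemma hermitian_form_real:
  assumes "hermitian n A" "v \<in> carrier_vec n"
  shows "Im ((A *\<^sub>v v) \<bullet>c v) = 0"
proof -
  define X where "X = mat_of_cols n [v]"
  have X: "X \<in> carrier_mat n 1" "col X 0 = v" using assms by (auto simp: X_def)
  note A = hermitianD[OF assms(1)]
  have "mat_adjoint (mat_adjoint X * A * X) = mat_adjoint X * A * X"
    using hermitian_sandwich[OF assms(1) X(1)] hermitianD by blast
  moreover have "mat_adjoint (mat_adjoint X * A * X) $$ (0, 0) = cnj ((mat_adjoint X * A * X) $$ (0, 0))"
    using A X by (intro index_mat_adjoint) auto
  ultimately show ?thesis
    using sandwich_index[OF A(1) X(1), of 0 0] X(2) by (simp add: complex_eq_iff)
qed

lemma psdI:
  assumes "hermitian n A" "\<And>v. v \<in> carrier_vec n \<Longrightarrow> 0 \<le> Re ((A *\<^sub>v v) \<bullet>c v)"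
  shows "positive_semidefinite n A"
  using assms hermitian_form_real[OF assms(1)]
  by (auto simp: positive_semidefinite_def less_eq_complex_def hermitian_def)

lemma psdD: "positive_semidefinite n A \<Longrightarrow> v \<in> carrier_vec n \<Longrightarrow> 0 \<le> Re ((A *\<^sub>v v) \<bullet>c v)"
  by (auto simp: positive_semidefinite_def less_eq_complex_def)

lemma quad_form_add:
  fixes A B :: "complex mat"
  assumes "A \<in> carrier_mat n n" "B \<in> carrier_mat n n" "v \<in> carrier_vec n"
  shows "Re (((A + B) *\<^sub>v v) \<bullet>c v) = Re ((A *\<^sub>v v) \<bullet>c v) + Re ((B *\<^sub>v v) \<bullet>c v)"
  using assms by (simp add: add_mult_distrib_mat_vec[of _ n n] add_scalar_prod_distrib[of _ n])

lemma quad_form_smult: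
  fixes A :: "complex mat"
  assumes "A \<in> carrier_mat n n" "v \<in> carrier_vec n"
  shows "Re (((complex_of_real c \<cdot>\<^sub>m A) *\<^sub>v v) \<bullet>c v) = c * Re ((A *\<^sub>v v) \<bullet>c v)"
proof -
  have "(complex_of_real c \<cdot>\<^sub>m A) *\<^sub>v v = complex_of_real c \<cdot>\<^sub>v (A *\<^sub>v v)"
    using assms by (intro eq_vecI) (auto simp: scalar_prod_def sum_distrib_left mult_ac)
  then show ?thesis using assms by simp
qed

lemma hermitian_add: "hermitian n A \<Longrightarrow> hermitian n B \<Longrightarrow> hermitian n (A + B)"
  by (auto simp: hermitian_def intro!: eq_matI) (metis carrier_matD complex_cnj_add index_mat_adjoint)+

lemma hermitian_minus: "hermitian n A \<Longrightarrow> hermitian n B \<Longrightarrow> hermitian n (A - B)"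
  by (auto simp: hermitian_def intro!: eq_matI) (metis carrier_matD complex_cnj_diff index_mat_adjoint)+

lemma hermitian_smult: "hermitian n A \<Longrightarrow> hermitian n (complex_of_real c \<cdot>\<^sub>m A)"
  by (auto simp: hermitian_def intro!: eq_matI) (metis carrier_matD index_mat_adjoint)+

lemma hermitian_one [simp]: "hermitian n (1\<^sub>m n)"
  by (auto simp: hermitian_def)

lemma psd_add:
  assumes "positive_semidefinite n A" "positive_semidefinite n B"
  shows "positive_semidefinite n (A + B)"
proof (rule psdI)
  show "hermitian n (A + B)" using assms psd_hermitian hermitian_add by blast
  fix v :: "complex vec" assume "v \<in> carrier_vec n"
  then show "0 \<le> Re (((A + B) *\<^sub>v v) \<bullet>c v)"
    using quad_form_add[of A n B v] psdD assms hermitianD psd_hermitian by (metis add_nonneg_nonneg)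
qed

lemma psd_smult:
  assumes "positive_semidefinite n A" "0 \<le> c"
  shows "positive_semidefinite n (complex_of_real c \<cdot>\<^sub>m A)"
proof (rule psdI)
  show "hermitian n (complex_of_real c \<cdot>\<^sub>m A)" using assms psd_hermitian hermitian_smult by blast
  fix v :: "complex vec" assume "v \<in> carrier_vec n"
  then show "0 \<le> Re (((complex_of_real c \<cdot>\<^sub>m A) *\<^sub>v v) \<bullet>c v)"
    using quad_form_smult[of A n v c] psdD assms hermitianD psd_hermitian by (metis mult_nonneg_nonneg)
qed

lemma pos_def_add_psd:
  assumes "pos_def n A" "positive_semidefinite n B" "0 < c"
  shows "pos_def n (complex_of_real c \<cdot>\<^sub>m A + B)"
proof -
  have h: "hermitian n A" "hermitian n B" using assms pos_def_hermitian psd_hermitian by auto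
  have "0 < Re (((complex_of_real c \<cdot>\<^sub>m A + B) *\<^sub>v v) \<bullet>c v)" if v: "v \<in> carrier_vec n" "v \<noteq> 0\<^sub>v n" for v
  proof -
    have "0 < c * Re ((A *\<^sub>v v) \<bullet>c v)" using assms v by (simp add: pos_def_def)
    moreover have "0 \<le> Re ((B *\<^sub>v v) \<bullet>c v)" using psdD assms v by blast
    ultimately show ?thesis
      using h v by (simp add: quad_form_add[of _ n] quad_form_smult[of _ n] hermitianD)
  qed
  then show ?thesis using h hermitian_add hermitian_smult by (simp add: pos_def_def)
qed

lemma pos_def_psd:
  assumes "pos_def n A"
  shows "positive_semidefinite n A"
proof (rule psdI)
  show h: "hermitian n A" using assms pos_def_hermitian by auto
  fix v :: "complex vec" assume "v \<in> carrier_vec n"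
  then show "0 \<le> Re ((A *\<^sub>v v) \<bullet>c v)"
    using assms hermitianD(1)[OF h] by (cases "v = 0\<^sub>v n") (auto simp: pos_def_def intro: less_imp_le)
qed

lemma psd_rtr_sandwich_nonneg:
  assumes "positive_semidefinite n A" "X \<in> carrier_mat n m"
  shows "0 \<le> rtr (mat_adjoint X * A * X)"
proof -
  have A: "A \<in> carrier_mat n n" using assms by (simp add: positive_semidefinite_def)
  have "rtr (mat_adjoint X * A * X) = (\<Sum>i<m. Re ((A *\<^sub>v col X i) \<bullet>c col X i))"
    using assms A by (simp add: rtr_def mat_trace_def sandwich_index del: index_mult_mat(1))
  also have "\<dots> \<ge> 0"
    using assms by (intro sum_nonneg psdD[OF assms(1)]) auto
  finally show ?thesis .
qed

lemma spectral_eigenvalue: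
  assumes U: "unitary n U" and A: "A = U * mat_diag n (\<lambda>i. complex_of_real (e i)) * mat_adjoint U" and i: "i < n"
  shows "complex_of_real (e i) = (A *\<^sub>v col U i) \<bullet>c col U i"
proof -
  note c = unitaryD[OF U]
  note assoc = assoc_mult_mat[of _ n n _ n _ n] mult_carrier_mat[of _ n n _ n]
  let ?D = "mat_diag n (\<lambda>i. complex_of_real (e i))"
  have "mat_adjoint U * A * U = (mat_adjoint U * U) * ?D * (mat_adjoint U * U)"
    unfolding A using c(1,2) by (simp add: assoc)
  also have "\<dots> = ?D" by (simp add: c(3))
  finally have *: "mat_adjoint U * A * U = ?D" .
  have "A \<in> carrier_mat n n"
    unfolding A using c(1,2) by (intro mult_carrier_mat[of _ n n _ n]) auto
  from sandwich_index[OF this c(1) i i] show ?thesis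
    unfolding * using i by (simp add: mat_diag_def)
qed

lemma pos_def_spectral:
  assumes "pos_def n A"
  obtains U e where "unitary n U" "A = U * mat_diag n (\<lambda>i. complex_of_real (e i)) * mat_adjoint U"
    "\<And>i. i < n \<Longrightarrow> 0 < e i"
proof -
  note h = hermitianD[OF pos_def_hermitian[OF assms]]
  obtain U e where U: "unitary n U" and A: "A = U * mat_diag n (\<lambda>i. complex_of_real (e i)) * mat_adjoint U"
    using hermitian_spectral[OF h] by blast
  have "0 < e i" if i: "i < n" for i
  proof -
    have "col U i \<noteq> 0\<^sub>v n"
    proof
      assume *: "col U i = 0\<^sub>v n"
      have "(mat_adjoint U * U) $$ (i, i) = row (mat_adjoint U) i \<bullet> col U i"
        using i unitaryD[OF U] by (metis carrier_matD index_mult_mat(1))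
      then show False using i unitaryD[OF U] by (simp add: *)
    qed
    moreover have "col U i \<in> carrier_vec n" using unitaryD[OF U] i by auto
    ultimately have "0 < Re ((A *\<^sub>v col U i) \<bullet>c col U i)" using assms by (simp add: pos_def_def)
    then show ?thesis using spectral_eigenvalue[OF U A i] by (metis Re_complex_of_real)
  qed
  then show ?thesis using that U A by blast
qed

lemma psd_spectral:
  assumes "positive_semidefinite n A"
  obtains U e where "unitary n U" "A = U * mat_diag n (\<lambda>i. complex_of_real (e i)) * mat_adjoint U"
    "\<And>i. i < n \<Longrightarrow> 0 \<le> e i"
proof -
  note h = hermitianD[OF psd_hermitian[OF assms]]
  obtain U e where U: "unitary n U" and A: "A = U * mat_diag n (\<lambda>i. complex_of_real (e i)) * mat_adjoint U"
    using hermitian_spectral[OF h] by blast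
  have "0 \<le> e i" if i: "i < n" for i
    using psdD[OF assms, of "col U i"] spectral_eigenvalue[OF U A i] unitaryD(1)[OF U] i
    by (metis Re_complex_of_real col_carrier_vec carrier_matD)
  then show ?thesis using that U A by blast
qed

text \<open>For matrices of equal trace this is nonnegativity of the relative entropy. In the joint spectral
  coordinates it is the scalar inequality \<open>x ln (y / x) \<le> y - x\<close>, averaged over the overlaps.\<close>

lemma klein_inequality:
  assumes A: "pos_def n A" and B: "pos_def n B"
  shows "rtr A - rtr B \<le> rtr (A * herm_fun ln A) - rtr (A * herm_fun ln B)"
proof -
  obtain U a where U: "unitary n U" and AU: "A = U * mat_diag n (\<lambda>i. complex_of_real (a i)) * mat_adjoint U"
    and a: "\<And>i. i < n \<Longrightarrow> 0 < a i" using pos_def_spectral[OF A] by blast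
  obtain V b where V: "unitary n V" and BV: "B = V * mat_diag n (\<lambda>i. complex_of_real (b i)) * mat_adjoint V"
    and b: "\<And>i. i < n \<Longrightarrow> 0 < b i" using pos_def_spectral[OF B] by blast
  note hA = pos_def_hermitian[OF A] and hB = pos_def_hermitian[OF B]
  note cA = hermitianD(1)[OF hA] and cB = hermitianD(1)[OF hB]
  note F = rtr_herm_fun_mult[OF U AU V BV]
  define w where "w i j = (cmod ((mat_adjoint U * V) $$ (i, j)))\<^sup>2" for i j
  have 1: "rtr (A * herm_fun ln A) = (\<Sum>i<n. \<Sum>j<n. a i * ln (a i) * w i j)"
    using F[of "\<lambda>x. x * ln x" "\<lambda>_. 1"] herm_fun_mult[OF hA, of "\<lambda>x. x" ln] herm_fun_hermitian[OF hA]
    by (simp add: herm_fun_one[OF hB] herm_fun_id[OF hA] w_def right_mult_one_mat[of _ n n] hermitianD)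
  have 2: "rtr (A * herm_fun ln B) = (\<Sum>i<n. \<Sum>j<n. a i * ln (b j) * w i j)"
    using F[of "\<lambda>x. x" ln] by (simp add: herm_fun_id[OF hA] w_def)
  have 3: "rtr A = (\<Sum>i<n. \<Sum>j<n. a i * w i j)"
    using F[of "\<lambda>x. x" "\<lambda>_. 1"] cA by (simp add: herm_fun_one[OF hB] herm_fun_id[OF hA] w_def)
  have 4: "rtr B = (\<Sum>i<n. \<Sum>j<n. b j * w i j)"
    using F[of "\<lambda>_. 1" "\<lambda>x. x"] cB by (simp add: herm_fun_one[OF hA] herm_fun_id[OF hB] w_def)
  have "0 \<le> (\<Sum>i<n. \<Sum>j<n. (a i * ln (a i) - a i * ln (b j) - a i + b j) * w i j)"
  proof (intro sum_nonneg mult_nonneg_nonneg)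
    fix i j assume "i \<in> {..<n}" "j \<in> {..<n}"
    then have p: "0 < a i" "0 < b j" using a b by auto
    have "a i * ln (b j / a i) \<le> a i * (b j / a i - 1)"
      using p by (intro mult_left_mono ln_le_minus_one) auto
    also have "\<dots> = b j - a i" using p by (simp add: field_simps)
    finally show "0 \<le> a i * ln (a i) - a i * ln (b j) - a i + b j"
      using p by (simp add: ln_div algebra_simps)
  qed (simp add: w_def)
  then show ?thesis
    unfolding 1 2 3 4 by (simp add: algebra_simps sum.distrib sum_subtractf)
qed

text \<open>This is \<open>x \<le> sinh x\<close> at \<open>x = ln t\<close>.\<close>

lemma ln_le_sinh:
  fixes t :: real
  assumes "1 \<le> t"
  shows "2 * ln t \<le> t - 1 / t"
proof -
  have "(\<lambda>t. t - 1 / t - 2 * ln t) 1 \<le> (\<lambda>t. t - 1 / t - 2 * ln t) t"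
  proof (rule DERIV_nonneg_imp_nondecreasing[OF assms])
    fix x :: real assume x: "1 \<le> x" "x \<le> t"
    have "((\<lambda>t. t - 1 / t - 2 * ln t) has_real_derivative (1 - 1 / x)\<^sup>2) (at x)"
      using x by (auto intro!: derivative_eq_intros simp: field_simps power2_eq_square)
    then show "\<exists>y. ((\<lambda>t. t - 1 / t - 2 * ln t) has_real_derivative y) (at x) \<and> 0 \<le> y"
      by auto
  qed
  then show ?thesis by simp
qed

text \<open>The logarithmic mean \<open>(x - y) / (ln x - ln y)\<close> is at least the harmonic mean of \<open>x\<close> and \<open>y\<close>. The
  bound is asymptotically sharp for \<open>y\<close> close to \<open>x\<close>; a worse constant would survive in the entropy
  estimate.\<close>

lemma log_mean_bound:
  fixes x y :: real
  assumes "0 < x" "0 < y"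
  shows "2 * ((x - y) * (ln x - ln y)) \<le> (x - y)\<^sup>2 * (1 / x + 1 / y)"
proof -
  have *: "2 * ((x - y) * (ln x - ln y)) \<le> (x - y)\<^sup>2 * (1 / x + 1 / y)" if "0 < y" "y \<le> x" for x y :: real
  proof -
    have "2 * ln (x / y) \<le> x / y - 1 / (x / y)" using that by (intro ln_le_sinh) auto
    then have "(x - y) * (2 * (ln x - ln y)) \<le> (x - y) * (x / y - y / x)"
      using that by (intro mult_left_mono) (auto simp: ln_div)
    also have "\<dots> = (x - y)\<^sup>2 * (1 / x + 1 / y)"
      using that by (simp add: field_simps power2_eq_square)
    finally show ?thesis by (metis mult.left_commute)
  qed
  show ?thesis
  proof (cases "y \<le> x")
    case True then show ?thesis using * assms by auto
  next
    case False
    then show ?thesis using *[of x y] assms by (simp add: algebra_simps power2_eq_square)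
  qed
qed

text \<open>The left side is the quadratic form that governs the second derivative of \<open>tr (A ln A)\<close>, written for a
  finite increment so that no derivative of a matrix logarithm is needed. The inverses on the
  right are easier to control than logarithms: \<open>tr (D D T\<^sup>-\<^sup>1)\<close> is jointly convex in \<open>D\<close> and \<open>T\<close>.\<close>

lemma rtr_log_increment_le:
  assumes A: "pos_def n A" and B: "pos_def n B"
  shows "2 * rtr ((A - B) * (herm_fun ln A - herm_fun ln B)) \<le>
    rtr ((A - B) * (A - B) * herm_fun inverse A) + rtr ((A - B) * (A - B) * herm_fun inverse B)"
proof -
  obtain U a where U: "unitary n U" and AU: "A = U * mat_diag n (\<lambda>i. complex_of_real (a i)) * mat_adjoint U"
    and a: "\<And>i. i < n \<Longrightarrow> 0 < a i" using pos_def_spectral[OF A] by blast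
  obtain V b where V: "unitary n V" and BV: "B = V * mat_diag n (\<lambda>i. complex_of_real (b i)) * mat_adjoint V"
    and b: "\<And>i. i < n \<Longrightarrow> 0 < b i" using pos_def_spectral[OF B] by blast
  note hA = pos_def_hermitian[OF A] and hB = pos_def_hermitian[OF B]
  note cA = hermitianD(1)[OF hA] and cB = hermitianD(1)[OF hB]
  note F = rtr_herm_fun_mult[OF U AU V BV]
  have fA: "herm_fun f A \<in> carrier_mat n n" for f using herm_fun_hermitian[OF hA] hermitianD by blast
  have fB: "herm_fun f B \<in> carrier_mat n n" for f using herm_fun_hermitian[OF hB] hermitianD by blast
  define w where "w i j = (cmod ((mat_adjoint U * V) $$ (i, j)))\<^sup>2" for i j
  define S where "S f = (\<Sum>i<n. \<Sum>j<n. f (a i) (b j) * w i j)" for f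
  have F': "rtr (herm_fun f A * herm_fun g B) = S (\<lambda>x y. f x * g y)" for f g
    unfolding F S_def w_def ..
  have FA: "rtr (herm_fun f A) = S (\<lambda>x y. f x)" for f
    using F'[of f "\<lambda>_. 1"] fA[of f] by (simp add: herm_fun_one[OF hB] right_mult_one_mat[of _ n n])
  have FB: "rtr (herm_fun f B) = S (\<lambda>x y. f y)" for f
    using F'[of "\<lambda>_. 1" f] fB[of f] by (simp add: herm_fun_one[OF hA] left_mult_one_mat[of _ n n])
  note mA = herm_fun_mult[OF hA, of "\<lambda>x. x", unfolded herm_fun_id[OF hA]]
  note mB = herm_fun_mult[OF hB, of "\<lambda>x. x", unfolded herm_fun_id[OF hB]]
  note mA' = herm_fun_mult[OF hA, of _ "\<lambda>x. x", unfolded herm_fun_id[OF hA]]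
  note mB' = herm_fun_mult[OF hB, of _ "\<lambda>x. x", unfolded herm_fun_id[OF hB]]
  note F1 = F'[of "\<lambda>x. x", unfolded herm_fun_id[OF hA]]
  note F2 = F'[of _ "\<lambda>x. x", unfolded herm_fun_id[OF hB]]
  note dist = minus_carrier_mat minus_mult_distrib_mat[of _ n n _ _ n] mult_minus_distrib_mat[of _ n n _ n]
  note assoc = assoc_mult_mat[of _ n n _ n _ n] mult_carrier_mat[of _ n n _ n]
  have S_add: "S f + S g = S (\<lambda>x y. f x y + g x y)" and S_minus: "S f - S g = S (\<lambda>x y. f x y - g x y)" for f g
    by (simp_all add: S_def sum.distrib sum_subtractf algebra_simps)
  have S_mult: "c * S f = S (\<lambda>x y. c * f x y)" for f c
    by (simp add: S_def sum_distrib_left algebra_simps)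
  have inv: "x * inverse x = 1" if "0 < x" for x :: real using that by simp
  have S_cong: "S f = S g" if "\<And>x y. 0 < x \<Longrightarrow> 0 < y \<Longrightarrow> f x y = g x y" for f g
    unfolding S_def using a b that by (intro sum.cong refl) auto
  have lhs: "rtr ((A - B) * (herm_fun ln A - herm_fun ln B)) = S (\<lambda>x y. (x - y) * (ln x - ln y))"
  proof -
    have "rtr ((A - B) * (herm_fun ln A - herm_fun ln B)) =
      rtr (A * herm_fun ln A) - rtr (A * herm_fun ln B) - (rtr (herm_fun ln A * B) - rtr (B * herm_fun ln B))"
      using cA cB fA fB by (simp add: dist rtr_minus[of _ n] mult_carrier_mat[of _ n n _ n] rtr_mult_comm[of B n n])
    then show ?thesis unfolding mA mB FA FB F1 F2 S_minus S_add by (simp add: algebra_simps)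
  qed
  have "rtr ((A - B) * (A - B) * herm_fun inverse B) =
      rtr (herm_fun (\<lambda>x. x * x) A * herm_fun inverse B) - rtr (A * herm_fun (\<lambda>x. x * inverse x) B)
      - (rtr (A * herm_fun (\<lambda>x. inverse x * x) B) - rtr (herm_fun (\<lambda>x. x * (x * inverse x)) B))"
  proof -
    have "rtr (B * A * herm_fun inverse B) = rtr (A * herm_fun inverse B * B)"
      using cA cB fB rtr_mult_comm[of B n n "A * herm_fun inverse B"] by (simp add: assoc)
    then show ?thesis
      unfolding mA[symmetric] mB[symmetric] mB'[symmetric]
      using cA cB fA fB by (simp add: dist assoc rtr_minus[of _ n] herm_fun_id[OF hA] herm_fun_id[OF hB])
  qed
  also have "\<dots> = S (\<lambda>x y. (x - y)\<^sup>2 / y)"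
    unfolding F' FB F1 S_minus by (rule S_cong) (simp add: field_simps power2_eq_square)
  finally have rB: "rtr ((A - B) * (A - B) * herm_fun inverse B) = S (\<lambda>x y. (x - y)\<^sup>2 / y)" .
  have "rtr ((A - B) * (A - B) * herm_fun inverse A) =
      rtr (herm_fun (\<lambda>x. x * (x * inverse x)) A) - rtr (herm_fun (\<lambda>x. inverse x * x) A * B)
      - (rtr (herm_fun (\<lambda>x. x * inverse x) A * B) - rtr (herm_fun inverse A * herm_fun (\<lambda>x. x * x) B))"
  proof -
    have "rtr (A * B * herm_fun inverse A) = rtr (herm_fun inverse A * A * B)"
      using cA cB fA rtr_mult_comm[of "A * B" n n "herm_fun inverse A"] by (simp add: assoc)
    moreover have "rtr (B * A * herm_fun inverse A) = rtr (A * herm_fun inverse A * B)"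
      using cA cB fA rtr_mult_comm[of B n n "A * herm_fun inverse A"] by (simp add: assoc)
    moreover have "rtr (B * B * herm_fun inverse A) = rtr (herm_fun inverse A * (B * B))"
      using cA cB fA rtr_mult_comm[of "B * B" n n "herm_fun inverse A"] by (simp add: assoc)
    ultimately show ?thesis
      unfolding mA[symmetric] mB[symmetric] mA'[symmetric]
      using cA cB fA fB by (simp add: dist assoc rtr_minus[of _ n] herm_fun_id[OF hA] herm_fun_id[OF hB])
  qed
  also have "\<dots> = S (\<lambda>x y. (x - y)\<^sup>2 / x)"
    unfolding F' FA F2 S_minus by (rule S_cong) (simp add: field_simps power2_eq_square)
  finally have rA: "rtr ((A - B) * (A - B) * herm_fun inverse A) = S (\<lambda>x y. (x - y)\<^sup>2 / x)" .
  show ?thesis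
    unfolding lhs rA rB S_add S_mult unfolding S_def
  proof (intro sum_mono mult_right_mono)
    fix i j assume "i \<in> {..<n}" "j \<in> {..<n}"
    then show "2 * ((a i - b j) * (ln (a i) - ln (b j))) \<le> (a i - b j)\<^sup>2 / a i + (a i - b j)\<^sup>2 / b j"
      using log_mean_bound[of "a i" "b j"] a[of i] b[of j] by (simp add: distrib_left)
  qed (simp add: w_def)
qed

text \<open>Expand \<open>0 \<le> tr (X\<^sup>* W X)\<close> for \<open>X = c Y - x 1\<close>.\<close>

lemma psd_cauchy_schwarz:
  assumes W: "positive_semidefinite n W" and Y: "Y \<in> carrier_mat n n" and c: "0 < c"
  shows "2 * x * rtr (W * Y) \<le> c * rtr (mat_adjoint Y * W * Y) + x\<^sup>2 / c * rtr W"
proof -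
  note h = hermitianD[OF psd_hermitian[OF W]]
  let ?c = "complex_of_real c" and ?x = "complex_of_real x"
  define X where "X = ?c \<cdot>\<^sub>m Y - ?x \<cdot>\<^sub>m 1\<^sub>m n"
  have X: "X \<in> carrier_mat n n" using Y by (auto simp: X_def)
  have Xa: "mat_adjoint X = ?c \<cdot>\<^sub>m mat_adjoint Y - ?x \<cdot>\<^sub>m 1\<^sub>m n"
    unfolding X_def by (rule eq_matI) (use Y in auto)
  note dist = minus_carrier_mat minus_mult_distrib_mat[of _ n n _ _ n] mult_minus_distrib_mat[of _ n n _ n]
    mult_smult_distrib[of _ n n _ n] mult_smult_assoc_mat[of _ n n _ n]
  note assoc = assoc_mult_mat[of _ n n _ n _ n] mult_carrier_mat[of _ n n _ n]
  have Ya: "mat_adjoint Y \<in> carrier_mat n n" using Y by simp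
  have "rtr (mat_adjoint Y * W) = rtr (mat_adjoint (mat_adjoint Y * W))"
    using Ya h by (subst rtr_adjoint[of _ n]) (auto simp: mult_carrier_mat[of _ n n _ n])
  also have "mat_adjoint (mat_adjoint Y * W) = W * Y"
    using Ya h by (simp add: mat_adjoint_mult[of _ n n _ n])
  finally have sym: "rtr (mat_adjoint Y * W) = rtr (W * Y)" .
  have WY: "W * Y \<in> carrier_mat n n" using h(1) Y by auto
  have "mat_adjoint X * W * X = mat_adjoint X * (W * X)"
    using X Y h(1) by (intro assoc_mult_mat[of _ n n _ n _ n]) auto
  also have "W * X = ?c \<cdot>\<^sub>m (W * Y) - ?x \<cdot>\<^sub>m W"
    unfolding X_def using Y h(1) by (simp add: dist)
  also have "mat_adjoint X * \<dots> = ?c \<cdot>\<^sub>m mat_adjoint Y * (?c \<cdot>\<^sub>m (W * Y) - ?x \<cdot>\<^sub>m W)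
      - ?x \<cdot>\<^sub>m 1\<^sub>m n * (?c \<cdot>\<^sub>m (W * Y) - ?x \<cdot>\<^sub>m W)"
    unfolding Xa using Y Ya h(1) WY by (intro minus_mult_distrib_mat[of _ n n _ _ n]) auto
  also have "rtr \<dots> = c * c * rtr (mat_adjoint Y * W * Y) - c * x * rtr (mat_adjoint Y * W)
      - (x * c * rtr (W * Y) - x * x * rtr W)"
    using WY Ya h(1) Y
    by (simp add: dist rtr_minus[of _ n] rtr_smult[of _ n] assoc left_mult_one_mat[of _ n n] algebra_simps)
  finally have "rtr (mat_adjoint X * W * X) = c * c * rtr (mat_adjoint Y * W * Y) - c * x * rtr (mat_adjoint Y * W)
      - (x * c * rtr (W * Y) - x * x * rtr W)"
    .
  moreover have "0 \<le> rtr (mat_adjoint X * W * X)" by (rule psd_rtr_sandwich_nonneg[OF W X])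
  ultimately have "c * (2 * x * rtr (W * Y)) \<le> c * (c * rtr (mat_adjoint Y * W * Y) + x\<^sup>2 / c * rtr W)"
    using c unfolding sym by (simp add: algebra_simps power2_eq_square)
  then show ?thesis using c by simp
qed

lemma pos_def_inverse:
  assumes "pos_def n T"
  shows "T * herm_fun inverse T = 1\<^sub>m n"
proof -
  obtain U e where U: "unitary n U" and T: "T = U * mat_diag n (\<lambda>i. complex_of_real (e i)) * mat_adjoint U"
    and e: "\<And>i. i < n \<Longrightarrow> 0 < e i" using pos_def_spectral[OF assms] by blast
  note h = pos_def_hermitian[OF assms]
  have "T * herm_fun inverse T = herm_fun (\<lambda>x. x * inverse x) T"
    using herm_fun_mult[OF h, of "\<lambda>x. x" inverse] by (simp add: herm_fun_id[OF h])
  also have "\<dots> = U * mat_diag n (\<lambda>i. complex_of_real (e i * inverse (e i))) * mat_adjoint U"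
    by (rule herm_fun_eq[OF U T])
  also have "mat_diag n (\<lambda>i. complex_of_real (e i * inverse (e i))) = mat_diag n (\<lambda>_. 1)"
  proof -
    have "e i * inverse (e i) = 1" if "i < n" for i using e[OF that] by simp
    then show ?thesis by (intro eq_matI) (simp_all add: mat_diag_def del: of_real_mult)
  qed
  finally show ?thesis using unitaryD[OF U] by simp
qed

text \<open>If \<open>R\<close> and \<open>W\<close> had orthogonal supports, both sides would agree. In general the left side is smaller,
  because \<open>Y = T\<^sup>-\<^sup>1 D\<close> can be inserted into the preceding inequality for \<open>R\<close> and for \<open>W\<close>, and the
  two quadratic terms add up to \<open>tr (Y\<^sup>* T Y) = tr (D D T\<^sup>-\<^sup>1)\<close>.\<close>

lemma rtr_inverse_metric_le:
  assumes R: "positive_semidefinite n R" and W: "positive_semidefinite n W" and c: "0 < a" "0 < b"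
    and T: "T = complex_of_real a \<cdot>\<^sub>m R + complex_of_real b \<cdot>\<^sub>m W" and pd: "pos_def n T"
    and D: "D = complex_of_real x \<cdot>\<^sub>m R + complex_of_real y \<cdot>\<^sub>m W"
  shows "rtr (D * D * herm_fun inverse T) \<le> x\<^sup>2 / a * rtr R + y\<^sup>2 / b * rtr W"
proof -
  note hR = hermitianD[OF psd_hermitian[OF R]] and hW = hermitianD[OF psd_hermitian[OF W]]
  note hT = pos_def_hermitian[OF pd]
  define Z where "Z = herm_fun inverse T"
  have Z: "hermitian n Z" unfolding Z_def by (rule herm_fun_hermitian[OF hT])
  note Zc = hermitianD[OF Z]
  have D': "hermitian n D" unfolding D using R W psd_hermitian hermitian_add hermitian_smult by blast
  note Dc = hermitianD[OF D'] and Tc = hermitianD(1)[OF hT]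
  define Y where "Y = Z * D"
  have Y: "Y \<in> carrier_mat n n" "mat_adjoint Y \<in> carrier_mat n n" using Zc Dc by (auto simp: Y_def)
  note assoc = assoc_mult_mat[of _ n n _ n _ n] mult_carrier_mat[of _ n n _ n]
  note dist = add_mult_distrib_mat[of _ n n _ _ n] mult_add_distrib_mat[of _ n n _ n]
    mult_smult_distrib[of _ n n _ n] mult_smult_assoc_mat[of _ n n _ n]
  have TY: "T * Y = D"
  proof -
    have "T * Y = (T * Z) * D" unfolding Y_def using Tc Zc Dc by (simp add: assoc)
    then show ?thesis using pos_def_inverse[OF pd] Dc by (simp add: Z_def)
  qed
  have DY: "rtr (D * Y) = rtr (D * D * Z)"
    unfolding Y_def using Zc Dc rtr_mult_comm[of "D * Z" n n D] by (simp add: assoc)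
  have "mat_adjoint Y * T * Y = mat_adjoint Y * D" using Y Tc by (simp add: assoc TY)
  also have "\<dots> = D * Z * D" unfolding Y_def using Zc Dc by (simp add: mat_adjoint_mult[of _ n n _ n])
  also have "rtr \<dots> = rtr (D * D * Z)" using Zc Dc rtr_mult_comm[of "D * Z" n n D] by (simp add: assoc)
  finally have YTY: "rtr (mat_adjoint Y * T * Y) = rtr (D * D * Z)" .
  have "2 * rtr (D * Y) = 2 * x * rtr (R * Y) + 2 * y * rtr (W * Y)"
    unfolding D using Y hR hW by (simp add: dist assoc rtr_add[of _ n] rtr_smult[of _ n])
  also have "\<dots> \<le> (a * rtr (mat_adjoint Y * R * Y) + x\<^sup>2 / a * rtr R) + (b * rtr (mat_adjoint Y * W * Y) + y\<^sup>2 / b * rtr W)"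
    using psd_cauchy_schwarz[OF R Y(1) c(1), of x] psd_cauchy_schwarz[OF W Y(1) c(2), of y] by simp
  also have "\<dots> = rtr (mat_adjoint Y * T * Y) + (x\<^sup>2 / a * rtr R + y\<^sup>2 / b * rtr W)"
    unfolding T using Y hR hW by (simp add: dist assoc rtr_add[of _ n] rtr_smult[of _ n])
  finally show ?thesis unfolding DY YTY Z_def by simp
qed

section \<open>A bound on relative entropy\<close>

text \<open>A substitute for integrating an upper bound on the derivative of a function that is not known to be
  differentiable. Bisection reduces the claim to short intervals, on which \<open>Q\<close> is nearly constant.\<close>

lemma increment_le_antiderivative:
  fixes g P Q :: "real \<Rightarrow> real"
  assumes ab: "a \<le> b"
    and inc: "\<And>x y. a \<le> x \<Longrightarrow> x < y \<Longrightarrow> y \<le> b \<Longrightarrow> g y - g x \<le> (y - x) * max (Q x) (Q y)"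
    and der: "\<And>x. a \<le> x \<Longrightarrow> x \<le> b \<Longrightarrow> (P has_real_derivative Q x) (at x)"
    and cont: "continuous_on {a..b} Q"
  shows "g b - g a \<le> P b - P a"
proof (rule field_le_epsilon)
  fix e :: real assume e: "0 < e"
  define \<epsilon> where "\<epsilon> = e / (2 * (b - a + 1))"
  have eps: "0 < \<epsilon>" using e ab by (simp add: \<epsilon>_def)
  define k where "k x = g x - P x" for x
  have "a \<le> a \<longrightarrow> b \<le> b \<longrightarrow> k b - k a \<le> 2 * \<epsilon> * (b - a)"
  proof (rule Bolzano[of a b "\<lambda>u v. a \<le> u \<longrightarrow> v \<le> b \<longrightarrow> k v - k u \<le> 2 * \<epsilon> * (v - u)"])
    show "a \<le> b" by (rule ab)
  next
    fix u v w assume *: "a \<le> u \<longrightarrow> v \<le> b \<longrightarrow> k v - k u \<le> 2 * \<epsilon> * (v - u)"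
      "a \<le> v \<longrightarrow> w \<le> b \<longrightarrow> k w - k v \<le> 2 * \<epsilon> * (w - v)" "u \<le> v" "v \<le> w"
    show "a \<le> u \<longrightarrow> w \<le> b \<longrightarrow> k w - k u \<le> 2 * \<epsilon> * (w - u)"
    proof (intro impI)
      assume "a \<le> u" "w \<le> b"
      then have "k v - k u \<le> 2 * \<epsilon> * (v - u)" "k w - k v \<le> 2 * \<epsilon> * (w - v)" using * by auto
      then show "k w - k u \<le> 2 * \<epsilon> * (w - u)" by (simp add: algebra_simps)
    qed
  next
    fix x assume x: "a \<le> x" "x \<le> b"
    obtain d where d: "0 < d" and dQ: "\<And>y. y \<in> {a..b} \<Longrightarrow> dist y x < d \<Longrightarrow> dist (Q y) (Q x) < \<epsilon>"
    proof -
      have "(Q \<longlongrightarrow> Q x) (at x within {a..b})" using cont x by (simp add: continuous_on_def)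
      from tendstoD[OF this eps] obtain d where "0 < d"
        and d: "\<And>y. y \<in> {a..b} \<Longrightarrow> y \<noteq> x \<Longrightarrow> dist y x < d \<Longrightarrow> dist (Q y) (Q x) < \<epsilon>"
        unfolding eventually_at by blast
      moreover have "dist (Q y) (Q x) < \<epsilon>" if "y \<in> {a..b}" "dist y x < d" for y
        using d[OF that(1) _ that(2)] eps by (cases "y = x") auto
      ultimately show ?thesis using that by blast
    qed
    have "k v - k u \<le> 2 * \<epsilon> * (v - u)" if uv: "u \<le> x" "x \<le> v" "v - u < d" "a \<le> u" "v \<le> b" for u v
    proof (cases "u = v")
      case True then show ?thesis by simp
    next
      case False
      then have uv': "u < v" using uv by auto
      have near: "\<bar>Q y - Q x\<bar> < \<epsilon>" if "u \<le> y" "y \<le> v" for y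
        using dQ[of y] that uv by (auto simp: dist_real_def)
      obtain z where z: "u < z" "z < v" "P v - P u = (v - u) * Q z"
        using MVT2[OF uv', of P Q] der uv by fastforce
      have "k v - k u = (g v - g u) - (v - u) * Q z" using z by (simp add: k_def)
      also have "\<dots> \<le> (v - u) * (max (Q u) (Q v) - Q z)"
        using inc[of u v] uv uv' by (simp add: algebra_simps)
      also have "\<dots> \<le> (v - u) * (2 * \<epsilon>)"
        using near[of u] near[of v] near[of z] z uv' by (intro mult_left_mono) auto
      finally show ?thesis by (simp add: algebra_simps)
    qed
    then show "\<exists>d>0. \<forall>u v. u \<le> x \<and> x \<le> v \<and> v - u < d \<longrightarrow> a \<le> u \<longrightarrow> v \<le> b \<longrightarrow> k v - k u \<le> 2 * \<epsilon> * (v - u)"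
      using d by blast
  qed
  then have "k b - k a \<le> 2 * \<epsilon> * (b - a)" by simp
  also have "\<dots> = e * ((b - a) / (b - a + 1))" using ab by (simp add: \<epsilon>_def field_simps)
  also have "\<dots> \<le> e * 1" using ab e by (intro mult_left_mono) auto
  finally show "g b - g a \<le> P b - P a + e" by (simp add: k_def)
qed

text \<open>The condition \<open>R \<le> M T\<close> allows one to write \<open>T = R / M + W\<close> with \<open>W \<ge> 0\<close> of trace \<open>1 - 1 / M\<close>. The right
  side is the relative entropy that the two weight vectors of \<open>S\<close> and \<open>T\<close> would have if \<open>R\<close> and \<open>W\<close>
  were replaced by point masses. So the claim is that relative entropy cannot grow when classical
  outcomes are encoded into the quantum states \<open>R\<close> and \<open>W / tr W\<close>.

  Both relative entropies are followed along the segment from \<open>T\<close> to \<open>R\<close>, where their values and first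
  derivatives agree at the starting point. Second derivatives are compared by the
  estimate of \<open>tr (D D T\<^sup>-\<^sup>1)\<close> above, in the form of increments of the first derivative, and the
  comparison is then summed up twice.\<close>

theorem relative_entropy_le_max_divergence:
  assumes R: "pos_def n R" "rtr R = 1" and T: "pos_def n T" "rtr T = 1"
    and M: "1 \<le> M" "positive_semidefinite n (complex_of_real M \<cdot>\<^sub>m T - R)"
    and \<mu>: "0 \<le> \<mu>" "\<mu> < 1"
    and S: "S = complex_of_real \<mu> \<cdot>\<^sub>m R + complex_of_real (1 - \<mu>) \<cdot>\<^sub>m T"
  shows "rtr (S * herm_fun ln S) - rtr (S * herm_fun ln T) \<le>
    ((1 - \<mu> + \<mu> * M) * ln (1 - \<mu> + \<mu> * M) + (M - 1) * ((1 - \<mu>) * ln (1 - \<mu>))) / M"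
proof -
  note hR = pos_def_hermitian[OF R(1)] and hT = pos_def_hermitian[OF T(1)]
  note cR = hermitianD(1)[OF hR] and cT = hermitianD(1)[OF hT]
  define \<kappa> where "\<kappa> = 1 - 1 / M"
  have k: "0 \<le> \<kappa>" "\<kappa> = (M - 1) / M" using M by (auto simp: \<kappa>_def field_simps)
  define W where "W = complex_of_real (1 / M) \<cdot>\<^sub>m (complex_of_real M \<cdot>\<^sub>m T - R)"
  have W: "positive_semidefinite n W" unfolding W_def using M by (intro psd_smult) auto
  have cW: "W \<in> carrier_mat n n" using hermitianD psd_hermitian W by blast
  have rW: "rtr W = \<kappa>"
    using cT cR M R T by (simp add: W_def \<kappa>_def rtr_smult[of _ n] rtr_minus[of _ n] minus_carrier_mat field_simps del: of_real_divide)
  have Wij: "W $$ (i, j) = T $$ (i, j) - R $$ (i, j) / complex_of_real M" if "i < n" "j < n" for i j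
    using that cT cR M by (simp add: W_def field_simps)
  \<comment> \<open>The point \<open>X s\<close> of the segment has weight \<open>p s\<close> on \<open>R\<close> and relative weight \<open>1 - s\<close> on \<open>W\<close>; its velocity is \<open>D\<close>.\<close>
  define p where "p s = s + (1 - s) / M" for s
  define X where "X s = complex_of_real (p s) \<cdot>\<^sub>m R + complex_of_real (1 - s) \<cdot>\<^sub>m W" for s
  define D where "D = complex_of_real \<kappa> \<cdot>\<^sub>m R + complex_of_real (- 1) \<cdot>\<^sub>m W"
  have p: "0 < p s" if "0 \<le> s" "s < 1" for s
    using that M by (simp add: p_def add_nonneg_pos)
  have Xpd: "pos_def n (X s)" if "0 \<le> s" "s < 1" for s
    unfolding X_def using that p by (intro pos_def_add_psd R psd_smult W) auto
  have cX: "X s \<in> carrier_mat n n" for s using cR cW by (simp add: X_def)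
  have hD: "hermitian n D"
    unfolding D_def using hR psd_hermitian[OF W] by (intro hermitian_add hermitian_smult)
  note cD = hermitianD(1)[OF hD]
  have rX: "rtr (X s) = 1" for s
  proof -
    have "rtr (X s) = p s + (1 - s) * \<kappa>"
      using cR cW R rW by (simp add: X_def rtr_add[of _ n] rtr_smult[of _ n] del: of_real_diff)
    also have "\<dots> = 1" using M by (simp add: p_def \<kappa>_def field_simps)
    finally show ?thesis .
  qed
  have rD: "rtr D = 0"
    using cR cW R rW rtr_smult[OF cW, of "- 1"] by (simp add: D_def rtr_add[of _ n] rtr_smult[of _ n])
  have X_diff: "X y - X x = complex_of_real (y - x) \<cdot>\<^sub>m D" for x y
    using cR cW M by (intro eq_matI) (auto simp: X_def D_def p_def \<kappa>_def field_simps)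
  have X0: "X 0 = T"
    using cR cW cT M by (intro eq_matI) (auto simp: X_def p_def Wij)
  have X\<mu>: "X \<mu> = S"
    unfolding S using cR cW cT M by (intro eq_matI) (auto simp: X_def p_def Wij field_simps)
  define L where "L s = herm_fun ln (X s)" for s
  have cL: "L s \<in> carrier_mat n n" if "0 \<le> s" "s < 1" for s
    unfolding L_def using herm_fun_hermitian[OF pos_def_hermitian[OF Xpd[OF that]]] hermitianD by blast
  note dist = minus_carrier_mat minus_mult_distrib_mat[of _ n n _ _ n] mult_minus_distrib_mat[of _ n n _ n]
    add_mult_distrib_mat[of _ n n _ _ n]
    mult_smult_distrib[of _ n n _ n] mult_smult_assoc_mat[of _ n n _ n] mult_carrier_mat[of _ n n _ n]
  \<comment> \<open>The quantum quantities \<open>E\<close> and \<open>u\<close> are a negative entropy and its derivative. Their classical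
    counterparts are \<open>V\<close> and \<open>U\<close>, and \<open>Q\<close> is the second derivative of \<open>V\<close>.\<close>
  define u where "u s = rtr (D * L s)" for s
  define E where "E s = rtr (X s * L s)" for s
  define Q where "Q s = \<kappa>\<^sup>2 / p s + \<kappa> / (1 - s)" for s
  define U where "U s = \<kappa> * (ln (p s) - ln (1 - s))" for s
  define V where "V s = p s * ln (p s) + \<kappa> * ((1 - s) * ln (1 - s))" for s
  have p': "(p has_real_derivative \<kappa>) (at s)" for s
    unfolding p_def \<kappa>_def using M by (auto intro!: derivative_eq_intros simp: field_simps)
  have pc: "continuous_on A p" for A
    using p' DERIV_isCont continuous_at_imp_continuous_on by blast
  have U': "(U has_real_derivative Q s) (at s)" if "0 \<le> s" "s < 1" for s
    unfolding U_def Q_def using that p[OF that]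
    by (auto intro!: derivative_eq_intros p' simp: field_simps power2_eq_square)
  have V': "(V has_real_derivative U s) (at s)" if "0 \<le> s" "s < 1" for s
  proof -
    have \<phi>: "((\<lambda>x. x * ln x) has_real_derivative ln x + 1) (at x)" if "0 < x" for x :: real
      using that by (auto intro!: derivative_eq_intros)
    have "((\<lambda>s. p s * ln (p s)) has_real_derivative (ln (p s) + 1) * \<kappa>) (at s)"
      by (rule DERIV_chain2[OF \<phi>[OF p[OF that]] p'])
    moreover have "((\<lambda>s. (1 - s) * ln (1 - s)) has_real_derivative (ln (1 - s) + 1) * (- 1)) (at s)"
      by (rule DERIV_chain2[OF \<phi>]) (use that in \<open>auto intro!: derivative_eq_intros\<close>)
    ultimately have "((\<lambda>s. p s * ln (p s) + \<kappa> * ((1 - s) * ln (1 - s))) has_real_derivative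
        (ln (p s) + 1) * \<kappa> + \<kappa> * ((ln (1 - s) + 1) * (- 1))) (at s)"
      by (intro DERIV_add DERIV_cmult)
    moreover have "V = (\<lambda>s. p s * ln (p s) + \<kappa> * ((1 - s) * ln (1 - s)))"
      by (rule ext) (rule V_def)
    ultimately show ?thesis
      unfolding U_def by (auto elim!: DERIV_cong simp: algebra_simps)
  qed
  have Qc: "continuous_on {0..t} Q" if "t < 1" for t
  proof -
    have "p s \<noteq> 0" if "s \<in> {0..t}" for s using p[of s] that \<open>t < 1\<close> by auto
    then show ?thesis unfolding Q_def using that by (auto intro!: continuous_intros pc)
  qed
  have q: "rtr (D * D * herm_fun inverse (X s)) \<le> Q s" if "0 \<le> s" "s < 1" for s
    using rtr_inverse_metric_le[OF pos_def_psd[OF R(1)] W p[OF that] _ X_def Xpd[OF that] D_def] that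
    by (simp add: R rW Q_def)
  have uinc: "u y - u x \<le> (y - x) * max (Q x) (Q y)" if xy: "0 \<le> x" "x < y" "y < 1" for x y
  proof -
    have y0: "0 \<le> y" and x1: "x < 1" using xy by auto
    note cc = cD cL[OF xy(1) x1] cL[OF y0 xy(3)]
    have ci: "herm_fun inverse (X s) \<in> carrier_mat n n" if "0 \<le> s" "s < 1" for s
      using herm_fun_hermitian[OF pos_def_hermitian[OF Xpd[OF that]]] hermitianD by blast
    have "2 * rtr ((X y - X x) * (L y - L x)) \<le>
        rtr ((X y - X x) * (X y - X x) * herm_fun inverse (X y)) + rtr ((X y - X x) * (X y - X x) * herm_fun inverse (X x))"
      unfolding L_def using rtr_log_increment_le[OF Xpd[OF y0 xy(3)] Xpd[OF xy(1) x1]] .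
    also have "\<dots> = (y - x) * (y - x) * (rtr (D * D * herm_fun inverse (X y)) + rtr (D * D * herm_fun inverse (X x)))"
      unfolding X_diff using cD ci[OF y0 xy(3)] ci[OF xy(1) x1]
      by (simp add: dist rtr_smult[of _ n] algebra_simps del: of_real_diff)
    also have "\<dots> \<le> (y - x) * (y - x) * (2 * max (Q x) (Q y))"
      using q[OF y0 xy(3)] q[OF xy(1) x1] by (intro mult_left_mono) auto
    also have "rtr ((X y - X x) * (L y - L x)) = (y - x) * (u y - u x)"
      unfolding X_diff u_def using cc by (simp add: dist rtr_smult[of _ n] rtr_minus[of _ n] algebra_simps del: of_real_diff)
    finally have "(y - x) * (u y - u x) \<le> (y - x) * ((y - x) * max (Q x) (Q y))" by simp
    then show ?thesis using xy by simp
  qed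
  have u: "u t - u 0 \<le> U t - U 0" if t: "0 \<le> t" "t < 1" for t
    by (rule increment_le_antiderivative[OF t(1) _ _ Qc[OF t(2)]]) (use uinc U' t in auto)
  have Einc: "E y - E x \<le> (y - x) * u y" if xy: "0 \<le> x" "x < y" "y < 1" for x y
  proof -
    have y0: "0 \<le> y" and x1: "x < 1" using xy by auto
    have "0 \<le> rtr (X x * L x) - rtr (X x * L y)"
      using klein_inequality[OF Xpd[OF xy(1) x1] Xpd[OF y0 xy(3)]] by (simp add: rX L_def)
    moreover have "rtr (X x * L y) = rtr (X y * L y) - (y - x) * u y"
    proof -
      have "rtr ((X y - X x) * L y) = (y - x) * u y"
        unfolding X_diff u_def using cD cL[OF y0 xy(3)] by (simp add: dist rtr_smult[of _ n] del: of_real_diff)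
      moreover have "rtr ((X y - X x) * L y) = rtr (X y * L y) - rtr (X x * L y)"
        using cX cL[OF y0 xy(3)] by (simp add: dist rtr_minus[of _ n])
      ultimately show ?thesis by simp
    qed
    ultimately show ?thesis by (simp add: E_def)
  qed
  \<comment> \<open>\<open>F\<close> is \<open>V\<close> corrected by a linear term, so that its derivative \<open>u 0 - U 0 + U\<close> dominates \<open>u\<close>.\<close>
  define F where "F s = s * (u 0 - U 0) + V s" for s
  have "E \<mu> - E 0 \<le> F \<mu> - F 0"
  proof (rule increment_le_antiderivative[OF \<mu>(1)])
    fix x y assume xy: "0 \<le> x" "x < y" "y \<le> \<mu>"
    then have "E y - E x \<le> (y - x) * u y" using Einc \<mu> by auto
    also have "\<dots> \<le> (y - x) * max (u 0 - U 0 + U x) (u 0 - U 0 + U y)"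
      using u[of y] xy \<mu> by (intro mult_left_mono) auto
    finally show "E y - E x \<le> (y - x) * max (u 0 - U 0 + U x) (u 0 - U 0 + U y)" .
  next
    fix x assume "0 \<le> x" "x \<le> \<mu>"
    then show "(F has_real_derivative u 0 - U 0 + U x) (at x)"
      unfolding F_def using V'[of x] \<mu> by (auto intro!: derivative_eq_intros)
  next
    have "continuous_on {0..\<mu>} U"
    proof (rule continuous_at_imp_continuous_on, rule ballI)
      fix s assume "s \<in> {0..\<mu>}"
      then show "isCont U s" using DERIV_isCont[OF U'[of s]] \<mu> by auto
    qed
    then show "continuous_on {0..\<mu>} (\<lambda>x. u 0 - U 0 + U x)" by (intro continuous_intros)
  qed
  moreover have "rtr (S * herm_fun ln T) = E 0 + \<mu> * u 0"
  proof -
    have "rtr ((X \<mu> - X 0) * L 0) = \<mu> * u 0"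
      unfolding X_diff u_def using cD cL[of 0] by (simp add: dist rtr_smult[of _ n])
    moreover have "rtr ((X \<mu> - X 0) * L 0) = rtr (X \<mu> * L 0) - rtr (X 0 * L 0)"
      using cX cL[of 0] by (simp add: dist rtr_minus[of _ n])
    ultimately show ?thesis by (simp add: E_def X\<mu> L_def X0)
  qed
  moreover have "rtr (S * herm_fun ln S) = E \<mu>" by (simp add: E_def L_def X\<mu>)
  ultimately have "rtr (S * herm_fun ln S) - rtr (S * herm_fun ln T) \<le> V \<mu> - V 0 - \<mu> * U 0"
    by (simp add: F_def algebra_simps)
  also have "\<dots> = ((1 - \<mu> + \<mu> * M) * ln (1 - \<mu> + \<mu> * M) + (M - 1) * ((1 - \<mu>) * ln (1 - \<mu>))) / M"
  proof -
    have p1: "p \<mu> = (1 - \<mu> + \<mu> * M) / M" "p 0 = 1 / M" using M by (auto simp: p_def field_simps)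
    have pos: "0 < 1 - \<mu> + \<mu> * M" using \<mu> M by (simp add: add_pos_nonneg)
    have l: "ln (p \<mu>) = ln (1 - \<mu> + \<mu> * M) - ln M" "ln (p 0) = - ln M"
      unfolding p1 using pos M by (simp_all add: ln_div)
    show ?thesis
      unfolding V_def U_def l unfolding p1 k(2) using M by (simp add: field_simps)
  qed
  finally show ?thesis .
qed

section \<open>Kronecker products and partial traces\<close>

lemma sum_lessThan_mult:
  fixes f :: "nat \<Rightarrow> 'a :: comm_monoid_add"
  shows "(\<Sum>r<a * b. f r) = (\<Sum>i<a. \<Sum>k<b. f (i * b + k))"
proof -
  have "sum f {i * b..<i * b + b} = (\<Sum>k<b. f (i * b + k))" for i
    using sum.shift_bounds_nat_ivl[of f 0 "i * b" b] by (simp add: lessThan_atLeast0 add.commute)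
  then show ?thesis by (simp add: sum.nat_group[symmetric])
qed

lemma pair_index_less: "i < a \<Longrightarrow> k < b \<Longrightarrow> i * b + k < a * (b :: nat)"
  by (metis add_mult_distrib2 less_le_trans mult.commute mult_le_mono2 nat_add_left_cancel_less mult_Suc_right add.commute Suc_leI)

lemma pair_index_eq_iff:
  "k < b \<Longrightarrow> l < b \<Longrightarrow> i * b + k = j * b + l \<longleftrightarrow> i = j \<and> k = (l :: nat)"
  by (metis add_right_cancel div_mult_self3 div_less less_nat_zero_code mod_less mod_mult_self3 add.right_neutral)

lemma eq_mat_pairI:
  fixes A B :: "'a mat"
  assumes "A \<in> carrier_mat (a * b) (c * d)" "B \<in> carrier_mat (a * b) (c * d)"
    and "\<And>i k j l. i < a \<Longrightarrow> k < b \<Longrightarrow> j < c \<Longrightarrow> l < d \<Longrightarrow>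
      A $$ (i * b + k, j * d + l) = B $$ (i * b + k, j * d + l)"
  shows "A = B"
proof (rule eq_matI)
  fix r s assume "r < dim_row B" "s < dim_col B"
  then have rs: "r < a * b" "s < c * d" using assms by auto
  then have "b \<noteq> 0" "d \<noteq> 0" by (metis mult_0_right not_less_zero)+
  then have "r div b < a" "r mod b < b" "s div d < c" "s mod d < d"
    using rs by (auto simp: less_mult_imp_div_less)
  from assms(3)[OF this] show "A $$ (r, s) = B $$ (r, s)" by simp
qed (use assms in auto)

lemma kron_carrier [simp]:
  "A \<in> carrier_mat a c \<Longrightarrow> B \<in> carrier_mat b d \<Longrightarrow> kron A B \<in> carrier_mat (a * b) (c * d)"
  by (auto simp: kron_def)

lemma index_kron:
  assumes "A \<in> carrier_mat a c" "B \<in> carrier_mat b d" "i < a" "k < b" "j < c" "l < d"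
  shows "kron A B $$ (i * b + k, j * d + l) = A $$ (i, j) * B $$ (k, l)"
  using assms pair_index_less by (auto simp: kron_def)

lemma kron_mult:
  assumes A: "A \<in> carrier_mat a b" and C: "C \<in> carrier_mat b c"
    and B: "B \<in> carrier_mat a' b'" and D: "D \<in> carrier_mat b' c'"
  shows "kron A B * kron C D = kron (A * C) (B * D)"
proof (rule eq_mat_pairI[of _ a a' c c'])
  fix i k j l assume ix: "i < a" "k < a'" "j < c" "l < c'"
  have "(kron A B * kron C D) $$ (i * a' + k, j * c' + l)
      = (\<Sum>r<b * b'. kron A B $$ (i * a' + k, r) * kron C D $$ (r, j * c' + l))"
    using ix kron_carrier[OF A B] kron_carrier[OF C D] pair_index_less
    by (auto simp: scalar_prod_def lessThan_atLeast0 intro!: sum.cong)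
  also have "\<dots> = (\<Sum>p<b. \<Sum>q<b'. A $$ (i, p) * B $$ (k, q) * (C $$ (p, j) * D $$ (q, l)))"
    unfolding sum_lessThan_mult
    using ix by (intro sum.cong refl) (simp add: index_kron[OF A B] index_kron[OF C D])
  also have "\<dots> = (\<Sum>p<b. A $$ (i, p) * C $$ (p, j)) * (\<Sum>q<b'. B $$ (k, q) * D $$ (q, l))"
    by (simp add: sum_product mult_ac)
  also have "\<dots> = (A * C) $$ (i, j) * (B * D) $$ (k, l)"
    using ix A B C D by (auto simp: scalar_prod_def lessThan_atLeast0)
  also have "\<dots> = kron (A * C) (B * D) $$ (i * a' + k, j * c' + l)"
    using ix A B C D by (intro index_kron[symmetric, of _ a c _ a' c']) auto
  finally show "(kron A B * kron C D) $$ (i * a' + k, j * c' + l) = kron (A * C) (B * D) $$ (i * a' + k, j * c' + l)" .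
qed (use A B C D in \<open>auto intro!: mult_carrier_mat kron_carrier\<close>)

lemma kron_adjoint: "mat_adjoint (kron A B) = kron (mat_adjoint A) (mat_adjoint B)"
proof -
  have 1: "r div b < a" if "r < a * b" for r a b :: nat using that by (simp add: less_mult_imp_div_less)
  have 2: "r mod b < b" if "r < a * b" for r a b :: nat using that by (cases "b = 0") auto
  show ?thesis by (rule eq_matI) (auto simp: kron_def 1 2)
qed

lemma kron_mat_diag:
  "kron (mat_diag a f) (mat_diag b g) = mat_diag (a * b) (\<lambda>r. f (r div b) * g (r mod b))"
proof (rule eq_mat_pairI[of _ a b a b])
  fix i k j l assume ix: "i < a" "k < b" "j < a" "l < b"
  have "i * b + k = j * b + l \<longleftrightarrow> i = j \<and> k = l"
    using ix by (intro pair_index_eq_iff)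
  then show "kron (mat_diag a f) (mat_diag b g) $$ (i * b + k, j * b + l)
      = mat_diag (a * b) (\<lambda>r. f (r div b) * g (r mod b)) $$ (i * b + k, j * b + l)"
    using ix pair_index_less[of i a k b] pair_index_less[of j a l b]
    by (subst index_kron[of _ a a _ b b]) (auto simp: mat_diag_def)
qed auto

lemma kron_spectral:
  assumes "U \<in> carrier_mat a a" "V \<in> carrier_mat b b"
  shows "kron (U * mat_diag a (\<lambda>i. complex_of_real (e i)) * mat_adjoint U)
      (V * mat_diag b (\<lambda>i. complex_of_real (f i)) * mat_adjoint V)
    = kron U V * mat_diag (a * b) (\<lambda>r. complex_of_real (e (r div b) * f (r mod b))) * mat_adjoint (kron U V)"
proof -
  have d: "mat_diag (a * b) (\<lambda>r. complex_of_real (e (r div b) * f (r mod b)))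
      = kron (mat_diag a (\<lambda>i. complex_of_real (e i))) (mat_diag b (\<lambda>i. complex_of_real (f i)))"
    by (simp add: kron_mat_diag)
  show ?thesis
    unfolding kron_adjoint d using assms
    by (simp add: kron_mult[of _ a a _ a _ b b _ b] mult_carrier_mat[of _ a a _ a] mult_carrier_mat[of _ b b _ b])
qed

lemma kron_one: "kron (1\<^sub>m a) (1\<^sub>m b) = 1\<^sub>m (a * b)"
  using kron_mat_diag[of a "\<lambda>_. 1" b "\<lambda>_. 1"] by simp

lemma unitary_kron:
  assumes "unitary a U" "unitary b V"
  shows "unitary (a * b) (kron U V)"
  using unitaryD[OF assms(1)] unitaryD[OF assms(2)]
  by (intro unitaryI) (auto simp: kron_adjoint kron_mult[of _ a a _ a _ b b _ b] kron_one)

lemma ptrace_snd_sandwich: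
  assumes G: "G \<in> carrier_mat d d" and X: "X \<in> carrier_mat (d * n) (d * n)"
  shows "ptrace_snd d n (mat_adjoint (kron G (1\<^sub>m n)) * X * kron G (1\<^sub>m n))
    = mat_adjoint G * ptrace_snd d n X * G"
proof (rule eq_matI)
  let ?K = "kron G (1\<^sub>m n)"
  have K: "?K \<in> carrier_mat (d * n) (d * n)" using G by simp
  have Ke: "?K $$ (a * n + i, b * n + j) = (if i = j then G $$ (a, b) else 0)"
    if "a < d" "b < d" "i < n" "j < n" for a b i j
    using that G by (subst index_kron[of _ d d _ n n]) auto
  have e: "(mat_adjoint ?K * X * ?K) $$ (a * n + i, b * n + i) =
      (\<Sum>b'<d. \<Sum>a'<d. cnj (G $$ (a', a)) * X $$ (a' * n + i, b' * n + i) * G $$ (b', b))"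
    if ab: "a < d" "b < d" "i < n" for a b i
  proof -
    have "(mat_adjoint ?K * X * ?K) $$ (a * n + i, b * n + i)
      = (\<Sum>s<d * n. (\<Sum>r<d * n. cnj (?K $$ (r, a * n + i)) * X $$ (r, s)) * ?K $$ (s, b * n + i))"
      using K X ab pair_index_less[of a d i n] pair_index_less[of b d i n]
      by (auto simp: scalar_prod_def lessThan_atLeast0 intro!: sum.cong)
    also have "\<dots> = (\<Sum>b'<d. (\<Sum>a'<d. cnj (G $$ (a', a)) * X $$ (a' * n + i, b' * n + i)) * G $$ (b', b))"
      unfolding sum_lessThan_mult using ab
      by (intro sum.cong refl) (simp add: Ke if_distrib if_distribR sum.delta' cong: if_cong)
    finally show ?thesis by (simp add: sum_distrib_right)
  qed
  fix a b assume "a < dim_row (mat_adjoint G * ptrace_snd d n X * G)" "b < dim_col (mat_adjoint G * ptrace_snd d n X * G)"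
  then have ab: "a < d" "b < d" using G by auto
  have "ptrace_snd d n (mat_adjoint ?K * X * ?K) $$ (a, b)
     = (\<Sum>i<n. \<Sum>b'<d. \<Sum>a'<d. cnj (G $$ (a', a)) * X $$ (a' * n + i, b' * n + i) * G $$ (b', b))"
    using ab e by (simp add: ptrace_snd_def)
  also have "\<dots> = (\<Sum>b'<d. \<Sum>a'<d. \<Sum>i<n. cnj (G $$ (a', a)) * X $$ (a' * n + i, b' * n + i) * G $$ (b', b))"
    by (subst sum.swap) (rule sum.cong[OF refl], subst sum.swap, rule refl)
  also have "\<dots> = (\<Sum>b'<d. (\<Sum>a'<d. cnj (G $$ (a', a)) * ptrace_snd d n X $$ (a', b')) * G $$ (b', b))"
    by (intro sum.cong refl) (simp add: ptrace_snd_def sum_distrib_left sum_distrib_right mult_ac)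
  also have "\<dots> = (mat_adjoint G * ptrace_snd d n X * G) $$ (a, b)"
    using ab G by (auto simp: scalar_prod_def lessThan_atLeast0 ptrace_snd_def intro!: sum.cong)
  finally show "ptrace_snd d n (mat_adjoint ?K * X * ?K) $$ (a, b) = (mat_adjoint G * ptrace_snd d n X * G) $$ (a, b)" .
qed (use G in \<open>auto simp: ptrace_snd_def\<close>)

section \<open>Entropy\<close>

lemma rtr_spectral:
  assumes "unitary n U"
  shows "rtr (U * mat_diag n (\<lambda>i. complex_of_real (x i)) * mat_adjoint U) = (\<Sum>i<n. x i)"
proof -
  note c = unitaryD[OF assms]
  let ?D = "mat_diag n (\<lambda>i. complex_of_real (x i))"
  have "rtr (U * ?D * mat_adjoint U) = rtr (U * (?D * mat_adjoint U))"
    using c(1,2) by (simp add: assoc_mult_mat[of _ n n _ n _ n])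
  also have "\<dots> = rtr (?D * mat_adjoint U * U)"
    using c(1,2) by (intro rtr_mult_comm[of _ n n]) auto
  also have "?D * mat_adjoint U * U = ?D * (mat_adjoint U * U)"
    using c(1,2) by (intro assoc_mult_mat[of _ n n _ n _ n]) auto
  also have "rtr \<dots> = (\<Sum>i<n. x i)" by (simp add: c(3) right_mult_one_mat[of _ n n] rtr_def mat_trace_def mat_diag_def)
  finally show ?thesis .
qed

lemma entropy_spectral:
  assumes U: "unitary n U" and A: "A = U * mat_diag n (\<lambda>i. complex_of_real (e i)) * mat_adjoint U"
  shows "entropy A = - (\<Sum>i<n. e i * log 2 (e i))"
proof -
  note c = unitaryD[OF U]
  have "hermitian n A"
    using herm_fun_hermitian[of n "mat_diag n (\<lambda>i. complex_of_real (e i))" "\<lambda>x. x"]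
    unfolding A hermitian_def
    using c(1,2) by (auto simp: mat_adjoint_mult[of _ n n _ n] assoc_mult_mat[of _ n n _ n _ n] mult_carrier_mat[of _ n n _ n]
        mat_diag_def intro!: arg_cong2[where f = "(*)"] eq_matI)
  note h = this
  have "A * herm_fun (log 2) A = herm_fun (\<lambda>x. x * log 2 x) A"
    using herm_fun_mult[OF h, of "\<lambda>x. x" "log 2"] by (simp add: herm_fun_id[OF h])
  also have "rtr \<dots> = (\<Sum>i<n. e i * log 2 (e i))"
    unfolding herm_fun_eq[OF U A] by (rule rtr_spectral[OF U])
  finally show ?thesis by (simp add: entropy_def rtr_def)
qed

lemma entropy_ln:
  assumes "hermitian n A"
  shows "entropy A = - rtr (A * herm_fun ln A) / ln 2"
proof -
  obtain U e where U: "unitary n U" and A: "A = U * mat_diag n (\<lambda>i. complex_of_real (e i)) * mat_adjoint U"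
    using hermitian_spectral[of A n] assms by (auto simp: hermitian_def)
  have "A * herm_fun ln A = herm_fun (\<lambda>x. x * ln x) A"
    using herm_fun_mult[OF assms, of "\<lambda>x. x" ln] by (simp add: herm_fun_id[OF assms])
  also have "rtr \<dots> = (\<Sum>i<n. e i * ln (e i))"
    unfolding herm_fun_eq[OF U A] by (rule rtr_spectral[OF U])
  finally show ?thesis unfolding entropy_spectral[OF U A] by (simp add: log_def sum_divide_distrib)
qed

lemma entropy_unitary_conj:
  assumes "hermitian n A" and V: "unitary n V"
  shows "entropy (mat_adjoint V * A * V) = entropy A"
proof -
  obtain U e where U: "unitary n U" and A: "A = U * mat_diag n (\<lambda>i. complex_of_real (e i)) * mat_adjoint U"
    using hermitian_spectral[of A n] assms by (auto simp: hermitian_def)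
  note c = unitaryD(1,2)[OF U] unitaryD(1,2)[OF V]
  have W: "unitary n (mat_adjoint V * U)" using unitary_mult unitary_adjoint U V by blast
  have "mat_adjoint V * A * V = (mat_adjoint V * U) * mat_diag n (\<lambda>i. complex_of_real (e i)) * mat_adjoint (mat_adjoint V * U)"
    unfolding A using c by (simp add: mat_adjoint_mult[of _ n n _ n] assoc_mult_mat[of _ n n _ n _ n] mult_carrier_mat[of _ n n _ n])
  from entropy_spectral[OF W this] entropy_spectral[OF U A] show ?thesis by simp
qed

lemma entropy_mat_diag: "entropy (mat_diag n (\<lambda>i. complex_of_real (e i))) = - (\<Sum>i<n. e i * log 2 (e i))"
  by (rule entropy_spectral[OF unitary_one]) (simp add: right_mult_one_mat[of _ n n] left_mult_one_mat[of _ n n])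

lemma state_spectral:
  assumes "state n A"
  obtains U e where "unitary n U" "A = U * mat_diag n (\<lambda>i. complex_of_real (e i)) * mat_adjoint U"
    "\<And>i. i < n \<Longrightarrow> 0 \<le> e i" "(\<Sum>i<n. e i) = 1"
proof -
  obtain U e where U: "unitary n U" and A: "A = U * mat_diag n (\<lambda>i. complex_of_real (e i)) * mat_adjoint U"
    and e: "\<And>i. i < n \<Longrightarrow> 0 \<le> e i"
    using psd_spectral[of n A] assms by (auto simp: state_def)
  have "rtr A = 1" using assms by (simp add: rtr_def state_def)
  then have "(\<Sum>i<n. e i) = 1" using rtr_spectral[OF U, of e] A by simp
  then show ?thesis using that U A e by blast
qed

lemma entropy_le_log_dim:
  assumes "state n A"
  shows "entropy A \<le> log 2 n"
proof -
  obtain U e where U: "unitary n U" and A: "A = U * mat_diag n (\<lambda>i. complex_of_real (e i)) * mat_adjoint U"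
    and e: "\<And>i. i < n \<Longrightarrow> 0 \<le> e i" "(\<Sum>i<n. e i) = 1" using state_spectral[OF assms] by blast
  have n: "0 < n" using e(2) by (cases n) auto
  have "- (e i * ln (e i)) \<le> e i * ln n + 1 / n - e i" if "i < n" for i
  proof (cases "e i = 0")
    case False
    then have p: "0 < e i" using e(1)[OF that] by simp
    have "e i * ln (1 / (n * e i)) \<le> e i * (1 / (n * e i) - 1)"
      using p n by (intro mult_left_mono ln_le_minus_one) auto
    also have "\<dots> = 1 / n - e i" using p n by (simp add: field_simps)
    finally show ?thesis using p n by (simp add: ln_div ln_mult algebra_simps)
  qed simp
  then have "(\<Sum>i<n. - (e i * ln (e i))) \<le> (\<Sum>i<n. e i * ln n + 1 / n - e i)" by (intro sum_mono) auto
  also have "\<dots> = ln n" using e(2) n by (simp add: sum.distrib sum_subtractf sum_distrib_right[symmetric])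
  finally have "(\<Sum>i<n. - (e i * ln (e i))) / ln 2 \<le> ln n / ln 2" by (intro divide_right_mono) auto
  then show ?thesis unfolding entropy_spectral[OF U A] by (simp add: log_def sum_negf sum_divide_distrib)
qed

lemma x_log_x_continuous: "continuous_on {0..} (\<lambda>x :: real. x * log 2 x)"
proof (rule continuous_on_eq_continuous_within[THEN iffD2], rule ballI)
  fix x :: real assume "x \<in> {0..}"
  show "continuous (at x within {0..}) (\<lambda>x. x * log 2 x)"
  proof (cases "x = 0")
    case True
    have "((\<lambda>x :: real. x * log 2 x) \<longlongrightarrow> 0) (at_right 0)" by real_asymp
    then have "((\<lambda>x :: real. x * log 2 x) \<longlongrightarrow> 0) (at 0 within {0..})"
      by (simp add: at_within_Ici_at_right)
    then show ?thesis using True by (simp add: continuous_within)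
  next
    case False
    then have "isCont (\<lambda>x. x * log 2 x) x" using \<open>x \<in> {0..}\<close> by (auto intro!: continuous_intros)
    then show ?thesis by (rule continuous_at_imp_continuous_at_within)
  qed
qed

definition mix_uniform :: "nat \<Rightarrow> real \<Rightarrow> complex mat \<Rightarrow> complex mat" where
  "mix_uniform n t A = complex_of_real (1 - t) \<cdot>\<^sub>m A + complex_of_real (t / n) \<cdot>\<^sub>m 1\<^sub>m n"

text \<open>Mixing a little of the uniform state into \<open>A\<close> makes it positive definite and keeps its eigenvectors, so
  continuity of \<open>x log x\<close> at \<open>0\<close> suffices to transfer estimates back to \<open>A\<close>.\<close>

lemma entropy_mix_uniform_tendsto:
  assumes "state n A"
  shows "((\<lambda>t. entropy (mix_uniform n t A)) \<longlongrightarrow> entropy A) (at_right 0)"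
proof -
  obtain U e where U: "unitary n U" and A: "A = U * mat_diag n (\<lambda>i. complex_of_real (e i)) * mat_adjoint U"
    and e: "\<And>i. i < n \<Longrightarrow> 0 \<le> e i" using state_spectral[OF assms] by blast
  note c = unitaryD[OF U]
  have "mix_uniform n t A = U * mat_diag n (\<lambda>i. complex_of_real ((1 - t) * e i + t / n)) * mat_adjoint U" for t
  proof -
    have "mat_diag n (\<lambda>i. complex_of_real ((1 - t) * e i + t / n)) =
      complex_of_real (1 - t) \<cdot>\<^sub>m mat_diag n (\<lambda>i. complex_of_real (e i)) + complex_of_real (t / n) \<cdot>\<^sub>m 1\<^sub>m n"
      by (rule eq_matI) (auto simp: mat_diag_def)
    then show ?thesis
      unfolding mix_uniform_def A using c
      by (simp add: add_mult_distrib_mat[of _ n n _ _ n] mult_add_distrib_mat[of _ n n _ n]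
        mult_smult_distrib[of _ n n _ n] mult_smult_assoc_mat[of _ n n _ n] mult_carrier_mat[of _ n n _ n]
        right_mult_one_mat[of _ n n])
  qed
  then have *: "entropy (mix_uniform n t A) = - (\<Sum>i<n. ((1 - t) * e i + t / n) * log 2 ((1 - t) * e i + t / n))" for t
    by (rule entropy_spectral[OF U])
  have lim: "((\<lambda>t. ((1 - t) * e i + t / n) * log 2 ((1 - t) * e i + t / n)) \<longlongrightarrow> e i * log 2 (e i)) (at_right 0)"
    if i: "i < n" for i
  proof -
    have "((\<lambda>x. x * log 2 x) \<longlongrightarrow> e i * log 2 (e i)) (at (e i) within {0..})"
      using x_log_x_continuous e[OF i] by (simp add: continuous_on_def)
    moreover have "((\<lambda>t. (1 - t) * e i + t / n) \<longlongrightarrow> (1 - 0) * e i + 0 / n) (at_right 0)"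
      using i by (intro tendsto_intros) auto
    moreover have "eventually (\<lambda>t. (1 - t) * e i + t / n \<in> {0..}) (at_right 0)"
      using eventually_at_right_real[of 0 "1 :: real"] by (rule eventually_mono) (use e[OF i] in auto)
    ultimately show ?thesis
      using continuous_on_tendsto_compose[OF x_log_x_continuous, of "\<lambda>t. (1 - t) * e i + t / n" "e i"] e[OF i] by simp
  qed
  show ?thesis
    unfolding * entropy_spectral[OF U A] by (intro tendsto_intros lim) auto
qed

text \<open>In an eigenbasis of \<open>A\<close> the diagonal entry \<open>q\<close> of \<open>P\<close> at an eigenvalue \<open>e\<close> satisfies \<open>e q = a q\<close> and
  \<open>e (1 - q) = b (1 - q)\<close>. So \<open>q\<close> acts as the probability that \<open>e\<close> is \<open>a\<close> rather than \<open>b\<close>, and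
  no eigenvectors have to be computed.\<close>

lemma entropy_two_valued:
  assumes A: "hermitian n A" and P: "P \<in> carrier_mat n n"
    and aP: "A * P = complex_of_real a \<cdot>\<^sub>m P"
    and bP: "A * (1\<^sub>m n - P) = complex_of_real b \<cdot>\<^sub>m (1\<^sub>m n - P)"
  shows "entropy A = - (a * log 2 a * rtr P + b * log 2 b * (n - rtr P))"
proof -
  obtain U e where U: "unitary n U" and AU: "A = U * mat_diag n (\<lambda>i. complex_of_real (e i)) * mat_adjoint U"
    using hermitian_spectral[of A n] A by (auto simp: hermitian_def)
  note c = unitaryD[OF U] and cA = hermitianD(1)[OF A]
  note assoc = assoc_mult_mat[of _ n n _ n _ n] mult_carrier_mat[of _ n n _ n]
  let ?D = "mat_diag n (\<lambda>i. complex_of_real (e i))"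
  define Q where "Q X = mat_adjoint U * X * U" for X
  have cQ: "Q X \<in> carrier_mat n n" if "X \<in> carrier_mat n n" for X
    unfolding Q_def using that c by (auto intro!: mult_carrier_mat)
  have DQ: "complex_of_real (e i) * Q X $$ (i, i) = complex_of_real x * Q X $$ (i, i)"
    if X: "X \<in> carrier_mat n n" and AX: "A * X = complex_of_real x \<cdot>\<^sub>m X" and i: "i < n" for X x i
  proof -
    have "?D * Q X = (mat_adjoint U * U) * ?D * (mat_adjoint U * (X * U))"
      unfolding Q_def c(3) using c(1,2) X by (simp add: assoc left_mult_one_mat[of _ n n])
    also have "\<dots> = mat_adjoint U * (A * X) * U"
      unfolding AU using c(1,2) X by (simp add: assoc)
    also have "\<dots> = complex_of_real x \<cdot>\<^sub>m Q X"
      unfolding AX Q_def using c(1,2) X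
      by (simp add: mult_smult_distrib[of _ n n _ n] mult_smult_assoc_mat[of _ n n _ n] mult_carrier_mat[of _ n n _ n])
    finally have "(?D * Q X) $$ (i, i) = (complex_of_real x \<cdot>\<^sub>m Q X) $$ (i, i)" by simp
    then show ?thesis using i cQ[OF X] by (simp add: mat_diag_mult_left[of _ n n])
  qed
  have Q1: "Q (1\<^sub>m n - P) = 1\<^sub>m n - Q P"
    unfolding Q_def using c P
    by (simp add: mult_minus_distrib_mat[of _ n n _ n] minus_mult_distrib_mat[of _ n n _ _ n] mult_carrier_mat[of _ n n _ n]
        right_mult_one_mat[of _ n n])
  have "e i * log 2 (e i) = a * log 2 a * Re (Q P $$ (i, i)) + b * log 2 b * (1 - Re (Q P $$ (i, i)))" if i: "i < n" for i
  proof -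
    define q where "q = Q P $$ (i, i)"
    have 1: "e i = a \<or> q = 0" using DQ[OF P aP i] by (auto simp: q_def)
    have "Q (1\<^sub>m n - P) $$ (i, i) = 1 - q" unfolding Q1 using i cQ[OF P] by (simp add: q_def)
    then have "e i = b \<or> q = 1" using DQ[OF _ bP i] P by (auto simp: minus_carrier_mat)
    with 1 show ?thesis by (auto simp: q_def[symmetric] algebra_simps)
  qed
  then have "(\<Sum>i<n. e i * log 2 (e i)) = (\<Sum>i<n. a * log 2 a * Re (Q P $$ (i, i)) + b * log 2 b * (1 - Re (Q P $$ (i, i))))"
    by (intro sum.cong) auto
  also have "\<dots> = a * log 2 a * rtr (Q P) + b * log 2 b * (n - rtr (Q P))"
    using cQ[OF P] by (simp add: rtr_def mat_trace_def sum.distrib sum_subtractf sum_distrib_left[symmetric])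
  also have "rtr (Q P) = rtr P"
  proof -
    have "rtr (Q P) = rtr (U * (mat_adjoint U * P))"
      unfolding Q_def using c P by (intro rtr_mult_comm[of _ n n]) auto
    also have "U * (mat_adjoint U * P) = (U * mat_adjoint U) * P"
      using c(1,2) P by (intro assoc_mult_mat[symmetric, of _ n n _ n _ n]) auto
    finally show ?thesis using c P by (simp add: left_mult_one_mat[of _ n n])
  qed
  finally show ?thesis unfolding entropy_spectral[OF U AU] by simp
qed

lemma entropy_kron:
  assumes "state a A" "state b B"
  shows "entropy (kron A B) = entropy A + entropy B"
proof -
  obtain U e where U: "unitary a U" and A: "A = U * mat_diag a (\<lambda>i. complex_of_real (e i)) * mat_adjoint U"
    and e: "\<And>i. i < a \<Longrightarrow> 0 \<le> e i" "(\<Sum>i<a. e i) = 1" using state_spectral[OF assms(1)] by blast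
  obtain V f where V: "unitary b V" and B: "B = V * mat_diag b (\<lambda>i. complex_of_real (f i)) * mat_adjoint V"
    and f: "\<And>i. i < b \<Longrightarrow> 0 \<le> f i" "(\<Sum>i<b. f i) = 1" using state_spectral[OF assms(2)] by blast
  have "kron A B = kron U V * mat_diag (a * b) (\<lambda>r. complex_of_real (e (r div b) * f (r mod b))) * mat_adjoint (kron U V)"
    unfolding A B by (rule kron_spectral[OF unitaryD(1)[OF U] unitaryD(1)[OF V]])
  from entropy_spectral[OF unitary_kron[OF U V] this]
  have "entropy (kron A B) = - (\<Sum>i<a. \<Sum>k<b. e i * f k * log 2 (e i * f k))"
    by (simp add: sum_lessThan_mult)
  also have "(\<Sum>i<a. \<Sum>k<b. e i * f k * log 2 (e i * f k))
      = (\<Sum>i<a. \<Sum>k<b. e i * log 2 (e i) * f k + e i * (f k * log 2 (f k)))"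
  proof (intro sum.cong refl)
    fix i k assume "i \<in> {..<a}" "k \<in> {..<b}"
    then have "0 \<le> e i" "0 \<le> f k" using e f by auto
    then show "e i * f k * log 2 (e i * f k) = e i * log 2 (e i) * f k + e i * (f k * log 2 (f k))"
      by (cases "e i = 0 \<or> f k = 0") (auto simp: log_mult algebra_simps)
  qed
  also have "\<dots> = (\<Sum>i<a. e i * log 2 (e i)) * (\<Sum>k<b. f k) + (\<Sum>i<a. e i) * (\<Sum>k<b. f k * log 2 (f k))"
    by (simp add: sum.distrib sum_product)
  finally show ?thesis unfolding e f entropy_spectral[OF U A] entropy_spectral[OF V B] by simp
qed

section \<open>Positive matrices\<close>

lemma dim_kron [simp]:
  "dim_row (kron A B) = dim_row A * dim_row B" "dim_col (kron A B) = dim_col A * dim_col B"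
  by (auto simp: kron_def)

lemma dim_ptrace [simp]:
  "dim_row (ptrace_fst d n X) = n" "dim_col (ptrace_fst d n X) = n"
  "dim_row (ptrace_snd d n X) = d" "dim_col (ptrace_snd d n X) = d"
  by (auto simp: ptrace_fst_def ptrace_snd_def)

lemma quad_form_sum:
  fixes A :: "complex mat"
  assumes "A \<in> carrier_mat n n" "v \<in> carrier_vec n"
  shows "(A *\<^sub>v v) \<bullet>c v = (\<Sum>i<n. \<Sum>j<n. A $$ (i, j) * v $ j * cnj (v $ i))"
  using assms by (auto simp: scalar_prod_def lessThan_atLeast0 sum_distrib_right intro!: sum.cong)

lemma quad_form_minus:
  fixes A B :: "complex mat"
  assumes "A \<in> carrier_mat n n" "B \<in> carrier_mat n n" "v \<in> carrier_vec n"
  shows "Re (((A - B) *\<^sub>v v) \<bullet>c v) = Re ((A *\<^sub>v v) \<bullet>c v) - Re ((B *\<^sub>v v) \<bullet>c v)"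
  using assms by (simp add: minus_mult_distrib_mat_vec[of _ n n] minus_scalar_prod_distrib[of _ n])

lemma quad_form_mat_diag:
  fixes v :: "complex vec"
  assumes "v \<in> carrier_vec n"
  shows "Re ((mat_diag n (\<lambda>i. complex_of_real (e i)) *\<^sub>v v) \<bullet>c v) = (\<Sum>i<n. e i * (cmod (v $ i))\<^sup>2)"
proof -
  have "(mat_diag n (\<lambda>i. complex_of_real (e i)) *\<^sub>v v) \<bullet>c v
      = (\<Sum>i<n. \<Sum>j<n. if i = j then complex_of_real (e j) * v $ j * cnj (v $ i) else 0)"
    unfolding quad_form_sum[OF mat_diag_dim assms] by (intro sum.cong refl) (simp add: mat_diag_def)
  also have "\<dots> = (\<Sum>i<n. complex_of_real (e i) * (v $ i * cnj (v $ i)))"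
    by (simp add: sum.delta' mult.assoc)
  also have "\<dots> = complex_of_real (\<Sum>i<n. e i * (cmod (v $ i))\<^sup>2)"
    by (simp only: of_real_sum of_real_mult complex_norm_square)
  finally show ?thesis by (simp del: of_real_sum)
qed

lemma hermitian_mat_diag: "hermitian n (mat_diag n (\<lambda>i. complex_of_real (e i)))"
  by (auto simp: hermitian_def mat_diag_def intro!: eq_matI)

lemma pos_def_mat_diag:
  assumes "\<And>i. i < n \<Longrightarrow> 0 < e i"
  shows "pos_def n (mat_diag n (\<lambda>i. complex_of_real (e i)))"
proof -
  have "0 < (\<Sum>i<n. e i * (cmod (v $ i))\<^sup>2)" if v: "v \<in> carrier_vec n" "v \<noteq> 0\<^sub>v n" for v :: "complex vec"
  proof -
    obtain k where k: "k < n" "v $ k \<noteq> 0" using v by (metis carrier_vecD eq_vecI index_zero_vec)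
    have nn: "0 \<le> e i * (cmod (v $ i))\<^sup>2" if "i < n" for i using assms[OF that] by simp
    have "0 < e k * (cmod (v $ k))\<^sup>2" using k assms by simp
    also have "\<dots> \<le> (\<Sum>i<n. e i * (cmod (v $ i))\<^sup>2)"
      using k nn by (intro member_le_sum) auto
    finally show ?thesis .
  qed
  then show ?thesis by (simp add: pos_def_def hermitian_mat_diag quad_form_mat_diag)
qed

lemma psd_mat_diag:
  assumes "\<And>i. i < n \<Longrightarrow> 0 \<le> e i"
  shows "positive_semidefinite n (mat_diag n (\<lambda>i. complex_of_real (e i)))"
  by (rule psdI) (auto simp: hermitian_mat_diag quad_form_mat_diag assms intro!: sum_nonneg)

lemma quad_form_sandwich:
  fixes A K :: "complex mat"
  assumes A: "A \<in> carrier_mat n n" and K: "K \<in> carrier_mat n n" and v: "v \<in> carrier_vec n"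
  shows "((mat_adjoint K * A * K) *\<^sub>v v) \<bullet>c v = (A *\<^sub>v (K *\<^sub>v v)) \<bullet>c (K *\<^sub>v v)"
proof -
  \<comment> \<open>The name \<open>m\<close> hides the numeral, which simplification would turn into \<open>Suc 0\<close>.\<close>
  define m where "m = (1 :: nat)"
  define X where "X = mat_of_cols n [v]"
  have X: "X \<in> carrier_mat n m" "col X 0 = v" using v by (auto simp: X_def m_def)
  have KX: "K * X \<in> carrier_mat n m" "col (K * X) 0 = K *\<^sub>v v" using X K by (auto simp: m_def col_mult2)
  have "mat_adjoint X * (mat_adjoint K * A * K) * X = mat_adjoint (K * X) * A * (K * X)"
    using A K X(1) by (simp add: mat_adjoint_mult[of _ n n _ m] assoc_mult_mat[of _ n n _ n _ n]
       assoc_mult_mat[of _ m n _ n _ n] assoc_mult_mat[of _ m n _ n _ m] assoc_mult_mat[of _ n n _ n _ m]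
       mult_carrier_mat[of _ n n _ n] mult_carrier_mat[of _ n n _ m] mult_carrier_mat[of _ m n _ n])
  moreover have "(mat_adjoint X * (mat_adjoint K * A * K) * X) $$ (0, 0) = ((mat_adjoint K * A * K) *\<^sub>v col X 0) \<bullet>c col X 0"
    using A K X(1) by (intro sandwich_index[of _ n _ m]) (auto simp: m_def intro!: mult_carrier_mat)
  moreover have "(mat_adjoint (K * X) * A * (K * X)) $$ (0, 0) = (A *\<^sub>v col (K * X) 0) \<bullet>c col (K * X) 0"
    using A KX(1) by (intro sandwich_index[of _ n _ m]) (auto simp: m_def)
  ultimately show ?thesis by (simp add: X(2) KX(2))
qed

lemma pos_def_unitary_conj:
  assumes A: "pos_def n A" and K: "unitary n K"
  shows "pos_def n (mat_adjoint K * A * K)"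
proof -
  note h = pos_def_hermitian[OF A] and c = unitaryD[OF K]
  have "0 < Re (((mat_adjoint K * A * K) *\<^sub>v v) \<bullet>c v)" if v: "v \<in> carrier_vec n" "v \<noteq> 0\<^sub>v n" for v
  proof -
    have "K *\<^sub>v v \<noteq> 0\<^sub>v n"
    proof
      assume "K *\<^sub>v v = 0\<^sub>v n"
      moreover have "mat_adjoint K *\<^sub>v 0\<^sub>v n = 0\<^sub>v n" by (intro eq_vecI) (use c in auto)
      ultimately have "mat_adjoint K *\<^sub>v (K *\<^sub>v v) = 0\<^sub>v n" by simp
      then show False using assoc_mult_mat_vec[OF c(2) c(1) v(1)] c(3) v by simp
    qed
    then show ?thesis
      unfolding quad_form_sandwich[OF hermitianD(1)[OF h] c(1) v(1)]
      using A c(1) v(1) by (auto simp: pos_def_def)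
  qed
  then show ?thesis using hermitian_sandwich[OF h c(1)] by (simp add: pos_def_def)
qed

lemma psd_sandwich:
  assumes A: "positive_semidefinite n A" and K: "K \<in> carrier_mat n n"
  shows "positive_semidefinite n (mat_adjoint K * A * K)"
proof (rule psdI)
  show "hermitian n (mat_adjoint K * A * K)" by (rule hermitian_sandwich[OF psd_hermitian[OF A] K])
  fix v :: "complex vec" assume v: "v \<in> carrier_vec n"
  show "0 \<le> Re (((mat_adjoint K * A * K) *\<^sub>v v) \<bullet>c v)"
    unfolding quad_form_sandwich[OF hermitianD(1)[OF psd_hermitian[OF A]] K v]
    by (rule psdD[OF A]) (use K v in auto)
qed

lemma psd_of_spectral:
  assumes U: "unitary n U" and e: "\<And>i. i < n \<Longrightarrow> 0 \<le> e i"
  shows "positive_semidefinite n (U * mat_diag n (\<lambda>i. complex_of_real (e i)) * mat_adjoint U)"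
  using psd_sandwich[OF psd_mat_diag[of n e], of "mat_adjoint U"] e unitaryD[OF U] by simp

lemma psd_kron:
  assumes "positive_semidefinite a A" "positive_semidefinite b B"
  shows "positive_semidefinite (a * b) (kron A B)"
proof -
  obtain U e where U: "unitary a U" and A: "A = U * mat_diag a (\<lambda>i. complex_of_real (e i)) * mat_adjoint U"
    and e: "\<And>i. i < a \<Longrightarrow> 0 \<le> e i" using psd_spectral[OF assms(1)] by blast
  obtain V f where V: "unitary b V" and B: "B = V * mat_diag b (\<lambda>i. complex_of_real (f i)) * mat_adjoint V"
    and f: "\<And>i. i < b \<Longrightarrow> 0 \<le> f i" using psd_spectral[OF assms(2)] by blast
  have "kron A B = kron U V * mat_diag (a * b) (\<lambda>r. complex_of_real (e (r div b) * f (r mod b))) * mat_adjoint (kron U V)"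
    unfolding A B by (rule kron_spectral[OF unitaryD(1)[OF U] unitaryD(1)[OF V]])
  moreover have "0 \<le> e (r div b) * f (r mod b)" if "r < a * b" for r
  proof -
    have "b \<noteq> 0" using that by (metis mult_0_right not_less_zero)
    then show ?thesis using that e f by (intro mult_nonneg_nonneg) (auto simp: less_mult_imp_div_less)
  qed
  ultimately show ?thesis by (simp only: psd_of_spectral[OF unitary_kron[OF U V]])
qed

lemma pos_def_diag_pos:
  assumes A: "pos_def n A" and i: "i < n"
  shows "0 < Re (A $$ (i, i))"
proof -
  note c = hermitianD(1)[OF pos_def_hermitian[OF A]]
  have "(A *\<^sub>v unit_vec n i) \<bullet>c unit_vec n i = (\<Sum>k<n. \<Sum>j<n. if j = i then (if k = i then A $$ (k, j) else 0) else 0)"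
    unfolding quad_form_sum[OF c unit_vec_carrier] using i by (intro sum.cong refl) simp
  also have "\<dots> = A $$ (i, i)" using i by simp
  finally have "(A *\<^sub>v unit_vec n i) \<bullet>c unit_vec n i = A $$ (i, i)" .
  moreover have "unit_vec n i \<noteq> (0\<^sub>v n :: complex vec)" using i by simp
  ultimately show ?thesis using A by (metis pos_def_def unit_vec_carrier)
qed

text \<open>Cauchy-Schwarz in an eigenbasis of \<open>A\<close>. If \<open>A\<close> is a bipartite state with diagonal first marginal and
  the weights are the entries of that marginal, then the first factor on the right is the
  dimension of the first system.\<close>

lemma psd_le_weighted_diagonal:
  assumes A: "positive_semidefinite n A" and w: "\<And>i. i < n \<Longrightarrow> 0 < w i" and v: "v \<in> carrier_vec n"
  shows "Re ((A *\<^sub>v v) \<bullet>c v) \<le> (\<Sum>i<n. Re (A $$ (i, i)) / w i) * (\<Sum>i<n. w i * (cmod (v $ i))\<^sup>2)"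
proof -
  obtain U e where U: "unitary n U" and AU: "A = U * mat_diag n (\<lambda>i. complex_of_real (e i)) * mat_adjoint U"
    and e: "\<And>i. i < n \<Longrightarrow> 0 \<le> e i" using psd_spectral[OF A] by blast
  note c = unitaryD(1,2)[OF U]
  have cA: "A \<in> carrier_mat n n" using A by (simp add: positive_semidefinite_def)
  have Aij: "A $$ (i, j) = (\<Sum>k<n. complex_of_real (e k) * (U $$ (i, k) * cnj (U $$ (j, k))))" if "i < n" "j < n" for i j
    unfolding AU using that c
    by (auto simp: mat_diag_mult_right[of _ n n] scalar_prod_def lessThan_atLeast0 intro!: sum.cong)
  have Aii: "Re (A $$ (i, i)) = (\<Sum>k<n. e k * (cmod (U $$ (i, k)))\<^sup>2)" if "i < n" for i
  proof -
    have "A $$ (i, i) = complex_of_real (\<Sum>k<n. e k * (cmod (U $$ (i, k)))\<^sup>2)"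
      unfolding Aij[OF that that] by (simp only: of_real_sum of_real_mult complex_norm_square)
    then show ?thesis by (simp del: of_real_sum)
  qed
  define z where "z k = (\<Sum>i<n. U $$ (i, k) * cnj (v $ i))" for k
  have "(A *\<^sub>v v) \<bullet>c v = (\<Sum>i<n. \<Sum>j<n. \<Sum>k<n. complex_of_real (e k) * ((U $$ (i, k) * cnj (v $ i)) * cnj (U $$ (j, k) * cnj (v $ j))))"
    unfolding quad_form_sum[OF cA v]
    by (intro sum.cong refl) (simp add: Aij sum_distrib_right sum_distrib_left mult_ac)
  also have "\<dots> = (\<Sum>i<n. \<Sum>k<n. \<Sum>j<n. complex_of_real (e k) * ((U $$ (i, k) * cnj (v $ i)) * cnj (U $$ (j, k) * cnj (v $ j))))"
    by (rule sum.cong[OF refl], rule sum.swap)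
  also have "\<dots> = (\<Sum>k<n. \<Sum>i<n. \<Sum>j<n. complex_of_real (e k) * ((U $$ (i, k) * cnj (v $ i)) * cnj (U $$ (j, k) * cnj (v $ j))))"
    by (rule sum.swap)
  also have "\<dots> = (\<Sum>k<n. complex_of_real (e k) * (z k * cnj (z k)))"
    unfolding z_def cnj_sum sum_product by (simp only: sum_distrib_left)
  also have "\<dots> = complex_of_real (\<Sum>k<n. e k * (cmod (z k))\<^sup>2)"
    by (simp only: of_real_sum of_real_mult complex_norm_square)
  finally have "Re ((A *\<^sub>v v) \<bullet>c v) = (\<Sum>k<n. e k * (cmod (z k))\<^sup>2)" by (simp del: of_real_sum)
  also have "\<dots> \<le> (\<Sum>k<n. e k * ((\<Sum>i<n. (cmod (U $$ (i, k)))\<^sup>2 / w i) * (\<Sum>i<n. w i * (cmod (v $ i))\<^sup>2)))"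
  proof (intro sum_mono mult_left_mono)
    fix k assume "k \<in> {..<n}"
    have "cmod (z k) \<le> (\<Sum>i<n. cmod (U $$ (i, k)) * cmod (v $ i))"
      unfolding z_def by (rule order_trans[OF norm_sum]) (simp add: norm_mult)
    also have "\<dots> = (\<Sum>i<n. (cmod (U $$ (i, k)) / sqrt (w i)) * (sqrt (w i) * cmod (v $ i)))"
    proof (intro sum.cong refl)
      fix i assume "i \<in> {..<n}"
      then have "0 < w i" using w by simp
      then show "cmod (U $$ (i, k)) * cmod (v $ i) = (cmod (U $$ (i, k)) / sqrt (w i)) * (sqrt (w i) * cmod (v $ i))"
        by simp
    qed
    finally have "(cmod (z k))\<^sup>2 \<le> (\<Sum>i<n. (cmod (U $$ (i, k)) / sqrt (w i)) * (sqrt (w i) * cmod (v $ i)))\<^sup>2"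
      by (intro power_mono) auto
    also have "\<dots> \<le> (\<Sum>i<n. (cmod (U $$ (i, k)) / sqrt (w i))\<^sup>2) * (\<Sum>i<n. (sqrt (w i) * cmod (v $ i))\<^sup>2)"
      by (rule Cauchy_Schwarz_ineq_sum)
    also have "\<dots> = (\<Sum>i<n. (cmod (U $$ (i, k)))\<^sup>2 / w i) * (\<Sum>i<n. w i * (cmod (v $ i))\<^sup>2)"
      using w by (intro arg_cong2[where f = "(*)"] sum.cong) (auto simp: power_divide power_mult_distrib less_imp_le)
    finally show "(cmod (z k))\<^sup>2 \<le> (\<Sum>i<n. (cmod (U $$ (i, k)))\<^sup>2 / w i) * (\<Sum>i<n. w i * (cmod (v $ i))\<^sup>2)" .
  qed (use e in auto)
  also have "\<dots> = (\<Sum>k<n. \<Sum>i<n. e k * (cmod (U $$ (i, k)))\<^sup>2 / w i) * (\<Sum>i<n. w i * (cmod (v $ i))\<^sup>2)"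
  proof -
    have "(\<Sum>k<n. e k * ((\<Sum>i<n. f i k) * C)) = (\<Sum>k<n. \<Sum>i<n. e k * f i k) * C" for f C
      by (simp add: sum_distrib_left sum_distrib_right mult.assoc)
    from this[of "\<lambda>i k. (cmod (U $$ (i, k)))\<^sup>2 / w i"] show ?thesis by simp
  qed
  also have "(\<Sum>k<n. \<Sum>i<n. e k * (cmod (U $$ (i, k)))\<^sup>2 / w i) = (\<Sum>i<n. Re (A $$ (i, i)) / w i)"
    by (subst sum.swap) (simp add: Aii sum_divide_distrib)
  finally show ?thesis .
qed

section \<open>Entropy gain of the depolarizing channel\<close>

text \<open>By the lemma \<open>entropy_depolarizing_pure\<close> below, this is, for integers \<open>M \<ge> 1\<close>, the number \<open>log M\<close>
  minus the entropy of a depolarized pure state in dimension \<open>M\<close>.\<close>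

definition pure_rate :: "real \<Rightarrow> real \<Rightarrow> real" where
  "pure_rate \<mu> M = ((1 - \<mu> + \<mu> * M) * log 2 (1 - \<mu> + \<mu> * M) + (M - 1) * ((1 - \<mu>) * log 2 (1 - \<mu>))) / M"

lemma Re_ptrace_snd_diag:
  "a < d \<Longrightarrow> Re (ptrace_snd d n X $$ (a, a)) = (\<Sum>i<n. Re (X $$ (a * n + i, a * n + i)))"
  by (simp add: ptrace_snd_def)

lemma rtr_ptrace_snd:
  assumes "X \<in> carrier_mat (d * n) (d * n)"
  shows "rtr (ptrace_snd d n X) = rtr X"
  using assms by (simp add: rtr_def mat_trace_def sum_lessThan_mult ptrace_snd_def)

text \<open>Here \<open>T\<close> is \<open>\<rho>\<^sub>A \<otimes> 1/n\<close>, so the left side is the relative entropy of \<open>S\<close> and \<open>T\<close> minus \<open>log n\<close>. The weighted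
  diagonal estimate gives \<open>\<rho> \<le> d (\<rho>\<^sub>A \<otimes> 1) = d n T\<close>, which is the hypothesis of the relative entropy
  bound with \<open>M = d n\<close>. The factor is \<open>d\<close> and not \<open>n\<close>, which is how the restriction on the
  entanglement enters.\<close>

lemma entropy_gain_diagonal_marginal:
  assumes \<rho>: "pos_def (d * n) \<rho>" "rtr \<rho> = 1" and dn: "0 < d" "0 < n" and \<mu>: "0 \<le> \<mu>" "\<mu> < 1"
    and marg: "ptrace_snd d n \<rho> = mat_diag d (\<lambda>a. complex_of_real (r a))"
    and T: "T = mat_diag (d * n) (\<lambda>x. complex_of_real (r (x div n) / n))"
    and S: "S = complex_of_real \<mu> \<cdot>\<^sub>m \<rho> + complex_of_real (1 - \<mu>) \<cdot>\<^sub>m T"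
  shows "entropy (mat_diag d (\<lambda>a. complex_of_real (r a))) - entropy S \<le> pure_rate \<mu> (real (d * n)) - log 2 n"
proof -
  let ?N = "d * n"
  note h\<rho> = pos_def_hermitian[OF \<rho>(1)] and c\<rho> = hermitianD(1)[OF pos_def_hermitian[OF \<rho>(1)]]
  have r: "r a = (\<Sum>i<n. Re (\<rho> $$ (a * n + i, a * n + i)))" if "a < d" for a
    using Re_ptrace_snd_diag[OF that, of n \<rho>] that unfolding marg by (simp add: mat_diag_def)
  have rpos: "0 < r a" if "a < d" for a
    unfolding r[OF that] using dn pair_index_less[OF that] pos_def_diag_pos[OF \<rho>(1)]
    by (intro sum_pos) auto
  have rsum: "(\<Sum>a<d. r a) = 1"
    using rtr_ptrace_snd[OF c\<rho>] \<rho>(2) unfolding marg by (simp add: rtr_def mat_trace_def mat_diag_def)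
  have xdiv: "x div n < d" if "x < ?N" for x using that by (simp add: less_mult_imp_div_less)
  have Tpd: "pos_def ?N T" unfolding T using rpos xdiv dn by (intro pos_def_mat_diag) auto
  note hT = pos_def_hermitian[OF Tpd] and cT = hermitianD(1)[OF pos_def_hermitian[OF Tpd]]
  have div: "(a * n + i) div n = a" if "i < n" for a i using that by simp
  have Ttr: "rtr T = 1"
    unfolding T using dn rsum by (simp add: rtr_def mat_trace_def mat_diag_def sum_lessThan_mult)
  have MT: "positive_semidefinite ?N (complex_of_real (real ?N) \<cdot>\<^sub>m T - \<rho>)"
  proof (rule psdI)
    show "hermitian ?N (complex_of_real (real ?N) \<cdot>\<^sub>m T - \<rho>)"
      using hT h\<rho> by (intro hermitian_minus hermitian_smult)
    fix v :: "complex vec" assume v: "v \<in> carrier_vec ?N"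
    have "Re ((\<rho> *\<^sub>v v) \<bullet>c v) \<le> (\<Sum>x<?N. Re (\<rho> $$ (x, x)) / r (x div n)) * (\<Sum>x<?N. r (x div n) * (cmod (v $ x))\<^sup>2)"
      using rpos xdiv by (intro psd_le_weighted_diagonal pos_def_psd \<rho> v) auto
    also have "(\<Sum>x<?N. Re (\<rho> $$ (x, x)) / r (x div n)) = (\<Sum>a<d. r a / r a)"
      unfolding sum_lessThan_mult
      by (intro sum.cong refl) (simp add: r[symmetric] sum_divide_distrib[symmetric])
    also have "\<dots> = (\<Sum>a<d. 1)"
      by (intro sum.cong refl) (metis divide_self lessThan_iff less_irrefl rpos)
    finally have "Re ((\<rho> *\<^sub>v v) \<bullet>c v) \<le> d * (\<Sum>x<?N. r (x div n) * (cmod (v $ x))\<^sup>2)" by simp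
    also have "\<dots> = real ?N * Re ((T *\<^sub>v v) \<bullet>c v)"
      unfolding T quad_form_mat_diag[OF v] using dn by (simp add: sum_distrib_left)
    finally show "0 \<le> Re (((complex_of_real (real ?N) \<cdot>\<^sub>m T - \<rho>) *\<^sub>v v) \<bullet>c v)"
      using quad_form_smult[OF cT v, of "real ?N"] cT c\<rho> v
      by (subst quad_form_minus[of _ ?N]) (auto simp del: of_nat_mult)
  qed
  have "1 \<le> real ?N" using dn by (metis One_nat_def Suc_leI nat_0_less_mult_iff of_nat_1 of_nat_le_iff)
  from relative_entropy_le_max_divergence[OF \<rho> Tpd Ttr this MT \<mu> S]
  have "(rtr (S * herm_fun ln S) - rtr (S * herm_fun ln T)) / ln 2 \<le>
      (((1 - \<mu> + \<mu> * ?N) * ln (1 - \<mu> + \<mu> * ?N) + (real ?N - 1) * ((1 - \<mu>) * ln (1 - \<mu>))) / ?N) / ln 2"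
    by (intro divide_right_mono) auto
  also have "\<dots> = pure_rate \<mu> ?N"
    by (simp add: pure_rate_def log_def add_divide_distrib mult.commute)
  finally have main: "(rtr (S * herm_fun ln S) - rtr (S * herm_fun ln T)) / ln 2 \<le> pure_rate \<mu> ?N" .
  have cS: "S \<in> carrier_mat ?N ?N" using cT c\<rho> by (simp add: S)
  have hS: "hermitian ?N S" unfolding S using hT h\<rho> by (intro hermitian_add hermitian_smult)
  have Tln: "herm_fun ln T = mat_diag ?N (\<lambda>x. complex_of_real (ln (r (x div n) / n)))"
    using herm_fun_eq[OF unitary_one, of T ?N "\<lambda>x. r (x div n) / n" ln]
    by (simp add: T right_mult_one_mat[of _ ?N ?N] left_mult_one_mat[of _ ?N ?N])
  have Sdiag: "(\<Sum>i<n. Re (S $$ (a * n + i, a * n + i))) = r a" if a: "a < d" for a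
  proof -
    have "(\<Sum>i<n. Re (S $$ (a * n + i, a * n + i))) = (\<Sum>i<n. \<mu> * Re (\<rho> $$ (a * n + i, a * n + i)) + (1 - \<mu>) * (r a / n))"
      using cT c\<rho> pair_index_less[OF a] by (intro sum.cong refl) (simp add: S T mat_diag_def)
    also have "\<dots> = \<mu> * r a + (1 - \<mu>) * r a"
      using dn by (simp add: sum.distrib sum_distrib_left[symmetric] r[OF a])
    finally show ?thesis by (simp add: algebra_simps)
  qed
  have "rtr (S * herm_fun ln T) = (\<Sum>x<?N. Re (S $$ (x, x)) * ln (r (x div n) / n))"
    unfolding Tln using cS by (simp add: mat_diag_mult_right[of _ ?N ?N] rtr_def mat_trace_def)
  also have "\<dots> = (\<Sum>a<d. r a * ln (r a / n))"
    unfolding sum_lessThan_mult by (intro sum.cong refl) (simp add: Sdiag sum_distrib_right[symmetric])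
  also have "\<dots> = (\<Sum>a<d. r a * ln (r a) - r a * ln n)"
    using rpos dn by (intro sum.cong refl) (simp add: ln_div right_diff_distrib)
  also have "\<dots> = (\<Sum>a<d. r a * ln (r a)) - ln n"
    using rsum by (simp add: sum_subtractf sum_distrib_right[symmetric])
  finally have "rtr (S * herm_fun ln T) / ln 2 = - entropy (mat_diag d (\<lambda>a. complex_of_real (r a))) - log 2 n"
    by (simp add: entropy_mat_diag log_def diff_divide_distrib sum_divide_distrib)
  moreover have "rtr (S * herm_fun ln S) / ln 2 = - entropy S" by (simp add: entropy_ln[OF hS])
  ultimately show ?thesis using main by (simp add: diff_divide_distrib)
qed

lemma hermitianI:
  assumes "A \<in> carrier_mat n n" "\<And>i j. i < n \<Longrightarrow> j < n \<Longrightarrow> cnj (A $$ (j, i)) = A $$ (i, j)"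
  shows "hermitian n A"
  unfolding hermitian_def using assms by (auto intro!: eq_matI)

lemma hermitian_entry: "hermitian n A \<Longrightarrow> i < n \<Longrightarrow> j < n \<Longrightarrow> cnj (A $$ (j, i)) = A $$ (i, j)"
  unfolding hermitian_def by (metis carrier_matD index_mat_adjoint)

lemma ptrace_snd_carrier [simp]: "ptrace_snd d n X \<in> carrier_mat d d"
  by (simp add: ptrace_snd_def)

lemma psd_ptrace_snd:
  assumes X: "positive_semidefinite (d * n) X"
  shows "positive_semidefinite d (ptrace_snd d n X)"
proof (rule psdI)
  note h = psd_hermitian[OF X]
  show "hermitian d (ptrace_snd d n X)"
    using hermitian_entry[OF h] pair_index_less by (intro hermitianI) (simp_all add: ptrace_snd_def)
  fix v :: "complex vec" assume v: "v \<in> carrier_vec d"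
  define w where "w i = vec (d * n) (\<lambda>x. if x mod n = i then v $ (x div n) else 0)" for i
  have we: "w i $ (a * n + k) = (if k = i then v $ a else 0)" if "a < d" "k < n" for a k i
    using that pair_index_less[of a d k n] by (simp add: w_def)
  have "(ptrace_snd d n X *\<^sub>v v) \<bullet>c v = (\<Sum>a<d. \<Sum>b<d. \<Sum>i<n. X $$ (a * n + i, b * n + i) * v $ b * cnj (v $ a))"
    using v by (subst quad_form_sum[of _ d]) (auto simp: ptrace_snd_def sum_distrib_right intro!: sum.cong)
  also have "\<dots> = (\<Sum>a<d. \<Sum>i<n. \<Sum>b<d. X $$ (a * n + i, b * n + i) * v $ b * cnj (v $ a))"
    by (rule sum.cong[OF refl], rule sum.swap)
  also have "\<dots> = (\<Sum>i<n. \<Sum>a<d. \<Sum>b<d. X $$ (a * n + i, b * n + i) * v $ b * cnj (v $ a))"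
    by (rule sum.swap)
  also have "\<dots> = (\<Sum>i<n. (X *\<^sub>v w i) \<bullet>c w i)"
  proof (rule sum.cong[OF refl])
    fix i assume i: "i \<in> {..<n}"
    have "(X *\<^sub>v w i) \<bullet>c w i = (\<Sum>x<d * n. \<Sum>y<d * n. X $$ (x, y) * w i $ y * cnj (w i $ x))"
      using h by (intro quad_form_sum) (auto simp: w_def hermitian_def)
    also have "\<dots> = (\<Sum>a<d. \<Sum>k<n. \<Sum>b<d. \<Sum>l<n. X $$ (a * n + k, b * n + l) * w i $ (b * n + l) * cnj (w i $ (a * n + k)))"
      unfolding sum_lessThan_mult ..
    also have "\<dots> = (\<Sum>a<d. \<Sum>k<n. \<Sum>b<d. \<Sum>l<n. if l = i then X $$ (a * n + k, b * n + l) * v $ b * cnj (w i $ (a * n + k)) else 0)"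
      by (intro sum.cong refl) (simp add: we)
    also have "\<dots> = (\<Sum>a<d. \<Sum>k<n. \<Sum>b<d. X $$ (a * n + k, b * n + i) * v $ b * cnj (w i $ (a * n + k)))"
      using i by simp
    also have "\<dots> = (\<Sum>a<d. \<Sum>k<n. if k = i then (\<Sum>b<d. X $$ (a * n + k, b * n + i) * v $ b * cnj (v $ a)) else 0)"
      by (intro sum.cong refl) (simp add: we)
    also have "\<dots> = (\<Sum>a<d. \<Sum>b<d. X $$ (a * n + i, b * n + i) * v $ b * cnj (v $ a))"
      using i by simp
    finally show "(\<Sum>a<d. \<Sum>b<d. X $$ (a * n + i, b * n + i) * v $ b * cnj (v $ a)) = (X *\<^sub>v w i) \<bullet>c w i" ..
  qed
  finally show "0 \<le> Re ((ptrace_snd d n X *\<^sub>v v) \<bullet>c v)"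
    by (auto intro!: sum_nonneg psdD[OF X] simp: w_def)
qed

lemma psd_ptrace_fst:
  assumes X: "positive_semidefinite (d * n) X"
  shows "positive_semidefinite n (ptrace_fst d n X)"
proof (rule psdI)
  note h = psd_hermitian[OF X]
  show "hermitian n (ptrace_fst d n X)"
    using hermitian_entry[OF h] pair_index_less by (intro hermitianI) (simp_all add: ptrace_fst_def)
  fix v :: "complex vec" assume v: "v \<in> carrier_vec n"
  define w where "w a = vec (d * n) (\<lambda>x. if x div n = a then v $ (x mod n) else 0)" for a
  have we: "w a $ (b * n + k) = (if b = a then v $ k else 0)" if "b < d" "k < n" for a k b
    using that pair_index_less[of b d k n] by (simp add: w_def)
  have "(ptrace_fst d n X *\<^sub>v v) \<bullet>c v = (\<Sum>i<n. \<Sum>j<n. \<Sum>a<d. X $$ (a * n + i, a * n + j) * v $ j * cnj (v $ i))"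
    using v by (subst quad_form_sum[of _ n]) (auto simp: ptrace_fst_def sum_distrib_right intro!: sum.cong)
  also have "\<dots> = (\<Sum>i<n. \<Sum>a<d. \<Sum>j<n. X $$ (a * n + i, a * n + j) * v $ j * cnj (v $ i))"
    by (rule sum.cong[OF refl], rule sum.swap)
  also have "\<dots> = (\<Sum>a<d. \<Sum>i<n. \<Sum>j<n. X $$ (a * n + i, a * n + j) * v $ j * cnj (v $ i))"
    by (rule sum.swap)
  also have "\<dots> = (\<Sum>a<d. (X *\<^sub>v w a) \<bullet>c w a)"
  proof (rule sum.cong[OF refl])
    fix a assume a: "a \<in> {..<d}"
    have "(X *\<^sub>v w a) \<bullet>c w a = (\<Sum>x<d * n. \<Sum>y<d * n. X $$ (x, y) * w a $ y * cnj (w a $ x))"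
      using h by (intro quad_form_sum) (auto simp: w_def hermitian_def)
    also have "\<dots> = (\<Sum>b<d. \<Sum>i<n. \<Sum>c<d. \<Sum>j<n. X $$ (b * n + i, c * n + j) * w a $ (c * n + j) * cnj (w a $ (b * n + i)))"
      unfolding sum_lessThan_mult ..
    also have "\<dots> = (\<Sum>b<d. \<Sum>i<n. \<Sum>c<d. if c = a then (\<Sum>j<n. X $$ (b * n + i, c * n + j) * v $ j * cnj (w a $ (b * n + i))) else 0)"
      by (intro sum.cong refl) (simp add: we)
    also have "\<dots> = (\<Sum>b<d. if b = a then (\<Sum>i<n. \<Sum>j<n. X $$ (b * n + i, a * n + j) * v $ j * cnj (v $ i)) else 0)"
      using a by (intro sum.cong refl) (simp add: we)
    also have "\<dots> = (\<Sum>i<n. \<Sum>j<n. X $$ (a * n + i, a * n + j) * v $ j * cnj (v $ i))"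
      using a by simp
    finally show "(\<Sum>i<n. \<Sum>j<n. X $$ (a * n + i, a * n + j) * v $ j * cnj (v $ i)) = (X *\<^sub>v w a) \<bullet>c w a" ..
  qed
  finally show "0 \<le> Re ((ptrace_fst d n X *\<^sub>v v) \<bullet>c v)"
    by (auto intro!: sum_nonneg psdD[OF X] simp: w_def)
qed

lemma rtr_unitary_conj:
  assumes K: "unitary n K" and A: "A \<in> carrier_mat n n"
  shows "rtr (mat_adjoint K * A * K) = rtr A"
proof -
  note c = unitaryD[OF K]
  have "rtr (mat_adjoint K * A * K) = rtr (K * (mat_adjoint K * A))"
    using c A by (intro rtr_mult_comm[of _ n n]) auto
  also have "K * (mat_adjoint K * A) = (K * mat_adjoint K) * A"
    using c(1,2) A by (intro assoc_mult_mat[symmetric, of _ n n _ n _ n]) auto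
  finally show ?thesis unfolding c(4) left_mult_one_mat[OF A] .
qed

text \<open>A unitary on the first system diagonalizes the marginal; it commutes with the channel and preserves all
  entropies.\<close>

lemma entropy_gain_pos_def:
  assumes \<rho>: "pos_def (d * n) \<rho>" "rtr \<rho> = 1" and dn: "0 < d" "0 < n" and \<mu>: "0 \<le> \<mu>" "\<mu> < 1"
    and S: "S = complex_of_real \<mu> \<cdot>\<^sub>m \<rho> +
      complex_of_real (1 - \<mu>) \<cdot>\<^sub>m (complex_of_real (1 / n) \<cdot>\<^sub>m kron (ptrace_snd d n \<rho>) (1\<^sub>m n))"
  shows "entropy (ptrace_snd d n \<rho>) - entropy S \<le> pure_rate \<mu> (real (d * n)) - log 2 n"
proof -
  let ?N = "d * n" and ?A = "ptrace_snd d n \<rho>"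
  note h\<rho> = pos_def_hermitian[OF \<rho>(1)] and c\<rho> = hermitianD(1)[OF pos_def_hermitian[OF \<rho>(1)]]
  have hA: "hermitian d ?A" by (rule psd_hermitian[OF psd_ptrace_snd[OF pos_def_psd[OF \<rho>(1)]]])
  note cA = hermitianD(1)[OF hA]
  obtain G r where G: "unitary d G" and AG: "?A = G * mat_diag d (\<lambda>i. complex_of_real (r i)) * mat_adjoint G"
    using hermitian_spectral[OF hermitianD[OF hA]] by blast
  note cG = unitaryD[OF G]
  let ?D = "mat_diag d (\<lambda>i. complex_of_real (r i))"
  define K where "K = kron G (1\<^sub>m n)"
  have K: "unitary ?N K" unfolding K_def by (rule unitary_kron[OF G unitary_one])
  note cK = unitaryD[OF K]
  have GAG: "mat_adjoint G * ?A * G = ?D"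
  proof -
    have "mat_adjoint G * ?A * G = (mat_adjoint G * G) * ?D * (mat_adjoint G * G)"
      unfolding AG using cG(1,2) by (simp add: assoc_mult_mat[of _ d d _ d _ d] mult_carrier_mat[of _ d d _ d])
    then show ?thesis using cG by (simp add: right_mult_one_mat[of _ d d] left_mult_one_mat[of _ d d])
  qed
  define B where "B = kron ?A (1\<^sub>m n)"
  have cB: "B \<in> carrier_mat ?N ?N" unfolding B_def by (intro kron_carrier) auto
  have hB: "hermitian ?N B"
    using cB hermitianD(2)[OF hA] by (simp add: hermitian_def B_def kron_adjoint)
  have KBK: "mat_adjoint K * B * K = kron ?D (1\<^sub>m n)"
    unfolding K_def B_def kron_adjoint using cG cA
    by (simp add: kron_mult[of _ d d _ d _ n n _ n] mult_carrier_mat[of _ d d _ d] GAG)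
  define T' where "T' = mat_diag ?N (\<lambda>x. complex_of_real (r (x div n) / n))"
  have T': "complex_of_real (1 / n) \<cdot>\<^sub>m kron ?D (1\<^sub>m n) = T'"
    unfolding T'_def using kron_mat_diag[of d "\<lambda>i. complex_of_real (r i)" n "\<lambda>_. 1"]
    by (auto simp: mat_diag_def intro!: eq_matI)
  have hS: "hermitian ?N S" unfolding S B_def[symmetric] using h\<rho> hB by (intro hermitian_add hermitian_smult)
  have "mat_adjoint K * S * K = complex_of_real \<mu> \<cdot>\<^sub>m (mat_adjoint K * \<rho> * K) + complex_of_real (1 - \<mu>) \<cdot>\<^sub>m T'"
    unfolding S B_def[symmetric] T'[symmetric] KBK[symmetric] using cK c\<rho> cB
    by (simp add: add_mult_distrib_mat[of _ ?N ?N _ _ ?N] mult_add_distrib_mat[of _ ?N ?N _ ?N]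
      mult_smult_distrib[of _ ?N ?N _ ?N] mult_smult_assoc_mat[of _ ?N ?N _ ?N] mult_carrier_mat[of _ ?N ?N _ ?N])
  from entropy_gain_diagonal_marginal[OF pos_def_unitary_conj[OF \<rho>(1) K] _ dn \<mu> _ T'_def this]
  have "entropy ?D - entropy (mat_adjoint K * S * K) \<le> pure_rate \<mu> (real (d * n)) - log 2 n"
    using ptrace_snd_sandwich[OF cG(1) c\<rho>] \<rho>(2)
    by (simp add: rtr_unitary_conj[OF K c\<rho>] K_def[symmetric] GAG)
  moreover have "entropy ?D = entropy ?A"
    using entropy_unitary_conj[OF hA G] by (simp add: GAG)
  ultimately show ?thesis using entropy_unitary_conj[OF hS K] by simp
qed

lemma psd_one: "positive_semidefinite n (1\<^sub>m n)"
  using psd_mat_diag[of n "\<lambda>_. 1"] by simp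

lemma state_iff_rtr: "state n A \<longleftrightarrow> positive_semidefinite n A \<and> rtr A = 1"
proof -
  have "Im (mat_trace A) = 0" if "positive_semidefinite n A"
  proof -
    note h = psd_hermitian[OF that]
    have "Im (A $$ (i, i)) = 0" if "i < n" for i
      using hermitian_entry[OF h that that] by (simp add: complex_eq_iff)
    then show ?thesis using hermitianD(1)[OF h] by (simp add: mat_trace_def)
  qed
  then show ?thesis by (auto simp: state_def rtr_def complex_eq_iff)
qed

lemma stateD:
  assumes "state n A"
  shows "positive_semidefinite n A" "hermitian n A" "A \<in> carrier_mat n n" "rtr A = 1" "mat_trace A = 1"
  using assms psd_hermitian state_iff_rtr hermitianD by (auto simp: state_def)

lemma state_convex:
  assumes "state n A" "state n B" "0 \<le> t" "t \<le> 1"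
  shows "state n (complex_of_real t \<cdot>\<^sub>m A + complex_of_real (1 - t) \<cdot>\<^sub>m B)"
  using stateD[OF assms(1)] stateD[OF assms(2)] assms(3,4)
  by (auto simp: state_iff_rtr rtr_add[of _ n] rtr_smult[of _ n] simp del: of_real_diff intro!: psd_add psd_smult)

lemma state_uniform:
  assumes "0 < n"
  shows "state n (complex_of_real (1 / n) \<cdot>\<^sub>m 1\<^sub>m n)"
  using assms by (auto simp: state_iff_rtr rtr_smult[of _ n] rtr_one simp del: of_real_divide intro!: psd_smult psd_one)

lemma state_kron:
  assumes "state a A" "state b B"
  shows "state (a * b) (kron A B)"
proof -
  have "mat_trace (kron A B) = mat_trace A * mat_trace B"
    using stateD(3)[OF assms(1)] stateD(3)[OF assms(2)]
    by (simp add: carrier_matD[OF kron_carrier[OF stateD(3)[OF assms(1)] stateD(3)[OF assms(2)]]] mat_trace_def sum_lessThan_mult sum_product index_kron[of _ a a _ b b])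
  then show ?thesis using psd_kron stateD[OF assms(1)] stateD[OF assms(2)] by (simp add: state_def)
qed

lemma state_ptrace_snd: "state (d * n) X \<Longrightarrow> state d (ptrace_snd d n X)"
  by (simp add: state_iff_rtr psd_ptrace_snd rtr_ptrace_snd[OF stateD(3)])

lemma state_ptrace_fst:
  assumes "state (d * n) X"
  shows "state n (ptrace_fst d n X)"
proof -
  have "rtr (ptrace_fst d n X) = rtr X"
    using stateD(3)[OF assms] sum.swap[of "\<lambda>a i. Re (X $$ (a * n + i, a * n + i))" "{..<n}" "{..<d}"]
    by (simp add: rtr_def mat_trace_def sum_lessThan_mult ptrace_fst_def)
  then show ?thesis using assms by (simp add: state_iff_rtr psd_ptrace_fst)
qed

lemma state_mixture:
  assumes p: "\<And>i. i \<in> {1..K} \<Longrightarrow> 0 \<le> p i" "(\<Sum>i = 1..K. p i) = 1"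
    and R: "\<And>i. i \<in> {1..K} \<Longrightarrow> state n (R i)"
  shows "state n (mixture n K p R)"
proof -
  let ?M = "mixture n K p R"
  have cM: "?M \<in> carrier_mat n n" by (simp add: mixture_def)
  have "positive_semidefinite n ?M"
  proof (rule psdI)
    show "hermitian n ?M"
    proof (rule hermitianI[OF cM])
      fix i j assume ij: "i < n" "j < n"
      show "cnj (?M $$ (j, i)) = ?M $$ (i, j)"
        using ij hermitian_entry[OF stateD(2)[OF R]] by (auto simp: mixture_def intro!: sum.cong)
    qed
    fix v :: "complex vec" assume v: "v \<in> carrier_vec n"
    have "(?M *\<^sub>v v) \<bullet>c v = (\<Sum>i<n. \<Sum>j<n. \<Sum>k = 1..K. complex_of_real (p k) * (R k $$ (i, j) * v $ j * cnj (v $ i)))"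
      unfolding quad_form_sum[OF cM v]
      by (intro sum.cong refl) (simp add: mixture_def sum_distrib_left sum_distrib_right mult_ac)
    also have "\<dots> = (\<Sum>i<n. \<Sum>k = 1..K. \<Sum>j<n. complex_of_real (p k) * (R k $$ (i, j) * v $ j * cnj (v $ i)))"
      by (rule sum.cong[OF refl], rule sum.swap)
    also have "\<dots> = (\<Sum>k = 1..K. \<Sum>i<n. \<Sum>j<n. complex_of_real (p k) * (R k $$ (i, j) * v $ j * cnj (v $ i)))"
      by (rule sum.swap)
    also have "\<dots> = (\<Sum>k = 1..K. complex_of_real (p k) * ((R k *\<^sub>v v) \<bullet>c v))"
      by (intro sum.cong refl) (simp add: quad_form_sum[OF stateD(3)[OF R] v] sum_distrib_left)
    finally show "0 \<le> Re ((?M *\<^sub>v v) \<bullet>c v)"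
      using p psdD[OF stateD(1)[OF R] v] by (auto intro!: sum_nonneg)
  qed
  moreover have "mat_trace ?M = 1"
  proof -
    have "mat_trace ?M = (\<Sum>i<n. \<Sum>k = 1..K. complex_of_real (p k) * R k $$ (i, i))"
      using cM by (simp add: mat_trace_def mixture_def)
    also have "\<dots> = (\<Sum>k = 1..K. \<Sum>i<n. complex_of_real (p k) * R k $$ (i, i))" by (rule sum.swap)
    also have "\<dots> = (\<Sum>k = 1..K. complex_of_real (p k) * mat_trace (R k))"
      using stateD(3)[OF R] by (intro sum.cong refl) (auto simp: mat_trace_def sum_distrib_left)
    also have "\<dots> = (\<Sum>k = 1..K. complex_of_real (p k))" using stateD(5)[OF R] by (intro sum.cong refl) simp
    also have "\<dots> = complex_of_real 1" unfolding p(2)[symmetric] by simp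
    finally show ?thesis by simp
  qed
  ultimately show ?thesis by (simp add: state_def)
qed

lemma depolarizing_state:
  assumes "state n A"
  shows "depolarizing n \<mu> A = complex_of_real \<mu> \<cdot>\<^sub>m A + complex_of_real (1 - \<mu>) \<cdot>\<^sub>m (complex_of_real (1 / n) \<cdot>\<^sub>m 1\<^sub>m n)"
  using stateD(3,5)[OF assms] by (auto simp: depolarizing_def intro!: eq_matI)

lemma state_depolarizing:
  assumes "state n A" "0 < n" "0 \<le> \<mu>" "\<mu> \<le> 1"
  shows "state n (depolarizing n \<mu> A)"
  unfolding depolarizing_state[OF assms(1)] using assms state_uniform by (intro state_convex) auto

text \<open>Every state is a limit of positive definite ones, and mixing with the uniform state commutes with taking
  the marginal and with the channel.\<close>

theorem entropy_gain_le_pure_rate: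
  assumes \<rho>: "state (d * n) \<rho>" and dn: "0 < d" "0 < n" and \<mu>: "0 \<le> \<mu>" "\<mu> < 1"
    and S: "S = complex_of_real \<mu> \<cdot>\<^sub>m \<rho> +
      complex_of_real (1 - \<mu>) \<cdot>\<^sub>m (complex_of_real (1 / n) \<cdot>\<^sub>m kron (ptrace_snd d n \<rho>) (1\<^sub>m n))"
  shows "entropy (ptrace_snd d n \<rho>) - entropy S \<le> pure_rate \<mu> (real (d * n)) - log 2 n"
proof -
  let ?N = "d * n" and ?A = "ptrace_snd d n \<rho>"
  have A: "state d ?A" by (rule state_ptrace_snd[OF \<rho>])
  have N: "0 < ?N" using dn by simp
  have kr: "complex_of_real (1 / n) \<cdot>\<^sub>m kron X (1\<^sub>m n) = kron X (complex_of_real (1 / n) \<cdot>\<^sub>m 1\<^sub>m n)" for X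
    by (rule eq_matI) (use dn in \<open>auto simp: kron_def\<close>)
  have S_state: "state ?N S"
    unfolding S kr using \<rho> A dn \<mu> state_uniform by (intro state_convex state_kron) auto
  define \<rho>' where "\<rho>' t = mix_uniform ?N t \<rho>" for t
  have pos: "pos_def ?N (\<rho>' t)" "rtr (\<rho>' t) = 1" if "0 < t" "t < 1" for t
  proof -
    have "pos_def ?N (1\<^sub>m ?N)" using pos_def_mat_diag[of ?N "\<lambda>_. 1"] by simp
    from pos_def_add_psd[OF this psd_smult[OF stateD(1)[OF \<rho>], of "1 - t"], of "t / ?N"]
    show "pos_def ?N (\<rho>' t)"
      using that N stateD(3)[OF \<rho>] by (simp add: \<rho>'_def mix_uniform_def comm_add_mat[of _ ?N ?N])
    show "rtr (\<rho>' t) = 1"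
      using stateD[OF \<rho>] N
      by (simp add: \<rho>'_def mix_uniform_def rtr_add[of _ ?N] rtr_smult[of _ ?N] rtr_one del: of_real_diff of_real_divide of_nat_mult)
  qed
  have A': "ptrace_snd d n (\<rho>' t) = mix_uniform d t ?A" for t
  proof (rule eq_matI)
    fix a b assume "a < dim_row (mix_uniform d t ?A)" "b < dim_col (mix_uniform d t ?A)"
    then have ab: "a < d" "b < d" by (auto simp: mix_uniform_def)
    have eq: "a * n + i = b * n + i \<longleftrightarrow> a = b" for i using dn by simp
    have "ptrace_snd d n (\<rho>' t) $$ (a, b) = (\<Sum>i<n. complex_of_real (1 - t) * \<rho> $$ (a * n + i, b * n + i) + (if a = b then complex_of_real (t / ?N) else 0))"
      using ab stateD(3)[OF \<rho>] pair_index_less[OF ab(1)] pair_index_less[OF ab(2)]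
      by (auto simp: ptrace_snd_def \<rho>'_def mix_uniform_def eq intro!: sum.cong)
    also have "\<dots> = mix_uniform d t ?A $$ (a, b)"
      using ab dn by (simp add: mix_uniform_def ptrace_snd_def sum.distrib sum_distrib_left)
    finally show "ptrace_snd d n (\<rho>' t) $$ (a, b) = mix_uniform d t ?A $$ (a, b)" .
  qed (auto simp: mix_uniform_def ptrace_snd_def)
  have S': "complex_of_real \<mu> \<cdot>\<^sub>m \<rho>' t +
      complex_of_real (1 - \<mu>) \<cdot>\<^sub>m (complex_of_real (1 / n) \<cdot>\<^sub>m kron (ptrace_snd d n (\<rho>' t)) (1\<^sub>m n)) = mix_uniform ?N t S" for t
  proof (rule eq_mat_pairI[of _ d n d n])
    have cK: "kron (mix_uniform d t ?A) (1\<^sub>m n) \<in> carrier_mat ?N ?N" "kron ?A (1\<^sub>m n) \<in> carrier_mat ?N ?N"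
      by (auto simp: mix_uniform_def intro!: kron_carrier)
    fix i k j l assume ix: "i < d" "k < n" "j < d" "l < n"
    have eq: "i * n + k = j * n + l \<longleftrightarrow> i = j \<and> k = l"
      using ix by (intro pair_index_eq_iff)
    have "mix_uniform d t ?A \<in> carrier_mat d d" by (simp add: mix_uniform_def)
    note index_kron[OF this one_carrier_mat ix] index_kron[OF ptrace_snd_carrier one_carrier_mat ix, of n \<rho>]
    then show "(complex_of_real \<mu> \<cdot>\<^sub>m \<rho>' t +
        complex_of_real (1 - \<mu>) \<cdot>\<^sub>m (complex_of_real (1 / n) \<cdot>\<^sub>m kron (ptrace_snd d n (\<rho>' t)) (1\<^sub>m n))) $$ (i * n + k, j * n + l)
       = mix_uniform ?N t S $$ (i * n + k, j * n + l)"
      unfolding A' using cK stateD(3)[OF \<rho>] ix pair_index_less[of i d k n] pair_index_less[of j d l n] dn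
      by (simp add: \<rho>'_def S mix_uniform_def eq) (auto simp: field_simps)
  qed (use stateD(3)[OF \<rho>] in \<open>auto simp: S \<rho>'_def mix_uniform_def intro!: kron_carrier\<close>)
  have "((\<lambda>t. entropy (mix_uniform d t ?A) - entropy (mix_uniform ?N t S)) \<longlongrightarrow> entropy ?A - entropy S) (at_right 0)"
    by (intro tendsto_diff entropy_mix_uniform_tendsto A S_state)
  moreover have "\<forall>\<^sub>F t in at_right 0. entropy (mix_uniform d t ?A) - entropy (mix_uniform ?N t S) \<le> pure_rate \<mu> (real (d * n)) - log 2 n"
    using eventually_at_right_real[of 0 "1 :: real"]
  proof (rule eventually_mono)
    fix t :: real assume "t \<in> {0<..<1}"
    then have t: "0 < t" "t < 1" by auto
    show "entropy (mix_uniform d t ?A) - entropy (mix_uniform ?N t S) \<le> pure_rate \<mu> (real (d * n)) - log 2 n"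
      using entropy_gain_pos_def[OF pos[OF t] dn \<mu> refl] unfolding S' unfolding A' .
  qed simp
  ultimately show ?thesis by (rule tendsto_upperbound) simp
qed

lemma mat_unit_carrier [simp]: "mat_unit n i j \<in> carrier_mat n n"
  by (simp add: mat_unit_def)

lemma index_mat_unit [simp]:
  "a < n \<Longrightarrow> b < n \<Longrightarrow> mat_unit n i j $$ (a, b) = (if a = i \<and> b = j then 1 else 0)"
  by (simp add: mat_unit_def)

lemma depolarizing_mat_unit:
  assumes "k < n" "l < n" "x < n" "y < n"
  shows "depolarizing n \<mu> (mat_unit n k l) $$ (x, y) =
    complex_of_real \<mu> * (if x = k \<and> y = l then 1 else 0) + complex_of_real ((1 - \<mu>) / n) * (if k = l \<and> x = y then 1 else 0)"
proof -
  have "mat_trace (mat_unit n k l) = (\<Sum>i<n. if i = k then (if k = l then 1 else 0) else 0)"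
    unfolding mat_trace_def by (auto simp: mat_unit_def intro!: sum.cong)
  also have "\<dots> = (if k = l then 1 else 0)" using assms by simp
  finally show ?thesis using assms by (auto simp: depolarizing_def mat_unit_def)
qed

lemma depolarizing_carrier [simp]: "A \<in> carrier_mat n n \<Longrightarrow> depolarizing n \<mu> A \<in> carrier_mat n n"
  by (simp add: depolarizing_def)

lemma map_tensor_carrier [simp]: "map_tensor n m n' m' F G X \<in> carrier_mat (m * m') (m * m')"
  by (simp add: map_tensor_def)

lemma id_tensor_depolarizing:
  assumes X: "X \<in> carrier_mat (d * n) (d * n)"
  shows "map_tensor d d n n (\<lambda>X. X) (depolarizing n \<mu>) X = complex_of_real \<mu> \<cdot>\<^sub>m X +
      complex_of_real (1 - \<mu>) \<cdot>\<^sub>m (complex_of_real (1 / n) \<cdot>\<^sub>m kron (ptrace_snd d n X) (1\<^sub>m n))"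
proof (rule eq_mat_pairI[of _ d n d n])
  have cK: "kron (ptrace_snd d n X) (1\<^sub>m n) \<in> carrier_mat (d * n) (d * n)" by (intro kron_carrier) auto
  fix a x b y assume ix: "a < d" "x < n" "b < d" "y < n"
  have "map_tensor d d n n (\<lambda>X. X) (depolarizing n \<mu>) X $$ (a * n + x, b * n + y) =
    (\<Sum>i<d. \<Sum>j<d. \<Sum>k<n. \<Sum>l<n. X $$ (i * n + k, j * n + l) *
      kron (mat_unit d i j) (depolarizing n \<mu> (mat_unit n k l)) $$ (a * n + x, b * n + y))"
    using ix pair_index_less by (simp add: map_tensor_def)
  also have "\<dots> = (\<Sum>i<d. \<Sum>j<d. if j = b then (if i = a then (\<Sum>k<n. \<Sum>l<n. X $$ (i * n + k, j * n + l) *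
      (complex_of_real \<mu> * (if x = k \<and> y = l then 1 else 0) + complex_of_real ((1 - \<mu>) / n) * (if k = l \<and> x = y then 1 else 0))) else 0) else 0)"
  proof (intro sum.cong refl)
    fix i j assume ij: "i \<in> {..<d}" "j \<in> {..<d}"
    have "kron (mat_unit d i j) (depolarizing n \<mu> (mat_unit n k l)) $$ (a * n + x, b * n + y) =
      (if i = a \<and> j = b then complex_of_real \<mu> * (if x = k \<and> y = l then 1 else 0) + complex_of_real ((1 - \<mu>) / n) * (if k = l \<and> x = y then 1 else 0) else 0)"
      if "k < n" "l < n" for k l
      using ix that by (subst index_kron[of _ d d _ n n]) (auto simp: depolarizing_mat_unit)
    then show "(\<Sum>k<n. \<Sum>l<n. X $$ (i * n + k, j * n + l) *
        kron (mat_unit d i j) (depolarizing n \<mu> (mat_unit n k l)) $$ (a * n + x, b * n + y)) =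
      (if j = b then (if i = a then (\<Sum>k<n. \<Sum>l<n. X $$ (i * n + k, j * n + l) *
      (complex_of_real \<mu> * (if x = k \<and> y = l then 1 else 0) + complex_of_real ((1 - \<mu>) / n) * (if k = l \<and> x = y then 1 else 0))) else 0) else 0)"
      by simp
  qed
  also have "\<dots> = (\<Sum>k<n. \<Sum>l<n. X $$ (a * n + k, b * n + l) *
      (complex_of_real \<mu> * (if x = k \<and> y = l then 1 else 0) + complex_of_real ((1 - \<mu>) / n) * (if k = l \<and> x = y then 1 else 0)))"
    using ix by simp
  also have "\<dots> = (\<Sum>k<n. \<Sum>l<n. if l = y then (if k = x then complex_of_real \<mu> * X $$ (a * n + k, b * n + l) else 0) else 0) +
      (\<Sum>k<n. \<Sum>l<n. if l = k then (if x = y then complex_of_real ((1 - \<mu>) / n) * X $$ (a * n + k, b * n + l) else 0) else 0)"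
    unfolding sum.distrib[symmetric] by (intro sum.cong refl) (auto simp: algebra_simps)
  also have "\<dots> = complex_of_real \<mu> * X $$ (a * n + x, b * n + y) +
      (if x = y then complex_of_real ((1 - \<mu>) / n) * ptrace_snd d n X $$ (a, b) else 0)"
    using ix by (simp add: ptrace_snd_def sum_distrib_left)
  also have "\<dots> = (complex_of_real \<mu> \<cdot>\<^sub>m X +
      complex_of_real (1 - \<mu>) \<cdot>\<^sub>m (complex_of_real (1 / n) \<cdot>\<^sub>m kron (ptrace_snd d n X) (1\<^sub>m n))) $$ (a * n + x, b * n + y)"
    using ix X cK pair_index_less[of a d x n] pair_index_less[of b d y n]
      index_kron[OF ptrace_snd_carrier one_carrier_mat ix, of n X] by simp
  finally show "map_tensor d d n n (\<lambda>X. X) (depolarizing n \<mu>) X $$ (a * n + x, b * n + y) = \<dots>" .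
qed (use X in \<open>auto intro!: kron_carrier\<close>)

text \<open>The average output has entropy at most \<open>log n\<close>, which cancels the \<open>- log n\<close> in the bound for every single
  input.\<close>

theorem C_prod_depolarizing_le:
  assumes dn: "0 < d" "0 < n" and \<mu>: "0 \<le> \<mu>" "\<mu> < 1"
  shows "C_prod n n d (depolarizing n \<mu>) \<le> ereal (pure_rate \<mu> (real (d * n)))"
  unfolding C_prod_def
proof (rule Sup_least, safe)
  fix K :: nat and p \<rho>
  assume p: "\<forall>i\<in>{1..K}. 0 \<le> p i" "(\<Sum>i = 1..K. p i) = (1 :: real)" and \<rho>: "\<forall>i\<in>{1..K}. state (d * n) (\<rho> i)"
  have "state n (mixture n K p (\<lambda>i. depolarizing n \<mu> (ptrace_fst d n (\<rho> i))))"
    using p \<rho> dn \<mu> by (intro state_mixture state_depolarizing state_ptrace_fst) auto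
  from entropy_le_log_dim[OF this]
  have 1: "entropy (mixture n K p (\<lambda>i. depolarizing n \<mu> (ptrace_fst d n (\<rho> i)))) \<le> log 2 n" .
  have "(\<Sum>i = 1..K. p i * (entropy (ptrace_snd d n (\<rho> i)) - entropy (map_tensor d d n n (\<lambda>X. X) (depolarizing n \<mu>) (\<rho> i))))
      \<le> (\<Sum>i = 1..K. p i * (pure_rate \<mu> (real (d * n)) - log 2 n))"
  proof (intro sum_mono mult_left_mono)
    fix i assume i: "i \<in> {1..K}"
    then have s: "state (d * n) (\<rho> i)" using \<rho> by blast
    show "entropy (ptrace_snd d n (\<rho> i)) - entropy (map_tensor d d n n (\<lambda>X. X) (depolarizing n \<mu>) (\<rho> i)) \<le> pure_rate \<mu> (real (d * n)) - log 2 n"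
      by (rule entropy_gain_le_pure_rate[OF s dn \<mu> id_tensor_depolarizing[OF stateD(3)[OF s]]])
    show "0 \<le> p i" using p i by blast
  qed
  also have "\<dots> = pure_rate \<mu> (real (d * n)) - log 2 n" using p(2) by (simp add: sum_distrib_right[symmetric])
  finally show "ereal (prod_rate n n d (depolarizing n \<mu>) K p \<rho>) \<le> ereal (pure_rate \<mu> (real (d * n)))"
    using 1 by (simp add: prod_rate_def)
qed

section \<open>Product inputs for two copies of the channel\<close>

text \<open>The tensor product \<^const>\<open>map_tensor\<close> sees a map only through its values at the matrix units. For maps
  that are determined by these values it behaves as expected on product matrices.\<close>

definition linear_on_units :: "nat \<Rightarrow> nat \<Rightarrow> (complex mat \<Rightarrow> complex mat) \<Rightarrow> bool" where
  "linear_on_units n m F \<longleftrightarrow> (\<forall>A \<in> carrier_mat n n. F A \<in> carrier_mat m m \<and>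
     (\<forall>r < m. \<forall>s < m. F A $$ (r, s) = (\<Sum>i<n. \<Sum>j<n. A $$ (i, j) * F (mat_unit n i j) $$ (r, s))))"

lemma linear_on_unitsD:
  assumes "linear_on_units n m F" "A \<in> carrier_mat n n"
  shows "F A \<in> carrier_mat m m"
    "r < m \<Longrightarrow> s < m \<Longrightarrow> (\<Sum>i<n. \<Sum>j<n. A $$ (i, j) * F (mat_unit n i j) $$ (r, s)) = F A $$ (r, s)"
proof -
  show "F A \<in> carrier_mat m m" using assms unfolding linear_on_units_def by blast
  assume "r < m" "s < m"
  then have "F A $$ (r, s) = (\<Sum>i<n. \<Sum>j<n. A $$ (i, j) * F (mat_unit n i j) $$ (r, s))"
    using assms unfolding linear_on_units_def by blast
  then show "(\<Sum>i<n. \<Sum>j<n. A $$ (i, j) * F (mat_unit n i j) $$ (r, s)) = F A $$ (r, s)" ..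
qed

lemma linear_depolarizing: "linear_on_units n n (depolarizing n \<mu>)"
  unfolding linear_on_units_def
proof (intro ballI conjI allI impI)
  fix A :: "complex mat" and r s assume A: "A \<in> carrier_mat n n" and rs: "r < n" "s < n"
  have "(\<Sum>i<n. \<Sum>j<n. A $$ (i, j) * depolarizing n \<mu> (mat_unit n i j) $$ (r, s)) =
      (\<Sum>i<n. \<Sum>j<n. if j = s then (if i = r then complex_of_real \<mu> * A $$ (i, j) else 0) else 0) +
      (\<Sum>i<n. \<Sum>j<n. if j = i then (if r = s then complex_of_real ((1 - \<mu>) / n) * A $$ (i, j) else 0) else 0)"
    unfolding sum.distrib[symmetric] using rs
    by (intro sum.cong refl) (auto simp: depolarizing_mat_unit algebra_simps)
  also have "\<dots> = depolarizing n \<mu> A $$ (r, s)"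
    using rs A by (simp add: depolarizing_def mat_trace_def sum_distrib_left)
  finally show "depolarizing n \<mu> A $$ (r, s) = (\<Sum>i<n. \<Sum>j<n. A $$ (i, j) * depolarizing n \<mu> (mat_unit n i j) $$ (r, s))" ..
qed simp

lemma map_tensor_kron:
  assumes F: "linear_on_units n m F" and G: "linear_on_units n' m' G"
    and A: "A \<in> carrier_mat n n" and B: "B \<in> carrier_mat n' n'"
  shows "map_tensor n m n' m' F G (kron A B) = kron (F A) (G B)"
proof (rule eq_mat_pairI[of _ m m' m m'])
  note FA = linear_on_unitsD[OF F A] and GB = linear_on_unitsD[OF G B]
  fix p q u v assume ix: "p < m" "q < m'" "u < m" "v < m'"
  have "map_tensor n m n' m' F G (kron A B) $$ (p * m' + q, u * m' + v) =
      (\<Sum>i<n. \<Sum>j<n. \<Sum>k<n'. \<Sum>l<n'. kron A B $$ (i * n' + k, j * n' + l) *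
        kron (F (mat_unit n i j)) (G (mat_unit n' k l)) $$ (p * m' + q, u * m' + v))"
    using pair_index_less[OF ix(1,2)] pair_index_less[OF ix(3,4)] by (simp add: map_tensor_def)
  also have "\<dots> = (\<Sum>i<n. \<Sum>j<n. \<Sum>k<n'. \<Sum>l<n'. (A $$ (i, j) * F (mat_unit n i j) $$ (p, u)) * (B $$ (k, l) * G (mat_unit n' k l) $$ (q, v)))"
  proof (intro sum.cong refl)
    fix i j k l assume "i \<in> {..<n}" "j \<in> {..<n}" "k \<in> {..<n'}" "l \<in> {..<n'}"
    then have "kron A B $$ (i * n' + k, j * n' + l) = A $$ (i, j) * B $$ (k, l)"
      by (intro index_kron[OF A B]) auto
    moreover have "kron (F (mat_unit n i j)) (G (mat_unit n' k l)) $$ (p * m' + q, u * m' + v)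
       = F (mat_unit n i j) $$ (p, u) * G (mat_unit n' k l) $$ (q, v)"
      by (intro index_kron[OF linear_on_unitsD(1)[OF F mat_unit_carrier] linear_on_unitsD(1)[OF G mat_unit_carrier]] ix)
    ultimately show "kron A B $$ (i * n' + k, j * n' + l) * kron (F (mat_unit n i j)) (G (mat_unit n' k l)) $$ (p * m' + q, u * m' + v)
      = (A $$ (i, j) * F (mat_unit n i j) $$ (p, u)) * (B $$ (k, l) * G (mat_unit n' k l) $$ (q, v))" by simp
  qed
  also have "\<dots> = F A $$ (p, u) * G B $$ (q, v)"
    by (simp only: sum_distrib_left[symmetric] sum_distrib_right[symmetric] FA(2)[OF ix(1,3)] GB(2)[OF ix(2,4)])
  also have "\<dots> = kron (F A) (G B) $$ (p * m' + q, u * m' + v)"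
    using ix by (intro index_kron[symmetric, OF FA(1) GB(1)])
  finally show "map_tensor n m n' m' F G (kron A B) $$ (p * m' + q, u * m' + v) = kron (F A) (G B) $$ (p * m' + q, u * m' + v)" .
qed (use linear_on_unitsD(1)[OF F A] linear_on_unitsD(1)[OF G B] in auto)

lemma mat_unit_pair:
  assumes "i < n" "j < n" "k < n'" "l < n'"
  shows "mat_unit (n * n') (i * n' + k) (j * n' + l) = kron (mat_unit n i j) (mat_unit n' k l)"
proof (rule eq_mat_pairI[of _ n n' n n'])
  fix p q u v assume ix: "p < n" "q < n'" "u < n" "v < n'"
  show "mat_unit (n * n') (i * n' + k) (j * n' + l) $$ (p * n' + q, u * n' + v)
      = kron (mat_unit n i j) (mat_unit n' k l) $$ (p * n' + q, u * n' + v)"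
    using pair_index_less[OF ix(1,2)] pair_index_less[OF ix(3,4)] ix assms
    by (subst index_kron[of _ n n _ n' n']) (auto simp: pair_index_eq_iff)
qed auto

text \<open>The tensor product of maps is associative. Grouping the reference system with the first copy of a channel
  is useful when the second input is uncorrelated with both.\<close>

lemma id_tensor_tensor_kron:
  assumes F: "linear_on_units n m F" and G: "linear_on_units n' m' G"
    and X: "X \<in> carrier_mat (d * n) (d * n)" and Y: "Y \<in> carrier_mat n' n'"
  shows "map_tensor d d (n * n') (m * m') (\<lambda>X. X) (map_tensor n m n' m' F G) (kron X Y)
    = kron (map_tensor d d n m (\<lambda>X. X) F X) (G Y)"
proof (rule eq_mat_pairI[of _ "d * m" m' "d * m" m'])
  note GY = linear_on_unitsD[OF G Y]
  show "map_tensor d d (n * n') (m * m') (\<lambda>X. X) (map_tensor n m n' m' F G) (kron X Y) \<in> carrier_mat (d * m * m') (d * m * m')"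
    by (simp add: mult.assoc map_tensor_def)
  show "kron (map_tensor d d n m (\<lambda>X. X) F X) (G Y) \<in> carrier_mat (d * m * m') (d * m * m')"
    using GY by (intro kron_carrier) auto
  fix R q S v assume ix: "R < d * m" "q < m'" "S < d * m" "v < m'"
  define a p b u where "a = R div m" and "p = R mod m" and "b = S div m" and "u = S mod m"
  have "m \<noteq> 0" using ix by (metis mult_0_right not_less_zero)
  then have abpu: "a < d" "p < m" "b < d" "u < m" and RS: "R = a * m + p" "S = b * m + u"
    using ix by (auto simp: a_def b_def p_def u_def less_mult_imp_div_less)
  have rs: "R * m' + q = a * (m * m') + (p * m' + q)" "S * m' + v = b * (m * m') + (u * m' + v)"
    by (simp_all add: RS algebra_simps)
  have pq: "p * m' + q < m * m'" "u * m' + v < m * m'" using abpu ix pair_index_less by auto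
  have less: "R * m' + q < d * (m * m')" "S * m' + v < d * (m * m')"
    using pair_index_less[OF ix(1,2)] pair_index_less[OF ix(3,4)] by (simp_all add: mult.assoc)
  let ?FG = "map_tensor n m n' m' F G"
  have FG: "?FG (mat_unit (n * n') (k * n' + k') (l * n' + l')) $$ (p * m' + q, u * m' + v)
      = F (mat_unit n k l) $$ (p, u) * G (mat_unit n' k' l') $$ (q, v)"
    if "k < n" "l < n" "k' < n'" "l' < n'" for k l k' l'
    unfolding mat_unit_pair[OF that] map_tensor_kron[OF F G mat_unit_carrier mat_unit_carrier]
    by (intro index_kron[OF linear_on_unitsD(1)[OF F mat_unit_carrier] linear_on_unitsD(1)[OF G mat_unit_carrier]] abpu ix)
  have XY: "kron X Y $$ (i * (n * n') + (k * n' + k'), j * (n * n') + (l * n' + l')) = X $$ (i * n + k, j * n + l) * Y $$ (k', l')"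
    if "i < d" "j < d" "k < n" "l < n" "k' < n'" "l' < n'" for i j k l k' l'
    using index_kron[OF X Y pair_index_less[OF that(1,3)] that(5) pair_index_less[OF that(2,4)] that(6)]
    by (simp add: algebra_simps)
  have unit_kron: "kron (mat_unit d i j) Z $$ (a * (m * m') + (p * m' + q), b * (m * m') + (u * m' + v))
     = (if j = b then (if i = a then Z $$ (p * m' + q, u * m' + v) else 0) else 0)"
    if "Z \<in> carrier_mat (m * m') (m * m')" for Z i j
    using that abpu pq by (subst index_kron[of _ d d _ "m * m'" "m * m'"]) auto
  have "map_tensor d d (n * n') (m * m') (\<lambda>X. X) ?FG (kron X Y) $$ (R * m' + q, S * m' + v) =
    (\<Sum>i<d. \<Sum>j<d. \<Sum>K<n * n'. \<Sum>L<n * n'. kron X Y $$ (i * (n * n') + K, j * (n * n') + L) *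
       kron (mat_unit d i j) (?FG (mat_unit (n * n') K L)) $$ (R * m' + q, S * m' + v))"
    unfolding map_tensor_def[of d d "n * n'" "m * m'"] using less by simp
  also have "\<dots> = (\<Sum>i<d. \<Sum>j<d. if j = b then (if i = a then (\<Sum>K<n * n'. \<Sum>L<n * n'. kron X Y $$ (i * (n * n') + K, j * (n * n') + L) *
       ?FG (mat_unit (n * n') K L) $$ (p * m' + q, u * m' + v)) else 0) else 0)"
    unfolding rs by (intro sum.cong refl) (simp add: unit_kron)
  also have "\<dots> = (\<Sum>K<n * n'. \<Sum>L<n * n'. kron X Y $$ (a * (n * n') + K, b * (n * n') + L) *
       ?FG (mat_unit (n * n') K L) $$ (p * m' + q, u * m' + v))"
    using abpu by simp
  also have "\<dots> = (\<Sum>k<n. \<Sum>k'<n'. \<Sum>l<n. \<Sum>l'<n'. (X $$ (a * n + k, b * n + l) * F (mat_unit n k l) $$ (p, u)) *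
      (Y $$ (k', l') * G (mat_unit n' k' l') $$ (q, v)))"
    unfolding sum_lessThan_mult by (intro sum.cong refl) (use abpu in \<open>simp add: FG XY\<close>)
  also have "\<dots> = (\<Sum>k<n. \<Sum>l<n. \<Sum>k'<n'. \<Sum>l'<n'. (X $$ (a * n + k, b * n + l) * F (mat_unit n k l) $$ (p, u)) *
      (Y $$ (k', l') * G (mat_unit n' k' l') $$ (q, v)))"
    by (rule sum.cong[OF refl], rule sum.swap)
  also have "\<dots> = (\<Sum>k<n. \<Sum>l<n. X $$ (a * n + k, b * n + l) * F (mat_unit n k l) $$ (p, u)) * G Y $$ (q, v)"
    by (simp only: sum_distrib_left[symmetric] sum_distrib_right[symmetric] GY(2)[OF ix(2,4)])
  also have "(\<Sum>k<n. \<Sum>l<n. X $$ (a * n + k, b * n + l) * F (mat_unit n k l) $$ (p, u)) = map_tensor d d n m (\<lambda>X. X) F X $$ (R, S)"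
  proof -
    have "map_tensor d d n m (\<lambda>X. X) F X $$ (R, S) = (\<Sum>i<d. \<Sum>j<d. \<Sum>k<n. \<Sum>l<n. X $$ (i * n + k, j * n + l) *
        kron (mat_unit d i j) (F (mat_unit n k l)) $$ (R, S))"
      using ix by (simp add: map_tensor_def)
    also have "\<dots> = (\<Sum>i<d. \<Sum>j<d. if j = b then (if i = a then (\<Sum>k<n. \<Sum>l<n. X $$ (i * n + k, j * n + l) *
        F (mat_unit n k l) $$ (p, u)) else 0) else 0)"
    proof (intro sum.cong refl)
      fix i j
      have "kron (mat_unit d i j) (F (mat_unit n k l)) $$ (R, S) = (if j = b then (if i = a then F (mat_unit n k l) $$ (p, u) else 0) else 0)" for k l
        unfolding RS using abpu linear_on_unitsD(1)[OF F mat_unit_carrier]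
        by (subst index_kron[of _ d d _ m m]) auto
      then show "(\<Sum>k<n. \<Sum>l<n. X $$ (i * n + k, j * n + l) * kron (mat_unit d i j) (F (mat_unit n k l)) $$ (R, S))
        = (if j = b then (if i = a then (\<Sum>k<n. \<Sum>l<n. X $$ (i * n + k, j * n + l) * F (mat_unit n k l) $$ (p, u)) else 0) else 0)"
        by simp
    qed
    finally show ?thesis using abpu by simp
  qed
  also have "map_tensor d d n m (\<lambda>X. X) F X $$ (R, S) * G Y $$ (q, v) = kron (map_tensor d d n m (\<lambda>X. X) F X) (G Y) $$ (R * m' + q, S * m' + v)"
    using ix GY by (intro index_kron[symmetric, OF map_tensor_carrier]) auto
  finally show "map_tensor d d (n * n') (m * m') (\<lambda>X. X) ?FG (kron X Y) $$ (R * m' + q, S * m' + v)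
    = kron (map_tensor d d n m (\<lambda>X. X) F X) (G Y) $$ (R * m' + q, S * m' + v)" .
qed

definition max_entangled :: "nat \<Rightarrow> complex mat" where
  "max_entangled n = mat (n * n) (n * n)
     (\<lambda>(r, s). if r div n = r mod n \<and> s div n = s mod n then complex_of_real (1 / n) else 0)"

lemma max_entangled_carrier [simp]: "max_entangled n \<in> carrier_mat (n * n) (n * n)"
  by (simp add: max_entangled_def)

lemma index_max_entangled:
  "i < n \<Longrightarrow> k < n \<Longrightarrow> j < n \<Longrightarrow> l < n \<Longrightarrow>
    max_entangled n $$ (i * n + k, j * n + l) = (if i = k \<and> j = l then complex_of_real (1 / n) else 0)"
  using pair_index_less[of i n k n] pair_index_less[of j n l n] by (simp add: max_entangled_def)

lemma max_entangled_pure: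
  assumes n: "0 < n"
  shows "max_entangled n * max_entangled n = max_entangled n" "state (n * n) (max_entangled n)"
proof -
  let ?P = "max_entangled n"
  show PP: "?P * ?P = ?P"
  proof (rule eq_mat_pairI[of _ n n n n])
    fix i k j l assume ix: "i < n" "k < n" "j < n" "l < n"
    have "(?P * ?P) $$ (i * n + k, j * n + l) = (\<Sum>r<n * n. ?P $$ (i * n + k, r) * ?P $$ (r, j * n + l))"
      using pair_index_less[OF ix(1,2)] pair_index_less[OF ix(3,4)] carrier_matD[OF max_entangled_carrier[of n]]
      by (simp add: scalar_prod_def lessThan_atLeast0)
    also have "\<dots> = (\<Sum>a<n. \<Sum>b<n. if b = a then (if i = k \<and> j = l then complex_of_real (1 / n) * complex_of_real (1 / n) else 0) else 0)"
      unfolding sum_lessThan_mult using ix by (intro sum.cong refl) (auto simp: index_max_entangled)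
    also have "\<dots> = ?P $$ (i * n + k, j * n + l)"
      using n ix by (simp add: index_max_entangled)
    finally show "(?P * ?P) $$ (i * n + k, j * n + l) = ?P $$ (i * n + k, j * n + l)" .
  qed (auto intro!: mult_carrier_mat[of _ _ "n * n"])
  have h: "mat_adjoint ?P = ?P"
    by (rule eq_matI) (auto simp: max_entangled_def)
  have "positive_semidefinite (n * n) (mat_adjoint ?P * 1\<^sub>m (n * n) * ?P)"
    by (intro psd_sandwich psd_one) simp
  then have "positive_semidefinite (n * n) ?P"
    using PP by (simp add: h right_mult_one_mat[of _ "n * n" "n * n"])
  moreover have "mat_trace ?P = (\<Sum>a<n. \<Sum>b<n. if b = a then complex_of_real (1 / n) else 0)"
    unfolding mat_trace_def carrier_matD[OF max_entangled_carrier] sum_lessThan_mult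
    by (intro sum.cong refl) (auto simp: index_max_entangled)
  ultimately show "state (n * n) ?P" using n by (simp add: state_def)
qed

lemma entropy_depolarizing_pure:
  assumes P: "state N P" "P * P = P" and N: "0 < N" and \<mu>: "0 \<le> \<mu>" "\<mu> < 1"
  shows "entropy (depolarizing N \<mu> P) = log 2 N - pure_rate \<mu> N"
proof -
  note cP = stateD(3)[OF P(1)]
  define b where "b = (1 - \<mu>) / N"
  define a where "a = \<mu> + b"
  have A: "depolarizing N \<mu> P = complex_of_real \<mu> \<cdot>\<^sub>m P + complex_of_real b \<cdot>\<^sub>m 1\<^sub>m N"
    using cP stateD(5)[OF P(1)] by (auto simp: depolarizing_def b_def intro!: eq_matI)
  have h: "hermitian N (depolarizing N \<mu> P)"
    unfolding A using stateD(2)[OF P(1)] by (intro hermitian_add hermitian_smult) auto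
  have "depolarizing N \<mu> P * P = complex_of_real \<mu> \<cdot>\<^sub>m (P * P) + complex_of_real b \<cdot>\<^sub>m P"
    unfolding A using cP
    by (simp add: add_mult_distrib_mat[of _ N N _ _ N] mult_smult_assoc_mat[of _ N N _ N] left_mult_one_mat[of _ N N])
  also have "\<dots> = complex_of_real a \<cdot>\<^sub>m P"
    unfolding P(2) a_def using cP by (auto simp: algebra_simps intro!: eq_matI)
  finally have 1: "depolarizing N \<mu> P * P = complex_of_real a \<cdot>\<^sub>m P" .
  have "depolarizing N \<mu> P * (1\<^sub>m N - P) = depolarizing N \<mu> P - depolarizing N \<mu> P * P"
    using hermitianD(1)[OF h] cP
    by (simp add: mult_minus_distrib_mat[of _ N N _ N] right_mult_one_mat[of _ N N])
  also have "\<dots> = complex_of_real b \<cdot>\<^sub>m (1\<^sub>m N - P)"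
    unfolding 1 unfolding A a_def using cP by (auto simp: algebra_simps intro!: eq_matI)
  finally have 2: "depolarizing N \<mu> P * (1\<^sub>m N - P) = complex_of_real b \<cdot>\<^sub>m (1\<^sub>m N - P)" .
  have b0: "0 < b" "0 < a" using N \<mu> by (auto simp: b_def a_def add_nonneg_pos)
  have ab: "a = (1 - \<mu> + \<mu> * N) / N" using N by (simp add: a_def b_def field_simps)
  have pos: "0 < 1 - \<mu> + \<mu> * N" using N \<mu> by (simp add: add_pos_nonneg)
  have la: "log 2 a = log 2 (1 - \<mu> + \<mu> * N) - log 2 N" unfolding ab using pos N by (simp add: log_divide)
  have lb: "log 2 b = log 2 (1 - \<mu>) - log 2 N" unfolding b_def using \<mu> N by (simp add: log_divide)
  have "entropy (depolarizing N \<mu> P) = - (a * log 2 a + b * log 2 b * (real N - 1))"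
    using entropy_two_valued[OF h cP 1 2] stateD(4)[OF P(1)] by simp
  also have "\<dots> = log 2 N - pure_rate \<mu> N"
    unfolding la lb unfolding pure_rate_def ab b_def using N by (simp add: field_simps)
  finally show ?thesis .
qed

lemma entropy_uniform:
  assumes "0 < n"
  shows "entropy (complex_of_real (1 / n) \<cdot>\<^sub>m 1\<^sub>m n) = log 2 n"
proof -
  have "complex_of_real (1 / n) \<cdot>\<^sub>m 1\<^sub>m n = mat_diag n (\<lambda>_. complex_of_real (1 / n))"
    by (rule eq_matI) (auto simp: mat_diag_def)
  then show ?thesis using assms by (simp only: entropy_mat_diag) (simp add: log_divide)
qed

lemma state_mat_unit: "i < n \<Longrightarrow> state n (mat_unit n i i)" "i < n \<Longrightarrow> mat_unit n i i * mat_unit n i i = mat_unit n i i"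
proof -
  assume i: "i < n"
  have d: "mat_unit n i i = mat_diag n (\<lambda>k. complex_of_real (if k = i then 1 else 0))"
    by (rule eq_matI) (auto simp: mat_unit_def mat_diag_def)
  show "mat_unit n i i * mat_unit n i i = mat_unit n i i"
    unfolding d by (simp add: if_distrib cong: if_cong)
  have "rtr (mat_unit n i i) = 1" unfolding d using i by (simp add: rtr_def mat_trace_def mat_diag_def)
  then show "state n (mat_unit n i i)"
    unfolding state_iff_rtr using psd_mat_diag[of n "\<lambda>k. if k = i then 1 else 0"] d by simp
qed

text \<open>The inputs share a maximally entangled state between the reference system and the first copy, and put a
  uniformly chosen basis state into the second copy. The average output is the uniform state, and every
  output is a tensor product of two depolarized pure states, of dimensions \<open>n\<^sup>2\<close> and \<open>n\<close>.\<close>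

theorem C_prod_two_depolarizing_ge:
  assumes n: "0 < n" and \<mu>: "0 \<le> \<mu>" "\<mu> < 1"
  shows "ereal (pure_rate \<mu> (real (n * n)) + pure_rate \<mu> (real n))
    \<le> C_prod (n * n) (n * n) n (map_tensor n n n n (depolarizing n \<mu>) (depolarizing n \<mu>))"
proof -
  let ?D = "depolarizing n \<mu>"
  let ?DD = "map_tensor n n n n ?D ?D"
  let ?P = "max_entangled n"
  let ?u = "complex_of_real (1 / n) \<cdot>\<^sub>m 1\<^sub>m n"
  \<comment> \<open>Ensembles are numbered from \<open>1\<close>, matrix units from \<open>0\<close>.\<close>
  define E where "E i = mat_unit n (i - 1) (i - 1)" for i
  define \<rho> where "\<rho> i = kron ?P (E i)" for i
  define p where "p i = 1 / real n" for i :: nat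
  have cE: "E i \<in> carrier_mat n n" for i by (simp add: E_def)
  have E: "state n (E i)" "E i * E i = E i" if "i \<in> {1..n}" for i
    using that state_mat_unit[of "i - 1" n] by (auto simp: E_def)
  note P = max_entangled_pure[OF n]
  have \<rho>: "state (n * (n * n)) (\<rho> i)" if "i \<in> {1..n}" for i
    using state_kron[OF P(2) E(1)[OF that]] by (simp add: \<rho>_def mult.assoc)
  have \<rho>e: "\<rho> i $$ (a * (n * n) + (k * n + k'), b * (n * n) + (l * n + l'))
      = (if a = k \<and> b = l then complex_of_real (1 / n) * E i $$ (k', l') else 0)"
    if "a < n" "b < n" "k < n" "l < n" "k' < n" "l' < n" for i a b k l k' l'
  proof -
    have e: "a * (n * n) + (k * n + k') = (a * n + k) * n + k'" "b * (n * n) + (l * n + l') = (b * n + l) * n + l'"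
      by (simp_all add: algebra_simps)
    show ?thesis
      unfolding e \<rho>_def index_kron[OF max_entangled_carrier cE pair_index_less[OF that(1,3)] that(5) pair_index_less[OF that(2,4)] that(6)]
        index_max_entangled[OF that(1,3,2,4)] by simp
  qed
  have fst: "ptrace_fst n (n * n) (\<rho> i) = kron ?u (E i)" for i
  proof (rule eq_mat_pairI[of _ n n n n])
    fix k k' l l' assume ix: "k < n" "k' < n" "l < n" "l' < n"
    have "ptrace_fst n (n * n) (\<rho> i) $$ (k * n + k', l * n + l') =
        (\<Sum>a<n. if a = k then (if k = l then complex_of_real (1 / n) * E i $$ (k', l') else 0) else 0)"
      using pair_index_less[OF ix(1,2)] pair_index_less[OF ix(3,4)] ix
      by (auto simp: ptrace_fst_def \<rho>e intro!: sum.cong)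
    also have "\<dots> = ?u $$ (k, l) * E i $$ (k', l')" using ix by simp
    also have "\<dots> = kron ?u (E i) $$ (k * n + k', l * n + l')"
      using ix cE by (intro index_kron[symmetric, of _ n n _ n n]) auto
    finally show "ptrace_fst n (n * n) (\<rho> i) $$ (k * n + k', l * n + l') = kron ?u (E i) $$ (k * n + k', l * n + l')" .
  qed (use cE in \<open>auto intro!: kron_carrier\<close>)
  have snd: "ptrace_snd n (n * n) (\<rho> i) = ?u" if i: "i \<in> {1..n}" for i
  proof (rule eq_matI)
    fix a b assume "a < dim_row ?u" "b < dim_col ?u"
    then have ab: "a < n" "b < n" by auto
    have "ptrace_snd n (n * n) (\<rho> i) $$ (a, b) = (\<Sum>k<n. \<Sum>k'<n. \<rho> i $$ (a * (n * n) + (k * n + k'), b * (n * n) + (k * n + k')))"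
      using ab by (simp add: ptrace_snd_def sum_lessThan_mult)
    also have "\<dots> = (\<Sum>k<n. \<Sum>k'<n. if k = a then (if a = b then complex_of_real (1 / n) * E i $$ (k', k') else 0) else 0)"
      using ab by (intro sum.cong refl) (auto simp: \<rho>e)
    also have "\<dots> = (\<Sum>k<n. if k = a then (if a = b then complex_of_real (1 / n) * mat_trace (E i) else 0) else 0)"
      using cE[of i] by (intro sum.cong refl) (auto simp: mat_trace_def sum_distrib_left)
    also have "\<dots> = ?u $$ (a, b)" using ab stateD(5)[OF E(1)[OF i]] by simp
    finally show "ptrace_snd n (n * n) (\<rho> i) $$ (a, b) = ?u $$ (a, b)" .
  qed auto
  have Du: "?D ?u = ?u"
    unfolding depolarizing_state[OF state_uniform[OF n]]
    by (auto simp: algebra_simps diff_divide_distrib intro!: eq_matI)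
  have out: "map_tensor n n (n * n) (n * n) (\<lambda>X. X) ?DD (\<rho> i) = kron (depolarizing (n * n) \<mu> ?P) (?D (E i))" for i
  proof -
    have "ptrace_snd n n ?P = ?u"
    proof (rule eq_matI)
      fix a b assume "a < dim_row ?u" "b < dim_col ?u"
      then have ab: "a < n" "b < n" by auto
      have "ptrace_snd n n ?P $$ (a, b) = (\<Sum>k<n. if k = a then (if a = b then complex_of_real (1 / n) else 0) else 0)"
        using ab by (auto simp: ptrace_snd_def index_max_entangled intro!: sum.cong)
      then show "ptrace_snd n n ?P $$ (a, b) = ?u $$ (a, b)" using ab by simp
    qed auto
    moreover have "complex_of_real (1 / n) \<cdot>\<^sub>m kron ?u (1\<^sub>m n) = complex_of_real (1 / real (n * n)) \<cdot>\<^sub>m 1\<^sub>m (n * n)"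
      unfolding kron_one[symmetric] using n by (intro eq_matI) (auto simp: kron_def less_mult_imp_div_less)
    ultimately have "map_tensor n n n n (\<lambda>X. X) ?D ?P = depolarizing (n * n) \<mu> ?P"
      unfolding depolarizing_state[OF P(2)] id_tensor_depolarizing[OF max_entangled_carrier] by simp
    then show ?thesis
      unfolding \<rho>_def by (simp add: id_tensor_tensor_kron[OF linear_depolarizing linear_depolarizing max_entangled_carrier cE])
  qed
  have entropy_out: "entropy (map_tensor n n (n * n) (n * n) (\<lambda>X. X) ?DD (\<rho> i))
      = (log 2 (real (n * n)) - pure_rate \<mu> (real (n * n))) + (log 2 n - pure_rate \<mu> n)" if i: "i \<in> {1..n}" for i
    unfolding out using n \<mu> E[OF i] P
    by (simp add: entropy_kron[of "n * n" _ n] state_depolarizing entropy_depolarizing_pure del: of_nat_mult)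
  have "mixture (n * n) n p (\<lambda>i. ?DD (ptrace_fst n (n * n) (\<rho> i))) = complex_of_real (1 / real (n * n)) \<cdot>\<^sub>m 1\<^sub>m (n * n)"
  proof (rule eq_mat_pairI[of _ n n n n])
    have DD: "?DD (ptrace_fst n (n * n) (\<rho> i)) = kron ?u (?D (E i))" for i
      unfolding fst using map_tensor_kron[OF linear_depolarizing linear_depolarizing _ cE, of ?u n \<mu> \<mu>] Du by simp
    fix k k' l l' assume ix: "k < n" "k' < n" "l < n" "l' < n"
    have "mixture (n * n) n p (\<lambda>i. ?DD (ptrace_fst n (n * n) (\<rho> i))) $$ (k * n + k', l * n + l')
       = (\<Sum>i = 1..n. complex_of_real (1 / n) * kron ?u (?D (E i)) $$ (k * n + k', l * n + l'))"
      unfolding DD using pair_index_less[OF ix(1,2)] pair_index_less[OF ix(3,4)] by (simp add: mixture_def p_def)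
    also have "\<dots> = (\<Sum>i = 1..n. complex_of_real (1 / n) * (?u $$ (k, l) * ?D (E i) $$ (k', l')))"
      using ix cE by (intro sum.cong refl arg_cong2[where f = "(*)"] index_kron[of _ n n _ n n]) auto
    also have "\<dots> = (\<Sum>i<n. complex_of_real (1 / n) * (?u $$ (k, l) * ?D (mat_unit n i i) $$ (k', l')))"
      unfolding E_def by (rule sum.reindex_bij_witness[of _ Suc "\<lambda>i. i - 1"]) auto
    also have "\<dots> = complex_of_real (1 / n) * ?u $$ (k, l) * (\<Sum>i<n. ?D (mat_unit n i i) $$ (k', l'))"
      by (simp add: sum_distrib_left mult.assoc)
    also have "(\<Sum>i<n. ?D (mat_unit n i i) $$ (k', l')) =
        (\<Sum>i<n. (if i = k' then (if k' = l' then complex_of_real \<mu> else 0) else 0) + (if k' = l' then complex_of_real ((1 - \<mu>) / n) else 0))"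
      using ix by (intro sum.cong refl) (auto simp: depolarizing_mat_unit)
    also have "\<dots> = (if k' = l' then 1 else 0)" using ix n by (simp add: sum.distrib)
    also have "complex_of_real (1 / n) * ?u $$ (k, l) * (if k' = l' then 1 else 0) =
        complex_of_real (1 / real (n * n)) * (if k = l \<and> k' = l' then 1 else 0)"
      using ix by simp
    also have "\<dots> = (complex_of_real (1 / real (n * n)) \<cdot>\<^sub>m 1\<^sub>m (n * n)) $$ (k * n + k', l * n + l')"
    proof -
      have "k * n + k' = l * n + l' \<longleftrightarrow> k = l \<and> k' = l'"
        using ix by (intro pair_index_eq_iff)
      then show ?thesis using pair_index_less[OF ix(1,2)] pair_index_less[OF ix(3,4)] by simp
    qed
    finally show "mixture (n * n) n p (\<lambda>i. ?DD (ptrace_fst n (n * n) (\<rho> i))) $$ (k * n + k', l * n + l') =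
      (complex_of_real (1 / real (n * n)) \<cdot>\<^sub>m 1\<^sub>m (n * n)) $$ (k * n + k', l * n + l')" .
  qed (auto simp: mixture_def)
  then have "entropy (mixture (n * n) n p (\<lambda>i. ?DD (ptrace_fst n (n * n) (\<rho> i)))) = log 2 (real (n * n))"
    using entropy_uniform[of "n * n"] n by simp
  moreover have "(\<Sum>i = 1..n. p i * (entropy (ptrace_snd n (n * n) (\<rho> i)) -
      entropy (map_tensor n n (n * n) (n * n) (\<lambda>X. X) ?DD (\<rho> i))))
    = (\<Sum>i = 1..n. p i * (log 2 n - ((log 2 (real (n * n)) - pure_rate \<mu> (real (n * n))) + (log 2 n - pure_rate \<mu> n))))"
    by (intro sum.cong refl) (simp only: snd entropy_out entropy_uniform[OF n])
  moreover have "\<dots> = pure_rate \<mu> (real (n * n)) + pure_rate \<mu> n - log 2 (real (n * n))"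
    using n by (simp add: p_def)
  ultimately have "prod_rate (n * n) (n * n) n ?DD n p \<rho> = pure_rate \<mu> (real (n * n)) + pure_rate \<mu> n"
    by (simp add: prod_rate_def)
  moreover have "\<forall>i\<in>{1..n}. 0 \<le> p i" "(\<Sum>i = 1..n. p i) = 1" using n by (auto simp: p_def)
  ultimately show ?thesis
    unfolding C_prod_def using \<rho> by (intro Sup_upper) (auto intro!: exI[of _ n] exI[of _ p] exI[of _ \<rho>])
qed

section \<open>Strict gap\<close>

text \<open>Up to a constant factor and terms independent of \<open>M\<close>, the rate is \<open>\<mu>\<close> times the integral of \<open>ln (1 - \<mu> + \<mu> M t)\<close> over
  \<open>t\<close> in \<open>[0, 1]\<close>, and \<open>u \<mapsto> ln (\<alpha> + \<beta> e\<^sup>u)\<close> is strictly convex. So the rate is strictly convex as a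
  function of \<open>log M\<close>. For a geometric progression this reduces to a comparison of products of linear
  functions of \<open>t\<close>.\<close>

lemma pure_rate_log_convex:
  assumes \<mu>: "0 < \<mu>" "\<mu> < 1" and M: "0 < M" and q: "0 < q" "q \<noteq> 1"
  shows "2 * pure_rate \<mu> (M * q) < pure_rate \<mu> M + pure_rate \<mu> (M * q\<^sup>2)"
proof -
  define \<phi> where "\<phi> x = x * ln x" for x :: real
  define z where "z w t = 1 - \<mu> + \<mu> * w * t" for w t :: real
  define K where "K t = \<phi> (z M t) / M + \<phi> (z (M * q\<^sup>2) t) / (M * q\<^sup>2) - 2 * (\<phi> (z (M * q) t) / (M * q))" for t
  have zpos: "0 < z w t" if "0 < w" "0 \<le> t" for w t using that \<mu> by (simp add: z_def add_pos_nonneg)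
  have \<phi>': "((\<lambda>t. \<phi> (z w t) / w) has_real_derivative \<mu> * (ln (z w t) + 1)) (at t)" if "0 < w" "0 \<le> t" for w t
  proof -
    have "(\<phi> has_real_derivative ln (z w t) + 1) (at (z w t))"
      unfolding \<phi>_def using zpos[OF that] by (auto intro!: derivative_eq_intros)
    moreover have "(z w has_real_derivative \<mu> * w) (at t)"
      unfolding z_def by (auto intro!: derivative_eq_intros)
    ultimately have "((\<lambda>t. \<phi> (z w t)) has_real_derivative (ln (z w t) + 1) * (\<mu> * w)) (at t)"
      by (rule DERIV_chain2)
    from DERIV_cdivide[OF this, of w] show ?thesis using that by (simp add: mult_ac)
  qed
  have pr: "pure_rate \<mu> w = (\<phi> (z w 1) / w - \<phi> (z w 0) / w + \<phi> (1 - \<mu>)) / ln 2" if "0 < w" for w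
    unfolding pure_rate_def \<phi>_def z_def log_def using that by (simp add: field_simps)
  have "\<exists>t. 0 < t \<and> t < 1 \<and> K 1 - K 0 = (1 - 0) * (\<mu> * (ln (z M t) + 1) + \<mu> * (ln (z (M * q\<^sup>2) t) + 1) - 2 * (\<mu> * (ln (z (M * q) t) + 1)))"
  proof (rule MVT2)
    fix t :: real assume "0 \<le> t" "t \<le> 1"
    then show "(K has_real_derivative \<mu> * (ln (z M t) + 1) + \<mu> * (ln (z (M * q\<^sup>2) t) + 1) - 2 * (\<mu> * (ln (z (M * q) t) + 1))) (at t)"
      unfolding K_def using M q by (intro DERIV_add DERIV_diff DERIV_cmult \<phi>') auto
  qed simp
  then obtain t where t: "0 < t" "t < 1" and K: "K 1 - K 0 = \<mu> * (ln (z M t) + ln (z (M * q\<^sup>2) t) - 2 * ln (z (M * q) t))"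
    by (auto simp: algebra_simps)
  have p: "0 < z M t" "0 < z (M * q\<^sup>2) t" "0 < z (M * q) t" using zpos t M q by auto
  have "z M t * z (M * q\<^sup>2) t - (z (M * q) t)\<^sup>2 = (1 - \<mu>) * \<mu> * M * t * (q - 1)\<^sup>2"
    by (simp add: z_def power2_eq_square algebra_simps)
  also have "\<dots> > 0" using \<mu> M t q by simp
  finally have "ln ((z (M * q) t)\<^sup>2) < ln (z M t * z (M * q\<^sup>2) t)" using p by simp
  then have "0 < K 1 - K 0" unfolding K using p \<mu> by (simp add: ln_mult ln_realpow)
  moreover have "K 1 - K 0 = (pure_rate \<mu> M + pure_rate \<mu> (M * q\<^sup>2) - 2 * pure_rate \<mu> (M * q)) * ln 2"
    using M q by (simp add: pr K_def field_simps)
  ultimately have "0 < (pure_rate \<mu> M + pure_rate \<mu> (M * q\<^sup>2) - 2 * pure_rate \<mu> (M * q)) * ln 2" by simp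
  then show ?thesis by (simp add: zero_less_mult_iff)
qed

text \<open>The recursion for powers starts with the identity on \<open>1\<close> by \<open>1\<close> matrices, which has to be
  absorbed.\<close>

lemma map_tensor_pow_two_depolarizing:
  "map_tensor_pow n n (depolarizing n \<mu>) 2 = map_tensor n n n n (depolarizing n \<mu>) (depolarizing n \<mu>)"
proof -
  have one: "map_tensor n n 1 1 (depolarizing n \<mu>) (\<lambda>X. X) X = depolarizing n \<mu> X" if X: "X \<in> carrier_mat n n" for X
  proof -
    have k: "kron A (1\<^sub>m 1) = A" if "A \<in> carrier_mat n n" for A using that by (intro eq_matI) (auto simp: kron_def)
    have "linear_on_units 1 1 (\<lambda>X. X)" by (auto simp: linear_on_units_def)
    from map_tensor_kron[OF linear_depolarizing this X, of "1\<^sub>m 1" \<mu>] show ?thesis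
      using X by (simp add: k del: One_nat_def)
  qed
  have "map_tensor_pow n n (depolarizing n \<mu>) 2 X = map_tensor n n n n (depolarizing n \<mu>) (depolarizing n \<mu>) X" for X
    unfolding numeral_2_eq_2 map_tensor_pow.simps
    by (simp add: map_tensor_def[of n n n n] one[simplified])
  then show ?thesis by (rule ext)
qed

theorem corollary1p5:
  fixes n d :: nat and \<mu> :: real
  assumes "n = 4" and "d = 2" and "0 < \<mu>" and "\<mu> < 1"
  shows "C_prod (n * n) (n * n) (d\<^sup>2)
           (map_tensor n n n n (depolarizing n \<mu>) (depolarizing n \<mu>)) >
         2 * C_prod n n d (depolarizing n \<mu>)
       \<and> C_reg n n d (depolarizing n \<mu>) > C_prod n n d (depolarizing n \<mu>)"
proof -
  let ?D = "depolarizing n \<mu>"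
  let ?C1 = "C_prod n n d ?D" and ?C2 = "C_prod (n * n) (n * n) (d\<^sup>2) (map_tensor n n n n ?D ?D)"
  have "?C1 \<le> ereal (pure_rate \<mu> (real (d * n)))" using assms by (intro C_prod_depolarizing_le) auto
  then have up: "?C1 \<le> ereal (pure_rate \<mu> 8)" using assms by simp
  have "d\<^sup>2 = n" using assms by simp
  then have "ereal (pure_rate \<mu> (real (n * n)) + pure_rate \<mu> (real n)) \<le> ?C2"
    using C_prod_two_depolarizing_ge[of n \<mu>] assms by simp
  then have low: "ereal (pure_rate \<mu> 16 + pure_rate \<mu> 4) \<le> ?C2" using assms by simp
  have gap: "2 * pure_rate \<mu> 8 < pure_rate \<mu> 16 + pure_rate \<mu> 4"
    using pure_rate_log_convex[of \<mu> 4 2] assms by simp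
  have "2 * ?C1 \<le> 2 * ereal (pure_rate \<mu> 8)" by (intro ereal_mult_left_mono up) auto
  also have "\<dots> = ereal (2 * pure_rate \<mu> 8)" by simp
  also have "\<dots> < ereal (pure_rate \<mu> 16 + pure_rate \<mu> 4)" using gap by simp
  also note low
  finally have first: "2 * ?C1 < ?C2" .
  have "?C1 \<le> ereal (pure_rate \<mu> 8)" by (rule up)
  also have "\<dots> < ereal ((pure_rate \<mu> 16 + pure_rate \<mu> 4) / 2)" using gap by simp
  also have "\<dots> = ereal (pure_rate \<mu> 16 + pure_rate \<mu> 4) / ereal (real 2)" by simp
  also have "\<dots> \<le> ?C2 / ereal (real 2)" by (intro ereal_divide_right_mono low) simp
  also have "\<dots> = C_prod (n ^ 2) (n ^ 2) (d ^ 2) (map_tensor_pow n n ?D 2) / ereal (real 2)"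
    by (simp only: map_tensor_pow_two_depolarizing power2_eq_square[of n])
  also have "\<dots> \<le> C_reg n n d ?D"
    unfolding C_reg_def by (rule SUP_upper) simp
  finally show ?thesis using first by blast
qed

end
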